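(* Let $\mathcal{S}$ be a finite set, $\boldsymbol{p}$ a probability distribution on $\mathcal{S}$, $Q$ an intensity matrix on $\mathcal{S}$, and $\mu_i\in\mathbb{R}$, $\sigma_i>0$ for $i\in\mathcal{S}$. Let $(\mathcal{R},\mathcal{J})$ and $\{(\mathcal{R}^n,\mathcal{J}^n)\}_{n\ge0}$ be the Markov-modulated Brownian motion and the stochastic fluid processes constructed in the context from these parameters on a common probability space $(\Omega,\mathscr{F},\mathbb{P})$, with $\lambda_n=\max\{\lambda_0,2n^2\}$ for $n\ge1$ (so $\lambda_n=2n^2$ for all large $n$). Fix $T\in[0,1)$. (i) For each $q>0$ there exists a constant $\alpha=\alpha(q)>0$ such that $$\mathbb{P}\left(\sup_{0\le s\le T}|R(s)-R^n(s)|>\alpha\,\varepsilon_n\right)=o(n^{-q})\quad\text{as } n\to\infty,$$ where $\varepsilon_n:=n^{-1/2}\log(n)$. (ii) Furthermore, the process $\{\pi_2(J^n(t))\}_{t\ge0}$ converges in an a.s. local uniform sense to $\{J(t)\}_{t\ge0}$; that is, $$\lim_{\rho\downarrow0}\left[\limsup_{n\to\infty}\left(\sup_{s\in(T-\rho,T+\rho),\,s\ge0}d\big(\pi_2(J^n(s)),J(s)\big)\right)\right]=0\quad\text{a.s.},$$ where $d(\cdot,\cdot)$ denotes the discrete metric on $\mathcal{S}$ and $\pi_2:\{+,-\}\times\mathcal{S}\to\mathcal{S}$ is the second-coordinate projection.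
   Context: Notation: $o(g(n))$, for $g:\mathbb{N}\to\mathbb{R}_+$, denotes a function $f:\mathbb{N}\to\mathbb{R}$ with $\lim_{n\to\infty}f(n)/g(n)=0$. An intensity matrix has nonnegative off-diagonal entries and zero row sums. Construction. Let $\lambda_0=2\max_{i\in\mathcal{S}}|Q_{ii}|$ (if $Q=0$, let $\lambda_0$ be any fixed positive number), and let $\{\lambda_n\}_{n\ge1}$ satisfy $\lambda_n\ge\lambda_{n-1}$ for $n\ge1$ and $\lambda_n\to\infty$. Let $(\Omega,\mathscr{F},\mathbb{P})$ support the following mutually independent objects: a standard Brownian motion $B$; a Poisson process $M^0$ of rate $\lambda_0/2$; Poisson processes $\widetilde M^n$, $n\ge1$, of rate $(\lambda_n-\lambda_{n-1})/2$ (no arrivals if the rate is $0$); a discrete-time Markov chain $\{X^0(k)\}_{k\ge0}$ on $\mathcal{S}$ with initial distribution $\boldsymbol{p}$ and transition matrix $P_0=I+(\lambda_0/2)^{-1}Q$. Define $$J(t)=X^0(M^0(t)),\qquad R(t)=\int_0^t\mu_{J(s)}\,ds+\int_0^t\sigma_{J(s)}\,dB(s),\qquad t\ge0.$$ Then $\mathcal{J}=\{J(t)\}$ is a Markov jump process with initial distribution $\boldsymbol{p}$ and intensity matrix $Q$, and $(\mathcal{R},\mathcal{J})$ is a Markov-modulated Brownian motion. For $n\ge0$ let $M^n$ be the superposition of $M^0,\widetilde M^1,\dots,\widetilde M^n$ (a Poisson process of rate $\lambda_n/2$), let $\theta^n_0=0$ and let $\theta^n_1<\theta^n_2<\cdots$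 be the arrival epochs of $M^n$. For $k\ge0$ put $X^n(k)=J(\theta^n_k)$, $$L^n_{k+1}=R(\theta^n_k)-\min_{\theta^n_k\le t\le\theta^n_{k+1}}R(t),\qquad H^n_{k+1}=R(\theta^n_{k+1})-\min_{\theta^n_k\le t\le\theta^n_{k+1}}R(t).$$ For $i\in\mathcal{S}$ set $$\omega^n_i=\sqrt{\frac{\mu_i^2}{\sigma_i^4}+\frac{\lambda_n}{\sigma_i^2}}+\frac{\mu_i}{\sigma_i^2},\qquad \eta^n_i=\sqrt{\frac{\mu_i^2}{\sigma_i^4}+\frac{\lambda_n}{\sigma_i^2}}-\frac{\mu_i}{\sigma_i^2}.$$ For $k\ge1$, if $X^n(k-1)=i$, set $\widehat L^n_k=\lambda_n^{-1}\omega^n_iL^n_k$ and $\widehat H^n_k=\lambda_n^{-1}\eta^n_iH^n_k$. Let $\chi^n_0=0$ and $\chi^n_k=\sum_{j=1}^k(\widehat L^n_j+\widehat H^n_j)$. Define $\mathcal{J}^n=\{J^n(t)\}_{t\ge0}$ with state space $\{+,-\}\times\mathcal{S}$ by: for $k\ge0$ with $X^n(k)=i$, $J^n(t)=(-,i)$ if $t\in[\chi^n_k,\chi^n_k+\widehat L^n_{k+1})$ and $J^n(t)=(+,i)$ if $t\in[\chi^n_k+\widehat L^n_{k+1},\chi^n_{k+1})$. Finally set $r^n(+,i)=\lambda_n/\eta^n_i$, $r^n(-,i)=-\lambda_n/\omega^n_i$, and $R^n(t)=\int_0^tr^n(J^n(s))\,ds$ for $t\ge0$. *)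

theory Defs
  imports "HOL-Probability.Probability" "HOL-Library.Landau_Symbols"
begin

section \<open>Driving processes\<close>

text \<open>Processes with time set \<open>[0,\<infinity>)\<close> are functions \<open>Z t \<omega>\<close> of a real time \<open>t\<close>; only the values at
  \<open>t \<ge> 0\<close> matter. Path properties are required almost surely.\<close>

text \<open>An infinite sequence of times covers every finite one (repeat the last time), and
  \<^const>\<open>prob_space.indep_vars\<close> is a condition on finite subfamilies.\<close>

definition (in prob_space) indep_increments ::
    "'v measure \<Rightarrow> (real \<Rightarrow> 'a \<Rightarrow> 'v::minus) \<Rightarrow> bool" where
  "indep_increments N Z \<longleftrightarrow>
     (\<forall>\<tau>::nat \<Rightarrow> real. 0 \<le> \<tau> 0 \<and> incseq \<tau> \<longrightarrow>
        indep_vars (\<lambda>_. N) (\<lambda>k \<omega>. Z (\<tau> (Suc k)) \<omega> - Z (\<tau> k) \<omega>) UNIV)"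

locale standard_brownian_motion = prob_space M for M :: "'w measure" +
  fixes B :: "real \<Rightarrow> 'w \<Rightarrow> real"
  assumes measurable_B: "0 \<le> t \<Longrightarrow> B t \<in> borel_measurable M"
    and B_0: "AE \<omega> in M. B 0 \<omega> = 0"
    and continuous_B: "AE \<omega> in M. continuous_on {0..} (\<lambda>t. B t \<omega>)"
    and indep_increments_B: "indep_increments borel B"
    and normal_increments_B: "0 \<le> s \<Longrightarrow> s < t \<Longrightarrow>
      distributed M lborel (\<lambda>\<omega>. B t \<omega> - B s \<omega>) (normal_density 0 (sqrt (t - s)))"

text \<open>Rate \<open>0\<close> is allowed and means no arrivals (\<open>0 ^ 0 = 1\<close>); \<^const>\<open>poisson_pmf\<close> requires a
  positive rate. Truncation of the subtraction on \<^typ>\<open>nat\<close> is harmless, as paths are almost surely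
  nondecreasing.\<close>

locale poisson_process = prob_space M for M :: "'w measure" +
  fixes N :: "real \<Rightarrow> 'w \<Rightarrow> nat" and rate :: real
  assumes rate_nonneg: "0 \<le> rate"
    and measurable_N: "0 \<le> t \<Longrightarrow> N t \<in> measurable M (count_space UNIV)"
    and N_0: "AE \<omega> in M. N 0 \<omega> = 0"
    and mono_N: "AE \<omega> in M. mono_on {0..} (\<lambda>t. N t \<omega>)"
    and right_continuous_N:
      "AE \<omega> in M. \<forall>t\<ge>0. continuous (at_right t) (\<lambda>s. real (N s \<omega>))"
    and indep_increments_N: "indep_increments (count_space UNIV) N"
    and poisson_increments_N: "0 \<le> s \<Longrightarrow> s \<le> t \<Longrightarrow>
      \<P>(\<omega> in M. N t \<omega> - N s \<omega> = k) = (rate * (t - s)) ^ k / fact k * exp (- (rate * (t - s)))"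

locale markov_chain = prob_space M for M :: "'w measure" +
  fixes X :: "nat \<Rightarrow> 'w \<Rightarrow> 's::finite" and p :: "'s pmf" and P :: "real ^ 's ^ 's"
  assumes measurable_X: "X k \<in> measurable M (count_space UNIV)"
    and initial_X: "\<P>(\<omega> in M. X 0 \<omega> = i) = pmf p i"
    and transition_X: "\<P>(\<omega> in M. \<forall>k\<le>n. X k \<omega> = x k) > 0 \<Longrightarrow>
      \<P>(\<omega> in M. X (Suc n) \<omega> = j \<bar> \<forall>k\<le>n. X k \<omega> = x k) = P $ x n $ j"

definition intensity_matrix :: "real ^ 's ^ 's \<Rightarrow> bool" where
  "intensity_matrix Q \<longleftrightarrow>
     (\<forall>i j. i \<noteq> j \<longrightarrow> 0 \<le> Q $ i $ j) \<and> (\<forall>i. (\<Sum>j\<in>UNIV. Q $ i $ j) = 0)"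

definition generated_events ::
    "'w measure \<Rightarrow> 't set \<Rightarrow> 'v measure \<Rightarrow> ('t \<Rightarrow> 'w \<Rightarrow> 'v) \<Rightarrow> 'w set set" where
  "generated_events M I N Z =
     sigma_sets (space M) {Z t -` A \<inter> space M | t A. t \<in> I \<and> A \<in> sets N}"

datatype driver = Brownian | Poisson nat | Chain

definition independent_drivers :: "'w measure \<Rightarrow> (real \<Rightarrow> 'w \<Rightarrow> real) \<Rightarrow>
    (nat \<Rightarrow> real \<Rightarrow> 'w \<Rightarrow> nat) \<Rightarrow> (nat \<Rightarrow> 'w \<Rightarrow> 's) \<Rightarrow> bool" where
  "independent_drivers M B N X \<longleftrightarrow> prob_space.indep_sets M
     (\<lambda>d. case d of
            Brownian \<Rightarrow> generated_events M {0..} borel B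
          | Poisson n \<Rightarrow> generated_events M {0..} (count_space UNIV) (N n)
          | Chain \<Rightarrow> generated_events M UNIV (count_space UNIV) X) UNIV"

section \<open>The Markov-modulated Brownian motion\<close>

text \<open>The constructions below act on single paths. They are meaningful for the almost surely occurring
  paths: continuous Brownian path, counting paths with unit jumps and infinitely many arrivals.\<close>

text \<open>\<open>arrival_epoch m k\<close> is the \<open>k\<close>-th arrival epoch of the counting path \<open>m\<close>, and
  \<open>arrival_epoch m 0 = 0\<close>.\<close>

definition arrival_epoch :: "(real \<Rightarrow> nat) \<Rightarrow> nat \<Rightarrow> real" where
  "arrival_epoch m k = Inf {t. 0 \<le> t \<and> k \<le> m t}"

text \<open>Stochastic integral over \<open>[0,t]\<close> of the simple predictable integrand with value \<open>h k\<close> on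
  \<open>(\<tau> k, \<tau> (Suc k)]\<close>, where \<open>0 = \<tau> 0 < \<tau> 1 < \<dots>\<close> tends to infinity.\<close>

definition simple_stochastic_integral ::
    "(nat \<Rightarrow> real) \<Rightarrow> (nat \<Rightarrow> real) \<Rightarrow> (real \<Rightarrow> real) \<Rightarrow> real \<Rightarrow> real" where
  "simple_stochastic_integral \<tau> h b t =
     (\<Sum>k | \<tau> k < t. h k * (b (min t (\<tau> (Suc k))) - b (\<tau> k)))"

definition mmbm_phase :: "(real \<Rightarrow> nat) \<Rightarrow> (nat \<Rightarrow> 's) \<Rightarrow> real \<Rightarrow> 's" where
  "mmbm_phase m x t = x (m t)"

text \<open>The integrand \<open>\<sigma>\<^bsub>J(s)\<^esub>\<close> is constant between consecutive arrivals of \<open>m\<close>, so that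
  \<open>\<integral> \<sigma>\<^bsub>J(s)\<^esub> dB(s)\<close> is the integral of a simple integrand (its left-continuous version).\<close>

definition mmbm_level :: "('s \<Rightarrow> real) \<Rightarrow> ('s \<Rightarrow> real) \<Rightarrow> (real \<Rightarrow> real) \<Rightarrow>
    (real \<Rightarrow> nat) \<Rightarrow> (nat \<Rightarrow> 's) \<Rightarrow> real \<Rightarrow> real" where
  "mmbm_level \<mu> \<sigma> b m x t =
     integral {0..t} (\<lambda>s. \<mu> (mmbm_phase m x s)) +
     simple_stochastic_integral (arrival_epoch m)
       (\<lambda>k. \<sigma> (mmbm_phase m x (arrival_epoch m k))) b t"

section \<open>The stochastic fluid processes\<close>

text \<open>Throughout, \<open>l\<close> stands for \<open>\<lambda>\<^sub>n\<close>, \<open>m\<close> for a path of \<open>M\<^sup>n\<close>, \<open>r\<close> for a path of \<open>R\<close> and \<open>j\<close> for a path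
  of \<open>J\<close>.\<close>

definition omega_rate :: "('s \<Rightarrow> real) \<Rightarrow> ('s \<Rightarrow> real) \<Rightarrow> real \<Rightarrow> 's \<Rightarrow> real" where
  "omega_rate \<mu> \<sigma> l i = sqrt ((\<mu> i)\<^sup>2 / (\<sigma> i)^4 + l / (\<sigma> i)\<^sup>2) + \<mu> i / (\<sigma> i)\<^sup>2"

definition eta_rate :: "('s \<Rightarrow> real) \<Rightarrow> ('s \<Rightarrow> real) \<Rightarrow> real \<Rightarrow> 's \<Rightarrow> real" where
  "eta_rate \<mu> \<sigma> l i = sqrt ((\<mu> i)\<^sup>2 / (\<sigma> i)^4 + l / (\<sigma> i)\<^sup>2) - \<mu> i / (\<sigma> i)\<^sup>2"

text \<open>The index is shifted: \<open>fluid_L m r k\<close>, \<open>fluid_H m r k\<close> and their scaled versions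
  \<open>fluid_Lhat\<close>, \<open>fluid_Hhat\<close> are the quantities with index \<open>k + 1\<close> in the
  usual notation; they belong to the interval from the \<open>k\<close>-th to the \<open>(k+1)\<close>-st epoch and to the
  state at its left end. The infimum is a minimum, as \<open>r\<close> is continuous.\<close>

definition fluid_L :: "(real \<Rightarrow> nat) \<Rightarrow> (real \<Rightarrow> real) \<Rightarrow> nat \<Rightarrow> real" where
  "fluid_L m r k = r (arrival_epoch m k) -
     (INF t\<in>{arrival_epoch m k..arrival_epoch m (Suc k)}. r t)"

definition fluid_H :: "(real \<Rightarrow> nat) \<Rightarrow> (real \<Rightarrow> real) \<Rightarrow> nat \<Rightarrow> real" where
  "fluid_H m r k = r (arrival_epoch m (Suc k)) -
     (INF t\<in>{arrival_epoch m k..arrival_epoch m (Suc k)}. r t)"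

definition fluid_Lhat :: "('s \<Rightarrow> real) \<Rightarrow> ('s \<Rightarrow> real) \<Rightarrow> real \<Rightarrow> (real \<Rightarrow> nat) \<Rightarrow>
    (real \<Rightarrow> real) \<Rightarrow> (real \<Rightarrow> 's) \<Rightarrow> nat \<Rightarrow> real" where
  "fluid_Lhat \<mu> \<sigma> l m r j k = omega_rate \<mu> \<sigma> l (j (arrival_epoch m k)) / l * fluid_L m r k"

definition fluid_Hhat :: "('s \<Rightarrow> real) \<Rightarrow> ('s \<Rightarrow> real) \<Rightarrow> real \<Rightarrow> (real \<Rightarrow> nat) \<Rightarrow>
    (real \<Rightarrow> real) \<Rightarrow> (real \<Rightarrow> 's) \<Rightarrow> nat \<Rightarrow> real" where
  "fluid_Hhat \<mu> \<sigma> l m r j k = eta_rate \<mu> \<sigma> l (j (arrival_epoch m k)) / l * fluid_H m r k"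

definition fluid_epoch :: "('s \<Rightarrow> real) \<Rightarrow> ('s \<Rightarrow> real) \<Rightarrow> real \<Rightarrow> (real \<Rightarrow> nat) \<Rightarrow>
    (real \<Rightarrow> real) \<Rightarrow> (real \<Rightarrow> 's) \<Rightarrow> nat \<Rightarrow> real" where
  "fluid_epoch \<mu> \<sigma> l m r j k =
     (\<Sum>i<k. fluid_Lhat \<mu> \<sigma> l m r j i + fluid_Hhat \<mu> \<sigma> l m r j i)"

datatype sign = Plus | Minus

definition fluid_phase :: "('s \<Rightarrow> real) \<Rightarrow> ('s \<Rightarrow> real) \<Rightarrow> real \<Rightarrow> (real \<Rightarrow> nat) \<Rightarrow>
    (real \<Rightarrow> real) \<Rightarrow> (real \<Rightarrow> 's) \<Rightarrow> real \<Rightarrow> sign \<times> 's" where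
  "fluid_phase \<mu> \<sigma> l m r j t =
     (let c = fluid_epoch \<mu> \<sigma> l m r j;
          k = (THE k. c k \<le> t \<and> t < c (Suc k))
      in (if t < c k + fluid_Lhat \<mu> \<sigma> l m r j k then Minus else Plus, j (arrival_epoch m k)))"

definition fluid_rate :: "('s \<Rightarrow> real) \<Rightarrow> ('s \<Rightarrow> real) \<Rightarrow> real \<Rightarrow> sign \<times> 's \<Rightarrow> real" where
  "fluid_rate \<mu> \<sigma> l a = (case a of
       (Plus, i) \<Rightarrow> l / eta_rate \<mu> \<sigma> l i
     | (Minus, i) \<Rightarrow> - (l / omega_rate \<mu> \<sigma> l i))"

definition fluid_level :: "('s \<Rightarrow> real) \<Rightarrow> ('s \<Rightarrow> real) \<Rightarrow> real \<Rightarrow> (real \<Rightarrow> nat) \<Rightarrow>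
    (real \<Rightarrow> real) \<Rightarrow> (real \<Rightarrow> 's) \<Rightarrow> real \<Rightarrow> real" where
  "fluid_level \<mu> \<sigma> l m r j t =
     integral {0..t} (\<lambda>s. fluid_rate \<mu> \<sigma> l (fluid_phase \<mu> \<sigma> l m r j s))"

end

theory Submission
  imports Defs "HOL-Real_Asymp.Real_Asymp"
begin

text \<open>
  Between two consecutive arrivals of \<open>M\<^sup>n\<close> the phase is constant, so \<open>L\<^sup>n\<close> is \<open>\<sigma>\<^sub>i\<close> times the fall of \<open>B\<close> on that
  interval, up to \<open>\<bar>\<mu>\<^sub>i\<bar>\<close> times its length. As \<open>H\<^sup>n - L\<^sup>n\<close> is an increment of \<open>R\<close> and
  \<open>\<omega>\<^sup>n\<sigma> + \<eta>\<^sup>n\<sigma> = 2 \<surd>\<lambda>\<^sub>n + O(1)\<close>, the epoch \<open>\<chi>\<^sup>n\<close> reached at time \<open>t\<close> is \<open>2 D / \<surd>\<lambda>\<^sub>n + O(log n / n)\<close>, where \<open>D\<close> is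
  the total fall of \<open>B\<close> up to \<open>t\<close>, restarted at every arrival; the increments of \<open>B\<close> that remain carry
  coefficients \<open>1 / \<surd>\<lambda>\<^sub>n + O(1 / \<lambda>\<^sub>n)\<close> and are summed by parts. The law of the phase process plays no role.

  Put \<open>\<gamma> = \<surd>\<lambda>\<^sub>n\<close> and \<open>r = \<lambda>\<^sub>n / 2\<close>. On a time grid the position of \<open>B\<close> above its minimum since the last
  arrival is approximated by a reflected walk \<open>W\<close> with restarts. With \<open>g(w) = 1 + s / (1 - s) exp (- \<gamma> w)\<close>,
  the product of \<open>g(W)\<close> and a weight that approximates \<open>exp (s \<gamma> D)\<close> is a supermartingale up to the factor
  \<open>exp (r t s / (1 - s))\<close>, and Fatou's lemma transfers the bound to \<open>D\<close>. Taking \<open>s = 1 / n\<close> and \<open>s = - 1 / n\<close>, the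
  epoch reached at time \<open>t\<close> is within \<open>O(log n / n)\<close> of \<open>t\<close>, for all \<open>t\<close> simultaneously, outside an event of
  probability \<open>O(n\<^sup>-\<^sup>q)\<close>. The same bound without restarts is a maximal inequality, which controls the
  oscillation of \<open>B\<close> over times \<open>O(log n / n)\<close> by \<open>O(n\<^sup>-\<^sup>1\<^sup>/\<^sup>2 log n)\<close>. As \<open>R\<^sup>n\<close> at \<open>\<chi>\<^sup>n\<close> equals \<open>R\<close> at the
  corresponding arrival, this gives (i); Borel--Cantelli gives (ii).
\<close>

subsection \<open>Running falls of a path and their discretisation\<close>

text \<open>The falls belong to intervals with random endpoints, and treating them one by one would
  call for the strong Markov property at every arrival. On a deterministic grid a step is an
  increment of \<open>B\<close> together with the indicator that no arrival occurred, and
  independence is only required over fixed times.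

  A weight that agrees with exp (s \<gamma> y) to first order suffices because undershoots, unlike
  increments of \<open>B\<close>, are nonnegative with a bounded sum: their squares add up to at
  most this sum times the largest undershoot, which vanishes as the grid is refined.

  The size 1 / n of s is dictated by r = n^2. In r t s / (1 - s) = r t s + r t s^2 + ... the first
  term is the centring n t of \<open>sqrt 2 * D\<close>, and 1 / n is the largest order of s for
  which the rest stays bounded. Deviations of order log n then have polynomially small probability,
  and division by n gives the precision log n / n of the clock. Over such a time \<open>B\<close>
  moves by sqrt (log n / n), times a further sqrt (log n) for a polynomial tail: this is the rate in
  (i).\<close>

definition fall :: "(real \<Rightarrow> real) \<Rightarrow> real \<Rightarrow> real \<Rightarrow> real" where
  "fall f a c = f a - (INF t\<in>{a..c}. f t)"

lemma fall_ex:
  assumes "continuous_on {a..c} f" "a \<le> c"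
  shows "\<exists>u\<in>{a..c}. (\<forall>v\<in>{a..c}. f u \<le> f v) \<and> fall f a c = f a - f u"
proof -
  obtain u where u: "u \<in> {a..c}" "\<forall>v\<in>{a..c}. f u \<le> f v"
    using continuous_attains_inf[of "{a..c}" f] assms by auto
  have "(INF t\<in>{a..c}. f t) = f u"
    using u by (intro cInf_eq_minimum) auto
  then show ?thesis using u by (auto simp: fall_def)
qed

lemma fall_ge:
  assumes "continuous_on {a..c} f" "v \<in> {a..c}"
  shows "f a - f v \<le> fall f a c"
  using fall_ex[OF assms(1)] assms(2) by fastforce

text \<open>Right continuity of an integer-valued path is local constancy to the right. Jumps may
  have any size: simultaneous arrivals of superposed processes appear as equal epochs, with
  intervals of length zero between them.\<close>

locale counting_path =
  fixes m :: "real \<Rightarrow> nat"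
  assumes m_0: "m 0 = 0"
    and m_mono: "0 \<le> s \<Longrightarrow> s \<le> t \<Longrightarrow> m s \<le> m t"
    and m_right: "0 \<le> t \<Longrightarrow> \<exists>e>0. \<forall>s. t \<le> s \<longrightarrow> s < t + e \<longrightarrow> m s = m t"
begin

abbreviation "ep \<equiv> arrival_epoch m"

lemma ep_0: "ep 0 = 0"
  unfolding arrival_epoch_def by (rule cInf_eq_minimum) auto

lemma ep_le:
  assumes "0 \<le> t" "k \<le> m t" shows "ep k \<le> t"
  unfolding arrival_epoch_def using assms by (intro cInf_lower bdd_belowI[of _ 0]) auto

lemma ep_ge_0: assumes "0 \<le> t" "k \<le> m t" shows "0 \<le> ep k"
  unfolding arrival_epoch_def using assms by (intro cInf_greatest) auto

text \<open>Local constancy makes the infimum a minimum: some time with count at least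
  \<open>k\<close> lies so close to \<open>ep k\<close> that both carry the same count.\<close>

lemma m_ep: assumes "0 \<le> t" "k \<le> m t" shows "k \<le> m (ep k)"
proof -
  have e0: "0 \<le> ep k" using ep_ge_0 assms by blast
  obtain e where e: "e > 0" "\<And>s. ep k \<le> s \<Longrightarrow> s < ep k + e \<Longrightarrow> m s = m (ep k)"
    using m_right[OF e0] by blast
  have ne: "{t. 0 \<le> t \<and> k \<le> m t} \<noteq> {}" using assms by auto
  have "Inf {t. 0 \<le> t \<and> k \<le> m t} < ep k + e" using e by (simp add: arrival_epoch_def)
  then obtain s where s: "0 \<le> s" "k \<le> m s" "s < ep k + e"
    using cInf_lessD[OF ne] by blast
  with e(2)[of s] ep_le[of s k] show ?thesis by simp
qed

lemma ep_mono: assumes "0 \<le> t" "l \<le> m t" "k \<le> l" shows "ep k \<le> ep l"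
  using ep_le[of "ep l" k] m_ep[of t l] ep_ge_0[of t l] assms by auto

lemma less_ep: "0 \<le> t \<Longrightarrow> t < ep k \<Longrightarrow> m t < k"
  using ep_le[of t k] by (meson leD not_le_imp_less)

lemma ep_bounds:
  assumes "0 \<le> s" "s \<le> t" "m s < k" "k \<le> m t" shows "s \<le> ep k" "ep k \<le> t"
proof -
  show "ep k \<le> t" using assms ep_le by auto
  show "s \<le> ep k"
  proof (rule ccontr)
    assume "\<not> s \<le> ep k"
    then have "m (ep k) \<le> m s" using ep_ge_0[of t k] assms by (intro m_mono) auto
    with m_ep[of t k] assms show False by auto
  qed
qed

end

text \<open>As a function of its right end, each summand is the Skorokhod regulator that keeps the
  path started at 0 nonnegative; the total is this regulator accumulated over restarts at all
  arrivals.\<close>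

definition total_fall :: "(real \<Rightarrow> real) \<Rightarrow> (real \<Rightarrow> nat) \<Rightarrow> real \<Rightarrow> real" where
  "total_fall b m t = (\<Sum>k<m t. fall b (arrival_epoch m k) (arrival_epoch m (Suc k)))
     + fall b (arrival_epoch m (m t)) t"

text \<open>A step is a pair of an increment and a mark, 1 for no arrival and 0 for an arrival with
  restart at 0. The mark is a real number so that it can multiply exponentials when moments are
  computed.\<close>

definition reflect :: "real \<Rightarrow> real \<times> real \<Rightarrow> real" where
  "reflect w v = (if snd v = 1 then max (w + fst v) 0 else 0)"

definition undershoot :: "real \<Rightarrow> real \<times> real \<Rightarrow> real" where
  "undershoot w v = (if snd v = 1 then max (- (w + fst v)) 0 else 0)"

primrec walk :: "(nat \<Rightarrow> real \<times> real) \<Rightarrow> nat \<Rightarrow> real" where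
  "walk v 0 = 0"
| "walk v (Suc j) = reflect (walk v j) (v j)"

definition path_steps :: "(real \<Rightarrow> real) \<Rightarrow> (real \<Rightarrow> nat) \<Rightarrow> real \<Rightarrow> nat \<Rightarrow> real \<times> real" where
  "path_steps b m d j = (b (real (Suc j) * d) - b (real j * d),
     if m (real (Suc j) * d) = m (real j * d) then 1 else 0)"

lemma walk_nonneg: "0 \<le> walk v j"
  by (induction j) (auto simp: reflect_def)

lemma undershoot_nonneg: "0 \<le> undershoot w v"
  by (auto simp: undershoot_def)

text \<open>The minimum over the long interval is attained in one of the two halves. The second form
  speaks of the height above the running minimum and is the continuous counterpart of the recursion
  \<open>max (w + x) 0\<close>.\<close>

lemma fall_extend:
  assumes "continuous_on {a..c} f" "a \<le> b" "b \<le> c"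
  shows "fall f a c = max (fall f a b) (f a - f b + fall f b c)"
    "f c - f a + fall f a c = max (f c - f b + (f b - f a + fall f a b)) (f c - f b + fall f b c)"
proof -
  have c: "continuous_on {a..b} f" "continuous_on {b..c} f"
    using assms by (auto intro: continuous_on_subset)
  obtain u where u: "u \<in> {a..c}" "\<And>v. v \<in> {a..c} \<Longrightarrow> f u \<le> f v" "fall f a c = f a - f u"
    using fall_ex[OF assms(1)] assms by fastforce
  obtain v where v: "v \<in> {a..b}" "\<And>w. w \<in> {a..b} \<Longrightarrow> f v \<le> f w" "fall f a b = f a - f v"
    using fall_ex[OF c(1)] assms by fastforce
  obtain x where x: "x \<in> {b..c}" "\<And>w. w \<in> {b..c} \<Longrightarrow> f x \<le> f w" "fall f b c = f b - f x"
    using fall_ex[OF c(2)] assms by fastforce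
  have "f u \<le> f v" "f u \<le> f x" using u v x assms by auto
  moreover have "f u = f v \<or> f u = f x"
    using u v x assms by (cases "u \<le> b") (auto intro!: antisym)
  ultimately show "fall f a c = max (fall f a b) (f a - f b + fall f b c)"
    "f c - f a + fall f a c = max (f c - f b + (f b - f a + fall f a b)) (f c - f b + fall f b c)"
    using u v x by auto
qed

lemma fall_bounds:
  assumes "continuous_on {a..c} f" "a \<le> c" "\<And>u. u \<in> {a..c} \<Longrightarrow> \<bar>f u - f a\<bar> \<le> e"
  shows "0 \<le> fall f a c" "fall f a c \<le> e"
proof -
  obtain u where u: "u \<in> {a..c}" "\<And>v. v \<in> {a..c} \<Longrightarrow> f u \<le> f v" "fall f a c = f a - f u"
    using fall_ex[OF assms(1,2)] by blast
  show "0 \<le> fall f a c" "fall f a c \<le> e"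
    using u(2)[of a] u(3) assms(2) assms(3)[OF u(1)] by auto
qed

lemma fall_nonneg:
  assumes "continuous_on {a..c} f" "a \<le> c" shows "0 \<le> fall f a c"
  using fall_ge[OF assms(1), of a] assms(2) by simp

section \<open>Falls of a continuous path compared with the undershoots of its reflected
  walk\<close>

locale driving_path = counting_path m for m +
  fixes b :: "real \<Rightarrow> real"
  assumes cont_b: "continuous_on {0..} b"
begin

text \<open>\<open>W\<close> is the height above the minimum since the last arrival. Its running
  fall is the same as the last summand of \<open>D\<close>, hence cancels in
  \<open>D t - W t\<close>.\<close>

abbreviation "W t \<equiv> b t - b (ep (m t)) + fall b (ep (m t)) t"
abbreviation "D t \<equiv> total_fall b m t"

lemma cont_sub: "0 \<le> s \<Longrightarrow> continuous_on {s..t} b"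
  by (rule continuous_on_subset[OF cont_b]) auto

lemma current_ep: "0 \<le> t \<Longrightarrow> 0 \<le> ep (m t) \<and> ep (m t) \<le> t"
  using ep_ge_0[of t "m t"] ep_le[of t "m t"] by auto

text \<open>At most m t - m s + 1 pieces of intervals meet [s, t], and each adds at most
  \<open>e\<close> to the fall. The third claim is the exact cancellation in \<open>D - W\<close>;
  in the fourth, the last arrival lies in [s, t], so that the position and the minimum differ by no
  more than the oscillation there.\<close>

lemma D_increment:
  assumes "0 \<le> s" "s \<le> t" and osc: "\<And>u v. u \<in> {s..t} \<Longrightarrow> v \<in> {s..t} \<Longrightarrow> \<bar>b u - b v\<bar> \<le> e"
  shows "D s \<le> D t" "D t \<le> D s + e * (real (m t - m s) + 1)"
    "m s = m t \<Longrightarrow> D t - W t = D s - W s - b t + b s"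
    "m s \<noteq> m t \<Longrightarrow> W t \<in> {0..e}" 
proof -
  have e: "0 \<le> e" using osc[of s s] assms by auto
  have c: "continuous_on {u..v} b" if "0 \<le> u" for u v using cont_sub that by auto
  have s: "0 \<le> ep (m s)" "ep (m s) \<le> s" and t: "0 \<le> ep (m t)" "ep (m t) \<le> t"
    using current_ep assms by auto
  have fo: "0 \<le> fall b u v" "fall b u v \<le> e" if "s \<le> u" "u \<le> v" "v \<le> t" for u v
    using fall_bounds[OF c, of u v e] that assms(1) osc[of _ u] by auto
  { assume eq: "m s = m t"
    show "D t - W t = D s - W s - b t + b s"
      unfolding total_fall_def eq by simp }
  { assume ne: "m s \<noteq> m t"
    then have lt: "m s < m t" using m_mono assms by (simp add: le_neq_implies_less)
    have st: "s \<le> ep (m t)" using ep_bounds(1)[of s t "m t"] assms lt by auto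
    obtain u where u: "u \<in> {ep (m t)..t}" "\<And>v. v \<in> {ep (m t)..t} \<Longrightarrow> b u \<le> b v"
       "fall b (ep (m t)) t = b (ep (m t)) - b u"
      using fall_ex[OF c[OF t(1)] t(2)] by blast
    show "W t \<in> {0..e}" using u(1) u(2)[of t] u(3) osc[of t u] st t by auto
    }
  show 12: "D s \<le> D t" "D t \<le> D s + e * (real (m t - m s) + 1)"
  proof -
    have "D s \<le> D t \<and> D t \<le> D s + e * (real (m t - m s) + 1)"
    proof (cases "m s = m t")
      case True
      have "fall b (ep (m s)) t = max (fall b (ep (m s)) s) (b (ep (m s)) - b s + fall b s t)"
        using fall_extend(1)[OF c, of "ep (m s)" s t] s assms by simp
      moreover have "fall b s t \<le> e" using fo assms by auto
      moreover have "b (ep (m s)) - b s \<le> fall b (ep (m s)) s"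
        using fall_ge[OF c[OF s(1)]] s by simp
      ultimately show ?thesis using True e by (auto simp: total_fall_def)
    next
      case False
      then have lt: "m s < m t" using m_mono assms by (simp add: le_neq_implies_less)
      define k where "k = m s"
      have kb: "s \<le> ep (Suc k)" "ep (Suc k) \<le> t"
        using ep_bounds[of s t "Suc k"] assms lt by (auto simp: k_def)
      have 1: "fall b (ep k) s \<le> fall b (ep k) (ep (Suc k))"
              "fall b (ep k) (ep (Suc k)) \<le> fall b (ep k) s + e"
      proof -
        have "fall b (ep k) (ep (Suc k)) = max (fall b (ep k) s) (b (ep k) - b s + fall b s (ep (Suc k)))"
          using fall_extend(1)[OF c, of "ep k" s "ep (Suc k)"] s kb assms by (simp add: k_def)
        moreover have "b (ep k) - b s \<le> fall b (ep k) s"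
          using fall_ge[OF c[OF s(1)]] s by (simp add: k_def)
        moreover have "fall b s (ep (Suc k)) \<le> e" using fo kb by auto
        ultimately show "fall b (ep k) s \<le> fall b (ep k) (ep (Suc k))"
              "fall b (ep k) (ep (Suc k)) \<le> fall b (ep k) s + e" using e by auto
      qed
      have 2: "fall b (ep i) (ep (Suc i)) \<in> {0..e}" if "i \<in> {Suc k..<m t}" for i
      proof -
        have "s \<le> ep i" "ep (Suc i) \<le> t" "ep i \<le> ep (Suc i)"
          using ep_bounds[of s t i] ep_bounds[of s t "Suc i"] ep_mono[of t "Suc i" i] that assms
          by (auto simp: k_def)
        then show ?thesis using fo[of "ep i" "ep (Suc i)"] by auto
      qed
      have 3: "fall b (ep (m t)) t \<in> {0..e}"
        using fo[of "ep (m t)" t] ep_bounds[of s t "m t"] assms lt t by auto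
      have split: "(\<Sum>i<m t. fall b (ep i) (ep (Suc i))) = (\<Sum>i<k. fall b (ep i) (ep (Suc i)))
         + fall b (ep k) (ep (Suc k)) + (\<Sum>i=Suc k..<m t. fall b (ep i) (ep (Suc i)))"
      proof -
        have "(\<Sum>i<Suc k. fall b (ep i) (ep (Suc i))) + (\<Sum>i=Suc k..<m t. fall b (ep i) (ep (Suc i)))
          = (\<Sum>i<m t. fall b (ep i) (ep (Suc i)))"
          unfolding lessThan_atLeast0 using lt by (intro sum.atLeastLessThan_concat) (auto simp: k_def)
        then show ?thesis by simp
      qed
      have 4: "0 \<le> (\<Sum>i=Suc k..<m t. fall b (ep i) (ep (Suc i)))"
        using 2 by (intro sum_nonneg) auto
      have 5: "(\<Sum>i=Suc k..<m t. fall b (ep i) (ep (Suc i))) \<le> (\<Sum>i=Suc k..<m t. e)"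
        using 2 by (intro sum_mono) auto
      have 6: "(\<Sum>i=Suc k..<m t. e) = e * (real (m t - m s) - 1)"
        using lt by (simp add: k_def algebra_simps of_nat_diff)
      have Ds: "D s = (\<Sum>i<k. fall b (ep i) (ep (Suc i))) + fall b (ep k) s"
        by (simp add: total_fall_def k_def)
      have Dt: "D t = (\<Sum>i<k. fall b (ep i) (ep (Suc i)))
         + fall b (ep k) (ep (Suc k)) + (\<Sum>i=Suc k..<m t. fall b (ep i) (ep (Suc i))) + fall b (ep (m t)) t"
        by (simp add: total_fall_def split)
      have a1: "D s \<le> D t" using 1(1) 3 4 unfolding Ds Dt by auto
      have "D t - D s \<le> e + e * (real (m t - m s) - 1) + e"
        using 1(2) 3 5 6 unfolding Ds Dt by (simp only: atLeastAtMost_iff) linarith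
      then have a2: "D t \<le> D s + e * (real (m t - m s) + 1)" by (simp add: algebra_simps)
      from a1 a2 show ?thesis by blast
    qed
    then show "D s \<le> D t" "D t \<le> D s + e * (real (m t - m s) + 1)" by auto
  qed
qed

lemma D_mono: assumes "0 \<le> s" "s \<le> t" shows "D s \<le> D t"
proof -
  have "compact (b ` {s..t})" using cont_sub[OF assms(1)] by (intro compact_continuous_image) auto
  then obtain e where e: "\<And>x. x \<in> b ` {s..t} \<Longrightarrow> norm x \<le> e" using compact_imp_bounded bounded_iff by metis
  have "\<bar>b u - b v\<bar> \<le> 2 * e" if "u \<in> {s..t}" "v \<in> {s..t}" for u v
    using e[of "b u"] e[of "b v"] that by auto
  then show ?thesis using D_increment(1)[OF assms] by blast
qed

lemma D_0: "D 0 = 0" "W 0 = 0"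
  by (simp_all add: total_fall_def m_0 ep_0 fall_def)

text \<open>Two invariants are carried along the grid. The heights \<open>walk\<close> and
  \<open>W\<close> stay within \<open>e\<close> because the recursions differ only in a lower
  barrier between 0 and \<open>e\<close>. On a step without arrival, undershoot sum minus
  \<open>walk\<close> and \<open>D - W\<close> change by the same amount, so the second discrepancy
  grows only with arrivals and not with the number of grid points.\<close>

lemma discretised_fall:
  assumes d: "0 \<le> d" and t: "\<And>j. j < K \<Longrightarrow> real (Suc j) * d \<le> t"
    and osc: "\<And>u v. 0 \<le> u \<Longrightarrow> u \<le> v \<Longrightarrow> v \<le> t \<Longrightarrow> v - u \<le> d \<Longrightarrow> \<bar>b u - b v\<bar> \<le> e"
  defines "v \<equiv> path_steps b m d"
  shows "j \<le> K \<Longrightarrow> 0 \<le> t \<Longrightarrow> \<bar>(\<Sum>i<j. undershoot (walk v i) (v i)) - D (real j * d)\<bar> \<le> (4 * real (m (real j * d)) + 1) * e"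
proof -
  assume "j \<le> K" "0 \<le> t"
  define S where "S j = (\<Sum>i<j. undershoot (walk v i) (v i))" for j
  have e0: "0 \<le> e" using osc[of 0 0] \<open>0 \<le> t\<close> d by auto
  have main: "\<bar>walk v j - W (real j * d)\<bar> \<le> e \<and>
    \<bar>(S j - D (real j * d)) - (walk v j - W (real j * d))\<bar> \<le> 4 * e * real (m (real j * d))"
    using \<open>j \<le> K\<close>
  proof (induction j)
    case 0 then show ?case using D_0 by (simp add: S_def e0 m_0)
  next
    case (Suc j)
    define s u where "s = real j * d" and "u = real (Suc j) * d"
    have su: "0 \<le> s" "s \<le> u" "u - s \<le> d" "u \<le> t"
      using d t[of j] Suc.prems by (auto simp: s_def u_def algebra_simps)
    have o: "\<bar>b x - b y\<bar> \<le> e" if "x \<in> {s..u}" "y \<in> {s..u}" for x y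
    proof (cases "x \<le> y")
      case True then show ?thesis using osc[of x y] su that by auto
    next
      case False then show ?thesis using osc[of y x] su that by (auto simp: abs_minus_commute)
    qed
    note DI = D_increment[OF su(1,2) o]
    have IH: "\<bar>walk v j - W s\<bar> \<le> e" "\<bar>(S j - D s) - (walk v j - W s)\<bar> \<le> 4 * e * real (m s)"
      using Suc by (auto simp: s_def)
    have vj: "v j = (b u - b s, if m u = m s then 1 else 0)"
      by (simp add: v_def path_steps_def s_def u_def)
    have Sj: "S (Suc j) = S j + undershoot (walk v j) (v j)" by (simp add: S_def)
    show ?case
    proof (cases "m s = m u")
      case True
      have w: "walk v (Suc j) = max (walk v j + (b u - b s)) 0"
        using True by (simp add: vj reflect_def)
      have dr: "undershoot (walk v j) (v j) = max (- (walk v j + (b u - b s))) 0"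
        using True by (simp add: vj undershoot_def)
      have "W u = max (W s + b u - b s) (b u - b s + fall b s u)"
        using fall_extend(2)[OF cont_sub, of "ep (m s)" s u] True current_ep[OF su(1)] su by simp
      moreover have "0 \<le> b u - b s + fall b s u \<and> b u - b s + fall b s u \<le> e"
      proof -
        obtain z where z: "z \<in> {s..u}" "\<And>v. v \<in> {s..u} \<Longrightarrow> b z \<le> b v" "fall b s u = b s - b z"
          using fall_ex[OF cont_sub[OF su(1)] su(2)] by blast
        then show ?thesis using o[of u z] su by fastforce
      qed
      ultimately have 1: "\<bar>walk v (Suc j) - W u\<bar> \<le> e" using IH(1) w by auto
      have "S (Suc j) - walk v (Suc j) = S j - walk v j - (b u - b s)"
        unfolding Sj w dr by auto
      then have "(S (Suc j) - D u) - (walk v (Suc j) - W u) = (S j - D s) - (walk v j - W s)"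
        using DI(3)[OF _ _ True] by simp
      with 1 IH(2) True show ?thesis unfolding u_def[symmetric] by (simp del: walk.simps)
    next
      case False
      then have ms: "m s < m u" using m_mono su by (simp add: le_neq_implies_less)
      have w: "walk v (Suc j) = 0" and dr: "undershoot (walk v j) (v j) = 0"
        using False by (auto simp: vj reflect_def undershoot_def)
      have wu: "0 \<le> W u" "W u \<le> e" using DI(4)[OF _ _ False] by auto
      have Du: "D s \<le> D u" "D u \<le> D s + e * (real (m u - m s) + 1)" using DI(1,2) by auto
      have S': "S (Suc j) = S j" using Sj dr by simp
      \<comment> \<open>A step with k >= 1 arrivals costs at most e (k + 1) for the fall and e for
        the height at either end; k + 3 <= 4 k explains the factor 4.\<close>
      have "e * (real (m u - m s) + 1) + 2 * e \<le> 4 * e * (real (m u) - real (m s))"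
      proof -
        have "3 * e * 1 \<le> 3 * e * (real (m u) - real (m s))"
          using e0 ms by (intro mult_left_mono) auto
        then show ?thesis using ms by (simp add: of_nat_diff algebra_simps)
      qed
      then have "\<bar>(S (Suc j) - D u) - (walk v (Suc j) - W u)\<bar> \<le> 4 * e * real (m u)"
        using IH wu Du unfolding S' w by (simp add: algebra_simps) 
      then show ?thesis using w wu unfolding u_def[symmetric] by (simp del: walk.simps)
    qed
  qed
  then have "\<bar>S j - D (real j * d)\<bar> \<le> 4 * e * real (m (real j * d)) + e" by linarith
  then show ?thesis unfolding S_def by (simp add: algebra_simps)
qed

end

subsection \<open>The reflected random walk\<close>

text \<open>The function \<open>g(w) = barrier s \<gamma> w\<close> solves \<open>g''(w) / 2 + r (g(0) - g(w)) = \<rho>\<close> with \<open>r = \<gamma>\<^sup>2 / 2\<close>,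
  \<open>\<rho> = r s / (1 - s)\<close> and the boundary condition \<open>g'(0) = - s \<gamma> g(0)\<close> of a reflected Brownian motion that restarts
  at rate \<open>r\<close> and is weighted by \<open>exp (s \<gamma> fall)\<close>.\<close>

definition barrier :: "real \<Rightarrow> real \<Rightarrow> real \<Rightarrow> real" where
  "barrier s \<gamma> w = 1 + s / (1 - s) * exp (- (\<gamma> * w))"

definition undershoot_weight :: "real \<Rightarrow> real \<Rightarrow> real \<Rightarrow> real" where
  "undershoot_weight s \<gamma> y = max 0 (1 + s * (exp (\<gamma> * y) - 1))"

text \<open>The weight is chosen such that \<open>barrier s \<gamma> 0 * undershoot_weight s \<gamma> y\<close> continues the barrier to
  the argument \<open>- y\<close>, apart from the cut at \<open>0\<close>, which only matters for \<open>s < 0\<close> and is paid for by the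
  last term of the following growth factor. It equals \<open>exp (s \<gamma> y)\<close> up to second order in \<open>y\<close>.\<close>

definition step_growth :: "real \<Rightarrow> real \<Rightarrow> real \<Rightarrow> real \<Rightarrow> real \<Rightarrow> real" where
  "step_growth s \<gamma> r p d = exp ((\<gamma>\<^sup>2 / 2 - r) * d) + s / (1 - s) * (1 - exp (- (r * d)))
     + 2 * (max 0 (- (s / (1 - s))) powr p * exp (p\<^sup>2 * \<gamma>\<^sup>2 * d / 2))"

lemma undershoot_weight_nonneg: "0 \<le> undershoot_weight s \<gamma> y"
  by (simp add: undershoot_weight_def)

lemma barrier_bounds:
  assumes "\<bar>s\<bar> \<le> 1/2" "0 \<le> \<gamma>" "0 \<le> w"
  shows "1/2 \<le> barrier s \<gamma> w" "0 < s \<Longrightarrow> 1 \<le> barrier s \<gamma> w" "s \<le> 0 \<Longrightarrow> barrier s \<gamma> w \<le> 1"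
    "barrier s \<gamma> w \<le> 2"
proof -
  have e: "0 < exp (- (\<gamma> * w))" "exp (- (\<gamma> * w)) \<le> 1" using assms by auto
  have B: "- (1/2) \<le> s / (1 - s)" "s / (1 - s) \<le> 1" using assms by (auto simp: field_simps)
  have "\<bar>s / (1 - s) * exp (- (\<gamma> * w))\<bar> \<le> \<bar>s / (1 - s)\<bar> * 1"
    unfolding abs_mult using e by (intro mult_left_mono) auto
  moreover have "s > 0 \<Longrightarrow> s / (1 - s) * exp (- (\<gamma> * w)) \<ge> 0"
    using assms by (intro mult_nonneg_nonneg divide_nonneg_nonneg) auto
  moreover have "s \<le> 0 \<Longrightarrow> s / (1 - s) * exp (- (\<gamma> * w)) \<le> 0"
    using assms by (intro mult_nonpos_nonneg divide_nonpos_nonneg) auto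
  moreover have "s > 0 \<Longrightarrow> s / (1 - s) \<ge> 0" "s \<le> 0 \<Longrightarrow> s / (1 - s) \<le> 0"
    using assms by (auto simp: divide_nonpos_nonneg)
  ultimately show "1/2 \<le> barrier s \<gamma> w" "0 < s \<Longrightarrow> 1 \<le> barrier s \<gamma> w"
    "s \<le> 0 \<Longrightarrow> barrier s \<gamma> w \<le> 1" "barrier s \<gamma> w \<le> 2"
    unfolding barrier_def using B by (cases "s > 0"; linarith)+
qed

text \<open>Without arrival and with v = exp (- \<gamma> (w + x)), the left side is at most max 0 (1
  + B v), whether or not the walk is reflected, because (1 + B) (1 + s (v - 1)) = 1 + B v.
  Everything on the right is linear in exponentials of the increment, so that its expectation is
  explicit.\<close>

lemma step_pointwise:
  assumes s: "\<bar>s\<bar> \<le> 1/2" and g: "0 < \<gamma>" and p: "1 \<le> p" and w: "0 \<le> w" and a: "a = 0 \<or> a = 1"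
  defines "B \<equiv> s / (1 - s)"
  shows "barrier s \<gamma> (reflect w (x, a)) * undershoot_weight s \<gamma> (undershoot w (x, a)) \<le>
    a + B * exp (- (\<gamma> * w)) * (a * exp (- \<gamma> * x))
      + max 0 (- B) powr p * exp (- (p * \<gamma> * w)) * (a * exp (- (p * \<gamma>) * x)) + (1 - a) * (1 + B)"
proof (cases "a = 1")
  case False
  then have "a = 0" using a by simp
  then show ?thesis by (simp add: reflect_def undershoot_def barrier_def undershoot_weight_def B_def)
next
  case True
  define z where "z = w + x"
  define v where "v = exp (- (\<gamma> * z))"
  have v: "v > 0" by (simp add: v_def)
  have e: "exp (- (\<gamma> * w)) * exp (- \<gamma> * x) = v" "exp (- (p * \<gamma> * w)) * exp (- (p * \<gamma>) * x) = v powr p"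
    by (simp_all add: v_def z_def powr_def exp_add[symmetric] algebra_simps)
  have B1: "1 + B = 1 / (1 - s)" using s by (simp add: B_def field_simps)
  have lhs: "barrier s \<gamma> (reflect w (x, a)) * undershoot_weight s \<gamma> (undershoot w (x, a)) \<le> max 0 (1 + B * v)"
  proof (cases "0 \<le> z")
    case z: True
    then have "barrier s \<gamma> (reflect w (x, a)) * undershoot_weight s \<gamma> (undershoot w (x, a)) = 1 + B * v"
      using True by (simp add: reflect_def undershoot_def barrier_def undershoot_weight_def B_def v_def z_def)
    then show ?thesis by simp
  next
    case z: False
    have "barrier s \<gamma> (reflect w (x, a)) * undershoot_weight s \<gamma> (undershoot w (x, a)) = (1 + B) * max 0 (1 + s * (v - 1))"
      using True z by (simp add: reflect_def undershoot_def barrier_def undershoot_weight_def B_def v_def z_def algebra_simps)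
    also have "\<dots> = max 0 ((1 + B) * (1 + s * (v - 1)))"
      using s by (subst max_mult_distrib_left) (auto simp: B1)
    also have "(1 + B) * (1 + s * (v - 1)) = 1 + B * v"
      using s unfolding B1 by (simp add: B_def field_simps)
    finally show ?thesis by simp
  qed
  have "max 0 (1 + B * v) \<le> 1 + B * v + (max 0 (- B) * v) powr p"
  proof (cases "1 + B * v \<ge> 0")
    case False
    then have b: "B < 0" using v by (smt (verit) mult_nonneg_nonneg)
    then have "1 \<le> - B * v" using False by simp
    \<comment> \<open>The cut at 0 acts only if - B v >= 1, and then any power with exponent at
      least 1 dominates - B v. A large exponent later makes this term negligible.\<close>
    then have "(- B * v) powr 1 \<le> (- B * v) powr p" using p by (intro powr_mono) auto
    then show ?thesis using False b \<open>1 \<le> - B * v\<close> by simp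
  qed simp
  also have "(max 0 (- B) * v) powr p = max 0 (- B) powr p * v powr p"
    using v by (subst powr_mult) auto
  also have "\<dots> = max 0 (- B) powr p * (exp (- (p * \<gamma> * w)) * exp (- (p * \<gamma>) * x))" using e by simp
  finally have "max 0 (1 + B * v) \<le> 1 + B * v + max 0 (- B) powr p * (exp (- (p * \<gamma> * w)) * exp (- (p * \<gamma>) * x))"
    by simp
  from order_trans[OF lhs this] show ?thesis using True by (simp add: e(1)[symmetric] mult.assoc)
qed

text \<open>The bound of \<open>step_pointwise\<close> combines the killed exponential moments at
  \<theta> = 0, - \<gamma> and - p \<gamma>. Turning its expectation into a multiple of the barrier
  uses that the barrier is at least 1/2 and lies on the side of 1 prescribed by the sign of
  \<open>s\<close>.\<close>

lemma (in prob_space) step_expectation: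
  fixes V :: "'a \<Rightarrow> real \<times> real"
  assumes s: "\<bar>s\<bar> \<le> 1/2" and g: "0 < \<gamma>" and p: "1 \<le> p" and w: "0 \<le> w" and d: "0 \<le> d"
    and a: "\<And>\<omega>. snd (V \<omega>) = 0 \<or> snd (V \<omega>) = 1"
    and r: "0 \<le> r" "r \<le> \<gamma>\<^sup>2 / 2" "0 < s \<or> r = \<gamma>\<^sup>2 / 2"
    and mgf: "\<And>\<theta>. has_bochner_integral M (\<lambda>\<omega>. snd (V \<omega>) * exp (\<theta> * fst (V \<omega>))) (exp (- (r * d)) * exp (\<theta>\<^sup>2 * d / 2))"
  shows "(\<integral>\<^sup>+\<omega>. ennreal (barrier s \<gamma> (reflect w (V \<omega>)) * undershoot_weight s \<gamma> (undershoot w (V \<omega>))) \<partial>M)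
    \<le> ennreal (step_growth s \<gamma> r p d * barrier s \<gamma> w)"
proof -
  define B where "B = s / (1 - s)"
  define q where "q = exp (- (r * d))"
  define c where "c = max 0 (- B) powr p"
  define E1 E2 where "E1 = exp (\<gamma>\<^sup>2 * d / 2)" and "E2 = exp ((p * \<gamma>)\<^sup>2 * d / 2)"
  define f where "f \<omega> = snd (V \<omega>) + B * exp (- (\<gamma> * w)) * (snd (V \<omega>) * exp (- \<gamma> * fst (V \<omega>)))
      + c * exp (- (p * \<gamma> * w)) * (snd (V \<omega>) * exp (- (p * \<gamma>) * fst (V \<omega>))) + (1 - snd (V \<omega>)) * (1 + B)" for \<omega>
  have m0: "has_bochner_integral M (\<lambda>\<omega>. snd (V \<omega>)) q" using mgf[of 0] by (simp add: q_def)
  have m1: "has_bochner_integral M (\<lambda>\<omega>. snd (V \<omega>) * exp (- \<gamma> * fst (V \<omega>))) (q * E1)"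
    using mgf[of "- \<gamma>"] by (simp add: q_def E1_def)
  have m2: "has_bochner_integral M (\<lambda>\<omega>. snd (V \<omega>) * exp (- (p * \<gamma>) * fst (V \<omega>))) (q * E2)"
    using mgf[of "- (p * \<gamma>)"] by (simp add: q_def E2_def)
  have f: "has_bochner_integral M f (q + B * exp (- (\<gamma> * w)) * (q * E1)
      + c * exp (- (p * \<gamma> * w)) * (q * E2) + (1 - q) * (1 + B))"
  proof -
    have 1: "has_bochner_integral M (\<lambda>\<omega>. 1 :: real) 1"
      using has_bochner_integral_integrable[of M "\<lambda>_. 1::real"] by (simp add: prob_space)
    show ?thesis unfolding f_def
      by (intro has_bochner_integral_add has_bochner_integral_mult_left has_bochner_integral_mult_right
          has_bochner_integral_diff 1 m0 m1 m2)
  qed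
  have le: "barrier s \<gamma> (reflect w (V \<omega>)) * undershoot_weight s \<gamma> (undershoot w (V \<omega>)) \<le> f \<omega>" for \<omega>
    using step_pointwise[OF s g p w a[of \<omega>], of "fst (V \<omega>)"] by (simp add: f_def B_def c_def)
  have st: "0 \<le> reflect w v" for v by (auto simp: reflect_def)
  have bp: "0 \<le> barrier s \<gamma> (reflect w v)" for v
    using barrier_bounds(1)[OF s less_imp_le[OF g] st, of v] by simp
  have f0: "0 \<le> f \<omega>" for \<omega>
    by (rule order_trans[OF mult_nonneg_nonneg[OF bp undershoot_weight_nonneg] le])
  have "(\<integral>\<^sup>+\<omega>. ennreal (barrier s \<gamma> (reflect w (V \<omega>)) * undershoot_weight s \<gamma> (undershoot w (V \<omega>))) \<partial>M)
     \<le> (\<integral>\<^sup>+\<omega>. ennreal (f \<omega>) \<partial>M)"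
    by (intro nn_integral_mono ennreal_leI le)
  also have "\<dots> = ennreal (q + B * exp (- (\<gamma> * w)) * (q * E1)
      + c * exp (- (p * \<gamma> * w)) * (q * E2) + (1 - q) * (1 + B))"
    using f f0 by (subst nn_integral_eq_integral) (auto simp: has_bochner_integral_iff)
  also have "\<dots> \<le> ennreal (step_growth s \<gamma> r p d * barrier s \<gamma> w)"
  proof (rule ennreal_leI)
    define e where "e = exp (- (\<gamma> * w))"
    define G where "G = barrier s \<gamma> w"
    define k where "k = exp ((\<gamma>\<^sup>2 / 2 - r) * d)"
    have G: "G = 1 + B * e" by (simp add: G_def barrier_def B_def e_def)
    have Gb: "1/2 \<le> G" "0 < s \<Longrightarrow> 1 \<le> G" "s \<le> 0 \<Longrightarrow> G \<le> 1"
      using barrier_bounds[OF s _ w, of \<gamma>] g by (auto simp: G_def)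
    have q: "0 < q" "q \<le> 1" using r d by (auto simp: q_def)
    have kq: "q * E1 = k" by (simp add: k_def q_def E1_def exp_add[symmetric] algebra_simps)
    have k1: "1 \<le> k" using r d by (simp add: k_def)
    have c0: "0 \<le> c" by (simp add: c_def)
    have sg: "step_growth s \<gamma> r p d = k + B * (1 - q) + 2 * (c * E2)"
      by (simp add: step_growth_def k_def B_def q_def c_def E2_def power_mult_distrib)
    have t3: "c * exp (- (p * \<gamma> * w)) * (q * E2) \<le> 2 * (c * E2) * G"
    proof -
      have "exp (- (p * \<gamma> * w)) * q \<le> 1 * 1" using p g w q by (intro mult_mono) auto
      then have "(c * E2) * (exp (- (p * \<gamma> * w)) * q) \<le> (c * E2) * 1"
        using c0 by (intro mult_left_mono) (auto simp: E2_def)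
      also have "\<dots> \<le> (c * E2) * (2 * G)" using Gb(1) c0 by (intro mult_left_mono) (auto simp: E2_def)
      finally show ?thesis by (simp add: mult_ac)
    qed
    have t1: "1 + B * e * k \<le> k * G"
      using k1 unfolding G by (simp add: algebra_simps)
    have t2: "B * (1 - q) \<le> B * (1 - q) * G"
    proof (cases "0 < s")
      case True
      then have "0 \<le> B * (1 - q)" using q s by (simp add: B_def)
      then show ?thesis using Gb(2)[OF True] mult_left_mono[of 1 G "B * (1 - q)"] by simp
    next
      case False
      then have "B * (1 - q) \<le> 0" using q s by (simp add: B_def divide_nonpos_nonneg mult_nonpos_nonneg)
      then show ?thesis using Gb(3) False mult_left_mono_neg[of G 1 "B * (1 - q)"] by simp
    qed
    have "q + B * e * (q * E1) + c * exp (- (p * \<gamma> * w)) * (q * E2) + (1 - q) * (1 + B)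
      = (1 + B * e * k) + B * (1 - q) + c * exp (- (p * \<gamma> * w)) * (q * E2)"
      unfolding kq by (simp add: algebra_simps)
    also have "\<dots> \<le> k * G + B * (1 - q) * G + 2 * (c * E2) * G"
      using t1 t2 t3 by linarith
    also have "\<dots> = step_growth s \<gamma> r p d * G" unfolding sg by (simp add: algebra_simps)
    finally show "q + B * exp (- (\<gamma> * w)) * (q * E1) + c * exp (- (p * \<gamma> * w)) * (q * E2) + (1 - q) * (1 + B)
      \<le> step_growth s \<gamma> r p d * barrier s \<gamma> w" by (simp add: e_def G_def)
  qed
  finally show ?thesis .
qed

section \<open>Measurability and expectation of the weighted walk\<close>

lemma measurable_reflect [measurable]: "(\<lambda>x. reflect (fst x) (snd x)) \<in> borel_measurable (borel \<Otimes>\<^sub>M (borel \<Otimes>\<^sub>M borel))"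
  unfolding reflect_def by measurable

lemma measurable_undershoot [measurable]: "(\<lambda>x. undershoot (fst x) (snd x)) \<in> borel_measurable (borel \<Otimes>\<^sub>M (borel \<Otimes>\<^sub>M borel))"
  unfolding undershoot_def by measurable

lemma measurable_walk:
  assumes "\<And>i. i < j \<Longrightarrow> (\<lambda>x. f x i) \<in> measurable N (borel \<Otimes>\<^sub>M borel)"
  shows "(\<lambda>x. walk (f x) j) \<in> borel_measurable N"
  using assms
proof (induction j)
  case (Suc j)
  have "(\<lambda>x. (walk (f x) j, f x j)) \<in> measurable N (borel \<Otimes>\<^sub>M (borel \<Otimes>\<^sub>M borel))"
    using Suc by (intro measurable_Pair) auto
  from measurable_compose[OF this measurable_reflect] show ?case by simp
qed simp

lemma measurable_walk_undershoot:
  assumes "\<And>i. i \<le> j \<Longrightarrow> (\<lambda>x. f x i) \<in> measurable N (borel \<Otimes>\<^sub>M borel)"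
  shows "(\<lambda>x. undershoot (walk (f x) j) (f x j)) \<in> borel_measurable N"
proof -
  have "(\<lambda>x. (walk (f x) j, f x j)) \<in> measurable N (borel \<Otimes>\<^sub>M (borel \<Otimes>\<^sub>M borel))"
    using assms by (intro measurable_Pair measurable_walk) auto
  from measurable_compose[OF this measurable_undershoot] show ?thesis by simp
qed

lemma borel_measurable_barrier [measurable]: "barrier s \<gamma> \<in> borel_measurable borel"
  unfolding barrier_def by measurable

lemma borel_measurable_undershoot_weight [measurable]: "undershoot_weight s \<gamma> \<in> borel_measurable borel"
  unfolding undershoot_weight_def by measurable

lemma walk_cong: "(\<And>i. i < j \<Longrightarrow> v i = u i) \<Longrightarrow> walk v j = walk u j"
  by (induction j) auto

text \<open>Position and weight after k steps are functions of the first k steps, hence independent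
  of the next step; by Fubini the position may be frozen, and the one-step hypothesis applies to
  each frozen value.\<close>

lemma (in prob_space) walk_supermartingale:
  fixes V :: "nat \<Rightarrow> 'a \<Rightarrow> real \<times> real"
  assumes indep: "indep_vars (\<lambda>_. borel \<Otimes>\<^sub>M borel) V UNIV"
    and rho: "0 \<le> \<rho>"
    and s: "\<bar>s\<bar> \<le> 1/2" and g: "0 < \<gamma>"
    and reflect: "\<And>j w. 0 \<le> w \<Longrightarrow> (\<integral>\<^sup>+\<omega>. ennreal (barrier s \<gamma> (reflect w (V j \<omega>)) * undershoot_weight s \<gamma> (undershoot w (V j \<omega>))) \<partial>M)
       \<le> ennreal (\<rho> * barrier s \<gamma> w)"
  shows "(\<integral>\<^sup>+\<omega>. ennreal (barrier s \<gamma> (walk (\<lambda>i. V i \<omega>) k) *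
       (\<Prod>j<k. undershoot_weight s \<gamma> (undershoot (walk (\<lambda>i. V i \<omega>) j) (V j \<omega>)))) \<partial>M)
    \<le> ennreal (\<rho> ^ k * barrier s \<gamma> 0)"
proof (induction k)
  case 0 show ?case by (simp add: emeasure_space_1)
next
  case (Suc k)
  let ?N = "borel \<Otimes>\<^sub>M borel :: (real \<times> real) measure"
  have [measurable]: "V j \<in> measurable M ?N" for j using indep by (auto simp: indep_vars_def)
  define A where "A = PiM {..<k} (\<lambda>_. ?N)"
  \<comment> \<open>\<open>Pst\<close> reads only coordinates below \<open>k\<close>, so it may be
    evaluated on the restricted sequence, which is a point of the product space.\<close>
  define Pst where "Pst f = (walk f k, \<Prod>j<k. undershoot_weight s \<gamma> (undershoot (walk f j) (f j)))" for f
  have Pst_meas: "Pst \<in> measurable A (borel \<Otimes>\<^sub>M borel)"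
    unfolding Pst_def A_def
    by (intro measurable_Pair measurable_walk borel_measurable_prod
        measurable_compose[OF measurable_walk_undershoot borel_measurable_undershoot_weight])
       (auto intro!: measurable_component_singleton)
  have "indep_var (PiM {..<k} (\<lambda>_. ?N)) (\<lambda>\<omega>. restrict (\<lambda>i. V i \<omega>) {..<k})
      (PiM {k} (\<lambda>_. ?N)) (\<lambda>\<omega>. restrict (\<lambda>i. V i \<omega>) {k})"
    by (rule indep_var_restrict[OF indep]) auto
  from indep_var_compose[OF this Pst_meas[unfolded A_def] measurable_component_singleton[of k "{k}" "\<lambda>_. ?N"]]
  have ind: "indep_var (borel \<Otimes>\<^sub>M borel) (\<lambda>\<omega>. Pst (restrict (\<lambda>i. V i \<omega>) {..<k})) ?N (V k)"
    by (simp add: comp_def)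
  have Pst_eq: "Pst (restrict (\<lambda>i. V i \<omega>) {..<k}) = Pst (\<lambda>i. V i \<omega>)" for \<omega>
    unfolding Pst_def using walk_cong[of _ "restrict (\<lambda>i. V i \<omega>) {..<k}" "\<lambda>i. V i \<omega>"]
    by (auto intro!: prod.cong)
  define Z where "Z \<omega> = Pst (\<lambda>i. V i \<omega>)" for \<omega>
  have indZ: "indep_var (borel \<Otimes>\<^sub>M borel) Z ?N (V k)" using ind by (simp add: Pst_eq Z_def[abs_def])
  have [measurable]: "Z \<in> measurable M (borel \<Otimes>\<^sub>M borel)" using indZ by (rule indep_var_rv1)
  have dist: "distr M ((borel \<Otimes>\<^sub>M borel) \<Otimes>\<^sub>M ?N) (\<lambda>\<omega>. (Z \<omega>, V k \<omega>)) =
     distr M (borel \<Otimes>\<^sub>M borel) Z \<Otimes>\<^sub>M distr M ?N (V k)"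
    using indZ by (simp add: indep_var_distribution_eq)
  define F where "F zv = ennreal (snd (fst zv) * (barrier s \<gamma> (reflect (fst (fst zv)) (snd zv))
     * undershoot_weight s \<gamma> (undershoot (fst (fst zv)) (snd zv))))" for zv :: "(real \<times> real) \<times> (real \<times> real)"
  have [measurable]: "F \<in> borel_measurable ((borel \<Otimes>\<^sub>M borel) \<Otimes>\<^sub>M ?N)"
  proof -
    have [measurable]: "(\<lambda>zv. reflect (fst (fst zv)) (snd zv)) \<in> borel_measurable ((borel \<Otimes>\<^sub>M borel) \<Otimes>\<^sub>M ?N)"
      "(\<lambda>zv. undershoot (fst (fst zv)) (snd zv)) \<in> borel_measurable ((borel \<Otimes>\<^sub>M borel) \<Otimes>\<^sub>M ?N)"
      unfolding reflect_def undershoot_def by measurable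
    show ?thesis unfolding F_def by measurable
  qed
  interpret DV: prob_space "distr M ?N (V k)" by (rule prob_space_distr) simp
  have Z0: "0 \<le> fst (Z \<omega>)" "0 \<le> snd (Z \<omega>)" for \<omega>
    by (auto simp: Z_def Pst_def walk_nonneg intro!: prod_nonneg undershoot_weight_nonneg)
  have "(\<integral>\<^sup>+\<omega>. ennreal (barrier s \<gamma> (walk (\<lambda>i. V i \<omega>) (Suc k)) *
       (\<Prod>j<Suc k. undershoot_weight s \<gamma> (undershoot (walk (\<lambda>i. V i \<omega>) j) (V j \<omega>)))) \<partial>M)
     = (\<integral>\<^sup>+\<omega>. F (Z \<omega>, V k \<omega>) \<partial>M)"
    by (simp add: F_def Z_def Pst_def mult_ac)
  also have "\<dots> = (\<integral>\<^sup>+zv. F zv \<partial>(distr M (borel \<Otimes>\<^sub>M borel) Z \<Otimes>\<^sub>M distr M ?N (V k)))"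
    by (subst dist[symmetric], subst nn_integral_distr) auto
  also have "\<dots> = (\<integral>\<^sup>+z. \<integral>\<^sup>+v. F (z, v) \<partial>distr M ?N (V k) \<partial>distr M (borel \<Otimes>\<^sub>M borel) Z)"
    by (subst DV.nn_integral_fst[symmetric]) auto
  also have "\<dots> = (\<integral>\<^sup>+\<omega>. \<integral>\<^sup>+\<omega>'. F (Z \<omega>, V k \<omega>') \<partial>M \<partial>M)"
    by (subst nn_integral_distr) (auto simp: nn_integral_distr)
  also have "\<dots> \<le> (\<integral>\<^sup>+\<omega>. ennreal (\<rho> * (barrier s \<gamma> (fst (Z \<omega>)) * snd (Z \<omega>))) \<partial>M)"
  proof (rule nn_integral_mono)
    fix \<omega> assume "\<omega> \<in> space M"
    have "(\<integral>\<^sup>+\<omega>'. F (Z \<omega>, V k \<omega>') \<partial>M) = (\<integral>\<^sup>+\<omega>'. ennreal (snd (Z \<omega>)) *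
       ennreal (barrier s \<gamma> (reflect (fst (Z \<omega>)) (V k \<omega>')) * undershoot_weight s \<gamma> (undershoot (fst (Z \<omega>)) (V k \<omega>'))) \<partial>M)"
      using Z0 by (simp add: F_def ennreal_mult')
    also have "\<dots> = ennreal (snd (Z \<omega>)) * (\<integral>\<^sup>+\<omega>'.
       ennreal (barrier s \<gamma> (reflect (fst (Z \<omega>)) (V k \<omega>')) * undershoot_weight s \<gamma> (undershoot (fst (Z \<omega>)) (V k \<omega>'))) \<partial>M)"
      unfolding reflect_def undershoot_def by (rule nn_integral_cmult) measurable
    also have "\<dots> \<le> ennreal (snd (Z \<omega>)) * ennreal (\<rho> * barrier s \<gamma> (fst (Z \<omega>)))"
      by (intro mult_left_mono reflect Z0) auto
    also have "\<dots> = ennreal (\<rho> * (barrier s \<gamma> (fst (Z \<omega>)) * snd (Z \<omega>)))"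
      using Z0 by (simp add: ennreal_mult'[symmetric] mult_ac)
    finally show "(\<integral>\<^sup>+\<omega>'. F (Z \<omega>, V k \<omega>') \<partial>M) \<le> ennreal (\<rho> * (barrier s \<gamma> (fst (Z \<omega>)) * snd (Z \<omega>)))" .
  qed
  also have "\<dots> = ennreal \<rho> * (\<integral>\<^sup>+\<omega>. ennreal (barrier s \<gamma> (fst (Z \<omega>)) * snd (Z \<omega>)) \<partial>M)"
    using rho by (subst nn_integral_cmult[symmetric]) (auto simp: ennreal_mult'[symmetric])
  also have "\<dots> \<le> ennreal \<rho> * ennreal (\<rho> ^ k * barrier s \<gamma> 0)"
    using Suc by (intro mult_left_mono) (auto simp: Z_def Pst_def)
  also have "\<dots> = ennreal (\<rho> ^ Suc k * barrier s \<gamma> 0)"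
    using rho by (simp add: ennreal_mult'[symmetric] mult_ac)
  finally show ?case .
qed

subsection \<open>Exponential tails of the total fall\<close>

text \<open>For s >= 0 this rests on ln (1 + x) >= x - x^2, for s < 0 on ln (1 - v) >= - v - 2 v^2
  with v = - s (exp (\<gamma> y) - 1). The constant 3 covers both signs.\<close>

lemma undershoot_weight_lower:
  assumes s: "\<bar>s\<bar> \<le> 1/2" and x: "0 \<le> \<gamma> * y" "\<gamma> * y \<le> 1/4"
  shows "exp (s * \<gamma> * y - 3 * (\<gamma> * y)\<^sup>2) \<le> undershoot_weight s \<gamma> y"
proof -
  define x where "x = \<gamma> * y"
  have x0: "0 \<le> x" "x \<le> 1/4" using x by (auto simp: x_def)
  have e1: "1 + x \<le> exp x" by simp
  have e2: "exp x \<le> 1 + x + x\<^sup>2" using x0 by (intro exp_bound) auto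
  have x2: "0 \<le> x\<^sup>2" "x\<^sup>2 \<le> x * (1/4)" using x0 mult_left_mono[of x "1/4" x] by (auto simp: power2_eq_square)
  have "exp (s * x - 3 * x\<^sup>2) \<le> 1 + s * (exp x - 1)"
  proof (cases "0 \<le> s")
    case True
    have sx: "0 \<le> s * x" "s * x \<le> x / 2"
      using True x0 s mult_right_mono[of s "1/2" x] by (auto intro!: mult_nonneg_nonneg)
    have "(s * x)\<^sup>2 \<le> 3 * x\<^sup>2"
      using power_mono[of "s * x" x 2] sx x0 zero_le_power2[of x] by linarith
    then have "s * x - 3 * x\<^sup>2 \<le> s * x - (s * x)\<^sup>2" by simp
    also have "\<dots> \<le> ln (1 + s * x)" using sx x0 by (intro ln_one_plus_pos_lower_bound) auto
    finally have "exp (s * x - 3 * x\<^sup>2) \<le> exp (ln (1 + s * x))" by simp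
    also have "\<dots> = 1 + s * x" using sx by simp
    also have "\<dots> \<le> 1 + s * (exp x - 1)" using True mult_left_mono[of x "exp x - 1" s] e1 by linarith
    finally show ?thesis .
  next
    case False
    define u where "u = - s"
    have u: "0 \<le> u" "u \<le> 1/2" using False s by (auto simp: u_def)
    define v where "v = u * (exp x - 1)"
    have v0: "0 \<le> v" using u e1 x0 by (auto simp: v_def)
    have v1: "v \<le> u * x + x\<^sup>2 / 2"
    proof -
      have "v \<le> u * (x + x\<^sup>2)" using u e2 by (auto simp: v_def intro!: mult_left_mono)
      moreover have "u * x\<^sup>2 \<le> (1/2) * x\<^sup>2" using u by (intro mult_right_mono) auto
      ultimately show ?thesis by (simp add: algebra_simps)
    qed
    have v2: "v \<le> x"
    proof -
      have "u * x \<le> (1/2) * x" using u x0 by (intro mult_right_mono) auto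
      then show ?thesis using v1 x2 x0 by simp
    qed
    have "v\<^sup>2 \<le> x\<^sup>2" using v0 v2 by (intro power_mono) auto
    then have "s * x - 3 * x\<^sup>2 \<le> - v - 2 * v\<^sup>2" using v1 zero_le_power2[of x] unfolding u_def by linarith
    also have "\<dots> \<le> ln (1 - v)" using v0 v2 x0 by (intro ln_one_minus_pos_lower_bound) auto
    finally have "exp (s * x - 3 * x\<^sup>2) \<le> exp (ln (1 - v))" by simp
    also have "\<dots> = 1 - v" using v2 x0 by simp
    also have "\<dots> = 1 + s * (exp x - 1)" by (simp add: v_def u_def algebra_simps)
    finally show ?thesis .
  qed
  then show ?thesis by (simp add: undershoot_weight_def x_def mult.assoc)
qed

lemma undershoot_le: "0 \<le> w \<Longrightarrow> undershoot w v \<le> \<bar>fst v\<bar>"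
  by (auto simp: undershoot_def)

text \<open>If \<open>e\<close> bounds the oscillation over one grid step, no undershoot exceeds
  \<open>e\<close>, so the squares lost in \<open>undershoot_weight_lower\<close> sum to at most
  \<open>e\<close> times the undershoot sum, which itself is close to \<open>D t\<close>. All losses
  in the exponent are proportional to \<open>e\<close>.\<close>

lemma (in driving_path) weight_product_lower:
  assumes t: "0 < t" and s: "\<bar>s\<bar> \<le> 1/2" and g: "0 < \<gamma>" and c: "c < exp (s * \<gamma> * D t)"
  shows "\<forall>\<^sub>F n in sequentially. c < (\<Prod>j<Suc n. undershoot_weight s \<gamma>
    (undershoot (walk (path_steps b m (t / real (Suc n))) j) (path_steps b m (t / real (Suc n)) j)))"
proof -
  define N where "N = 4 * real (m t) + 1"
  \<comment> \<open>The first summand pays for replacing the undershoot sum by \<open>D t\<close>,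
    the second for the quadratic losses; \<open>D t + N\<close> bounds the undershoot sum when e <
    1.\<close>
  define k where "k = \<bar>s\<bar> * \<gamma> * N + 3 * \<gamma>\<^sup>2 * (D t + N)"
  have "((\<lambda>e. exp (s * \<gamma> * D t - k * e)) \<longlongrightarrow> exp (s * \<gamma> * D t - k * 0)) (at_right 0)"
    by (intro tendsto_intros)
  then have "\<forall>\<^sub>F e in at_right 0. c < exp (s * \<gamma> * D t - k * e)"
    using c by (auto intro: order_tendstoD(1))
  moreover have "\<forall>\<^sub>F e::real in at_right 0. e < 1" "\<forall>\<^sub>F e in at_right 0. e < 1 / (4 * \<gamma>)"
    using g by (auto intro!: order_tendstoD(2)[OF tendsto_ident_at])
  moreover have "\<forall>\<^sub>F e::real in at_right 0. 0 < e" by (rule eventually_at_right_less)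
  ultimately have "\<forall>\<^sub>F e in at_right 0. c < exp (s * \<gamma> * D t - k * e) \<and> e < 1 \<and> e < 1 / (4 * \<gamma>) \<and> 0 < e"
    by eventually_elim auto
  \<comment> \<open>The condition e < 1 / (4 \<gamma>) puts all undershoots into the range of
    \<open>undershoot_weight_lower\<close>.\<close>
  then obtain e where e: "c < exp (s * \<gamma> * D t - k * e)" "e < 1" "e < 1 / (4 * \<gamma>)" "0 < e"
    using eventually_happens[of _ "at_right (0::real)"] by auto
  have "uniformly_continuous_on {0..t} b"
    by (intro compact_uniformly_continuous cont_sub) auto
  then obtain h where h: "h > 0" "\<And>u v. u \<in> {0..t} \<Longrightarrow> v \<in> {0..t} \<Longrightarrow> dist v u < h \<Longrightarrow> dist (b v) (b u) < e"
    unfolding uniformly_continuous_on_def using e(4) by blast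
  have "(\<lambda>n. t / real (Suc n)) \<longlonglongrightarrow> 0" by real_asymp
  then have "\<forall>\<^sub>F n in sequentially. t / real (Suc n) < h" using h(1) by (rule order_tendstoD(2))
  then show ?thesis
  proof eventually_elim
    case (elim n)
    define d where "d = t / real (Suc n)"
    have d: "0 < d" "d < h" using t elim by (auto simp: d_def)
    define v where "v = path_steps b m d"
    have grid: "real (Suc j) * d \<le> t" if "j < Suc n" for j
    proof -
      have "real (Suc j) * d \<le> real (Suc n) * d" using that d by (intro mult_right_mono) auto
      then show ?thesis by (simp add: d_def)
    qed
    have osc: "\<bar>b u - b w\<bar> \<le> e" if "0 \<le> u" "u \<le> w" "w \<le> t" "w - u \<le> d" for u w
      using h(2)[of u w] that d by (auto simp: dist_real_def)
    define S where "S = (\<Sum>i<Suc n. undershoot (walk v i) (v i))"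
    have "real (Suc n) * d = t" by (simp add: d_def)
    then have S: "\<bar>S - D t\<bar> \<le> N * e"
      using discretised_fall[of d "Suc n" t e "Suc n"] grid osc t d
      by (simp add: S_def v_def N_def)
    have u1: "0 \<le> undershoot (walk v j) (v j)" for j by (rule undershoot_nonneg)
    have u2: "undershoot (walk v j) (v j) \<le> e" if "j < Suc n" for j
    proof -
      have "undershoot (walk v j) (v j) \<le> \<bar>fst (v j)\<bar>" using walk_nonneg by (rule undershoot_le)
      also have "\<dots> \<le> e"
        using osc[of "real j * d" "real (Suc j) * d"] grid[OF that] d
        by (auto simp: v_def path_steps_def algebra_simps)
      finally show ?thesis .
    qed
    have S0: "0 \<le> S" unfolding S_def by (intro sum_nonneg u1)
    have "s * \<gamma> * D t - k * e \<le> s * \<gamma> * S - 3 * \<gamma>\<^sup>2 * e * S"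
    proof -
      have "s * \<gamma> * (D t - S) \<le> \<bar>s * \<gamma>\<bar> * (N * e)"
        using S abs_mult[of "s * \<gamma>" "D t - S"] mult_left_mono[of "\<bar>D t - S\<bar>" "N * e" "\<bar>s * \<gamma>\<bar>"]
        by (simp add: abs_minus_commute)
      moreover have "N * e \<le> N" using e by (simp add: N_def)
      then have "S \<le> D t + N" using S by linarith
      then have "3 * \<gamma>\<^sup>2 * e * S \<le> 3 * \<gamma>\<^sup>2 * e * (D t + N)" using e by (intro mult_left_mono) auto
      ultimately show ?thesis using g by (simp add: k_def abs_mult algebra_simps)
    qed
    also have "\<dots> \<le> (\<Sum>j<Suc n. s * \<gamma> * undershoot (walk v j) (v j) - 3 * (\<gamma> * undershoot (walk v j) (v j))\<^sup>2)"
    proof -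
      have "(\<Sum>j<Suc n. (undershoot (walk v j) (v j))\<^sup>2) \<le> (\<Sum>j<Suc n. e * undershoot (walk v j) (v j))"
        using u1 u2 by (intro sum_mono) (auto simp: power2_eq_square intro!: mult_right_mono)
      also have "\<dots> = e * S" unfolding S_def by (simp only: sum_distrib_left)
      finally have "3 * \<gamma>\<^sup>2 * (\<Sum>j<Suc n. (undershoot (walk v j) (v j))\<^sup>2) \<le> 3 * \<gamma>\<^sup>2 * (e * S)"
        by (intro mult_left_mono) auto
      then show ?thesis
        unfolding sum_subtractf by (simp only: S_def power_mult_distrib sum_distrib_left mult.assoc)
    qed
    finally have "exp (s * \<gamma> * D t - k * e) \<le>
       exp (\<Sum>j<Suc n. s * \<gamma> * undershoot (walk v j) (v j) - 3 * (\<gamma> * undershoot (walk v j) (v j))\<^sup>2)" by simp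
    also have "\<dots> = (\<Prod>j<Suc n. exp (s * \<gamma> * undershoot (walk v j) (v j) - 3 * (\<gamma> * undershoot (walk v j) (v j))\<^sup>2))"
      by (rule exp_sum) simp
    also have "\<dots> \<le> (\<Prod>j<Suc n. undershoot_weight s \<gamma> (undershoot (walk v j) (v j)))"
    proof (intro prod_mono conjI undershoot_weight_lower s)
      fix j assume j: "j \<in> {..<Suc n}"
      show "0 \<le> \<gamma> * undershoot (walk v j) (v j)" using g u1 by simp
      have "\<gamma> * undershoot (walk v j) (v j) \<le> \<gamma> * (1 / (4 * \<gamma>))"
        using u2[of j] e j g by (intro mult_left_mono) auto
      then show "\<gamma> * undershoot (walk v j) (v j) \<le> 1/4" using g by simp
    qed simp
    finally show ?case using e(1) by (simp only: d_def v_def)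
  qed
qed

text \<open>With Suc n steps of length t / Suc n, the choice p = sqrt (Suc n) keeps p^2 d = t fixed.
  The exponential in the price of the cut is then constant, while its base of at most 1/2 raised to
  the power p beats the number of steps. What remains is compounding: \<rho>^n <= exp (n (\<rho> -
  1)), and n (\<rho> - 1) converges.\<close>

lemma step_growth_limit:
  assumes s: "\<bar>s\<bar> \<le> 1/2" and g: "0 < \<gamma>" and t: "0 < t" and r: "0 \<le> r" "r \<le> \<gamma>\<^sup>2 / 2"
  defines "\<rho> n \<equiv> step_growth s \<gamma> r (sqrt (real (Suc n))) (t / real (Suc n))"
  shows "\<forall>n. 0 \<le> \<rho> n"
    "limsup (\<lambda>n. ennreal (\<rho> n ^ Suc n * barrier s \<gamma> 0)) \<le> ennreal (2 * exp ((\<gamma>\<^sup>2 / 2 - r) * t + s / (1 - s) * (r * t)))"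
proof -
  define B where "B = s / (1 - s)"
  define a where "a = \<gamma>\<^sup>2 / 2 - r"
  have B: "- (1/2) \<le> B" using s by (auto simp: B_def field_simps)
  define c where "c = max 0 (- B)"
  have c: "0 \<le> c" "c \<le> 1/2" using B by (auto simp: c_def)
  have rho: "\<rho> n = exp (a * (t / real (Suc n))) + B * (1 - exp (- (r * (t / real (Suc n)))))
     + 2 * (c powr sqrt (real (Suc n)) * exp (\<gamma>\<^sup>2 * t / 2))" for n
    by (simp add: \<rho>_def step_growth_def a_def B_def c_def)
  show 0: "\<forall>n. 0 \<le> \<rho> n"
  proof
    fix n
    have "1 \<le> exp (a * (t / real (Suc n)))" using r t by (simp add: a_def)
    moreover have "- (1/2) \<le> B * x" if "0 \<le> x" "x \<le> 1" for x
      using mult_right_mono[OF B that(1)] that(2) by simp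
    then have "- (1/2) \<le> B * (1 - exp (- (r * (t / real (Suc n)))))"
      using r t by simp
    moreover have "0 \<le> 2 * (c powr sqrt (real (Suc n)) * exp (\<gamma>\<^sup>2 * t / 2))" by simp
    ultimately show "0 \<le> \<rho> n" unfolding rho by linarith
  qed
  have l1: "(\<lambda>n. real (Suc n) * (exp (x * (t / real (Suc n))) - 1)) \<longlonglongrightarrow> x * t" for x
    by real_asymp
  have l2: "(\<lambda>n. real (Suc n) * (c powr sqrt (real (Suc n)))) \<longlonglongrightarrow> 0"
  proof (rule tendsto_sandwich[OF _ _ tendsto_const])
    show "(\<lambda>n. real (Suc n) * ((1/2) powr sqrt (real (Suc n)))) \<longlonglongrightarrow> 0" by real_asymp
    show "\<forall>\<^sub>F n in sequentially. real (Suc n) * (c powr sqrt (real (Suc n))) \<le> real (Suc n) * ((1/2) powr sqrt (real (Suc n)))"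
      using c by (intro always_eventually allI mult_left_mono powr_mono2) auto
    show "\<forall>\<^sub>F n in sequentially. 0 \<le> real (Suc n) * (c powr sqrt (real (Suc n)))" by simp
  qed
  have "(\<lambda>n. real (Suc n) * (exp (a * (t / real (Suc n))) - 1) + (- B) * (real (Suc n) * (exp ((- r) * (t / real (Suc n))) - 1))
    + 2 * exp (\<gamma>\<^sup>2 * t / 2) * (real (Suc n) * (c powr sqrt (real (Suc n)))))
    \<longlonglongrightarrow> a * t + (- B) * ((- r) * t) + 2 * exp (\<gamma>\<^sup>2 * t / 2) * 0"
    by (intro tendsto_intros l1 l2)
  moreover have "real (Suc n) * (exp (a * (t / real (Suc n))) - 1) + (- B) * (real (Suc n) * (exp ((- r) * (t / real (Suc n))) - 1))
    + 2 * exp (\<gamma>\<^sup>2 * t / 2) * (real (Suc n) * (c powr sqrt (real (Suc n)))) = real (Suc n) * (\<rho> n - 1)" for n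
    unfolding rho mult_minus_left by algebra
  ultimately have "(\<lambda>n. real (Suc n) * (\<rho> n - 1)) \<longlonglongrightarrow> a * t + B * (r * t)" by simp
  then have lim: "(\<lambda>n. ennreal (2 * exp (real (Suc n) * (\<rho> n - 1)))) \<longlonglongrightarrow> ennreal (2 * exp (a * t + B * (r * t)))"
    by (intro tendsto_intros)
  have le: "\<rho> n ^ Suc n * barrier s \<gamma> 0 \<le> 2 * exp (real (Suc n) * (\<rho> n - 1))" for n
  proof -
    have "\<rho> n \<le> exp (\<rho> n - 1)" using exp_ge_add_one_self[of "\<rho> n - 1"] by simp
    then have "\<rho> n ^ Suc n \<le> exp (\<rho> n - 1) ^ Suc n" using 0 by (intro power_mono) auto
    also have "\<dots> = exp (real (Suc n) * (\<rho> n - 1))" by (simp only: exp_of_nat_mult)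
    finally have "\<rho> n ^ Suc n \<le> exp (real (Suc n) * (\<rho> n - 1))" .
    moreover have "barrier s \<gamma> 0 \<le> 2" "0 \<le> barrier s \<gamma> 0" using barrier_bounds[OF s _ order_refl, of \<gamma>] g by auto
    ultimately have "\<rho> n ^ Suc n * barrier s \<gamma> 0 \<le> exp (real (Suc n) * (\<rho> n - 1)) * 2"
      using 0 by (intro mult_mono) auto
    then show ?thesis by simp
  qed
  have "limsup (\<lambda>n. ennreal (\<rho> n ^ Suc n * barrier s \<gamma> 0)) \<le> limsup (\<lambda>n. ennreal (2 * exp (real (Suc n) * (\<rho> n - 1))))"
    by (intro Limsup_mono always_eventually allI ennreal_leI le)
  also have "\<dots> = ennreal (2 * exp (a * t + B * (r * t)))"
    using lim by (intro lim_imp_Limsup) auto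
  finally show "limsup (\<lambda>n. ennreal (\<rho> n ^ Suc n * barrier s \<gamma> 0)) \<le> ennreal (2 * exp ((\<gamma>\<^sup>2 / 2 - r) * t + s / (1 - s) * (r * t)))"
    by (simp add: a_def B_def)
qed

text \<open>Asking only for a measurable superset of the exceptional set spares the measurability of the
  suprema and infima over paths that occur in the events below.\<close>

definition (in prob_space) holds_except :: "real \<Rightarrow> ('a \<Rightarrow> bool) \<Rightarrow> bool" where
  "holds_except e P \<longleftrightarrow> (\<exists>A\<in>events. prob A \<le> e \<and> (\<forall>\<omega>\<in>space M - A. P \<omega>))"

text \<open>The steps \<open>V\<close> agree with those of the path only almost surely; they are
  kept separate so that independence and the values 0 and 1 of the mark refer to every outcome. The
  moment condition expresses a Gaussian increment with independent killing at rate
  \<open>r\<close>.\<close>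

locale killed_motion = prob_space M for M :: "'a measure" +
  fixes b :: "real \<Rightarrow> 'a \<Rightarrow> real" and m :: "real \<Rightarrow> 'a \<Rightarrow> nat" and r :: real
    and V :: "real \<Rightarrow> nat \<Rightarrow> 'a \<Rightarrow> real \<times> real"
  assumes r_nonneg: "0 \<le> r"
    and paths: "AE \<omega> in M. driving_path (\<lambda>t. m t \<omega>) (\<lambda>t. b t \<omega>)"
    and V_indep: "0 < d \<Longrightarrow> indep_vars (\<lambda>_. borel \<Otimes>\<^sub>M borel) (V d) UNIV"
    and V_01: "snd (V d j \<omega>) = 0 \<or> snd (V d j \<omega>) = 1"
    and V_mgf: "0 < d \<Longrightarrow> has_bochner_integral M (\<lambda>\<omega>. snd (V d j \<omega>) * exp (\<theta> * fst (V d j \<omega>)))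
       (exp (- (r * d)) * exp (\<theta>\<^sup>2 * d / 2))"
    and V_path: "0 < d \<Longrightarrow> AE \<omega> in M. \<forall>j. V d j \<omega> = path_steps (\<lambda>t. b t \<omega>) (\<lambda>t. m t \<omega>) d j"
begin

theorem exp_total_fall_tail:
  assumes s: "\<bar>s\<bar> \<le> 1/2" and g: "0 < \<gamma>" and t: "0 < t" and r: "r \<le> \<gamma>\<^sup>2 / 2" "0 < s \<or> r = \<gamma>\<^sup>2 / 2"
    and y: "0 < y"
  shows "holds_except (4 * exp ((\<gamma>\<^sup>2 / 2 - r) * t + s / (1 - s) * (r * t)) / y)
    (\<lambda>\<omega>. exp (s * \<gamma> * total_fall (\<lambda>t. b t \<omega>) (\<lambda>t. m t \<omega>) t) \<le> y)"
proof -
  define L where "L = exp ((\<gamma>\<^sup>2 / 2 - r) * t + s / (1 - s) * (r * t))"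
  define d where "d n = t / real (Suc n)" for n
  have d: "0 < d n" for n using t by (simp add: d_def)
  define v where "v n \<omega> i = V (d n) i \<omega>" for n \<omega> i
  define Z where "Z n \<omega> = barrier s \<gamma> (walk (v n \<omega>) (Suc n)) *
       (\<Prod>j<Suc n. undershoot_weight s \<gamma> (undershoot (walk (v n \<omega>) j) (v n \<omega> j)))" for n \<omega>
  define \<rho> where "\<rho> n = step_growth s \<gamma> r (sqrt (real (Suc n))) (d n)" for n
  have rho: "0 \<le> \<rho> n" for n
    using step_growth_limit(1)[OF s g t r_nonneg r(1)] by (simp add: \<rho>_def d_def)
  have [measurable]: "V (d n) j \<in> measurable M (borel \<Otimes>\<^sub>M borel)" for n j
    using V_indep[OF d] by (auto simp: indep_vars_def)
  have Zm [measurable]: "Z n \<in> borel_measurable M" for n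
    unfolding Z_def[abs_def] v_def
    by (intro borel_measurable_times borel_measurable_prod
        measurable_compose[OF measurable_walk_undershoot borel_measurable_undershoot_weight]
        measurable_compose[OF measurable_walk borel_measurable_barrier]) measurable
  have EZ: "(\<integral>\<^sup>+\<omega>. ennreal (Z n \<omega>) \<partial>M) \<le> ennreal (\<rho> n ^ Suc n * barrier s \<gamma> 0)" for n
    unfolding Z_def v_def
  proof (rule walk_supermartingale[OF V_indep[OF d] rho s g])
    fix j and w :: real assume w: "0 \<le> w"
    show "(\<integral>\<^sup>+ \<omega>. ennreal (barrier s \<gamma> (reflect w (V (d n) j \<omega>)) * undershoot_weight s \<gamma> (undershoot w (V (d n) j \<omega>))) \<partial>M)
      \<le> ennreal (\<rho> n * barrier s \<gamma> w)"
      unfolding \<rho>_def using d[of n]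
      by (intro step_expectation[OF s g _ w _ V_01 r_nonneg r] V_mgf) auto
  qed
  \<comment> \<open>The barrier at the final position is at least 1/2, so a value above
    \<open>y\<close> forces the lower limit up to y / 2. Together with the bound 2 on the initial
    barrier, Markov's inequality gives the constant 4.\<close>
  define A where "A = {\<omega>\<in>space M. ennreal (y / 2) \<le> liminf (\<lambda>n. ennreal (Z n \<omega>))}"
  have A [measurable]: "A \<in> events" unfolding A_def by measurable
  have "ennreal (y / 2) * emeasure M A \<le> (\<integral>\<^sup>+\<omega>. liminf (\<lambda>n. ennreal (Z n \<omega>)) \<partial>M)"
  proof -
    have "ennreal (y / 2) * emeasure M A = (\<integral>\<^sup>+\<omega>. ennreal (y / 2) * indicator A \<omega> \<partial>M)"
      by (simp add: nn_integral_cmult_indicator)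
    also have "\<dots> \<le> (\<integral>\<^sup>+\<omega>. liminf (\<lambda>n. ennreal (Z n \<omega>)) \<partial>M)"
      by (intro nn_integral_mono) (auto simp: A_def indicator_def)
    finally show ?thesis .
  qed
  also have "\<dots> \<le> liminf (\<lambda>n. \<integral>\<^sup>+\<omega>. ennreal (Z n \<omega>) \<partial>M)" by (intro nn_integral_liminf) measurable
  also have "\<dots> \<le> limsup (\<lambda>n. \<integral>\<^sup>+\<omega>. ennreal (Z n \<omega>) \<partial>M)" by (intro Liminf_le_Limsup) simp
  also have "\<dots> \<le> limsup (\<lambda>n. ennreal (\<rho> n ^ Suc n * barrier s \<gamma> 0))"
    by (intro Limsup_mono always_eventually allI EZ)
  also have "\<dots> \<le> ennreal (2 * L)"
    using step_growth_limit(2)[OF s g t r_nonneg r(1)] by (simp add: L_def \<rho>_def d_def)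
  finally have "ennreal (y / 2) * emeasure M A \<le> ennreal (2 * L)" .
  moreover have "ennreal (y / 2 * prob A) = ennreal (y / 2) * emeasure M A"
    unfolding emeasure_eq_measure using y by (intro ennreal_mult') simp
  ultimately have "ennreal (y / 2 * prob A) \<le> ennreal (2 * L)" by simp
  then have "y / 2 * prob A \<le> 2 * L" by (subst (asm) ennreal_le_iff) (auto simp: L_def)
  then have pA: "prob A \<le> 4 * L / y" using y by (simp add: field_simps)
  have "AE \<omega> in M. \<forall>n. \<forall>j. V (d n) j \<omega> = path_steps (\<lambda>t. b t \<omega>) (\<lambda>t. m t \<omega>) (d n) j"
    using V_path[OF d] by (simp only: AE_all_countable) blast
  with paths have "AE \<omega> in M. driving_path (\<lambda>t. m t \<omega>) (\<lambda>t. b t \<omega>) \<and>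
     (\<forall>n j. V (d n) j \<omega> = path_steps (\<lambda>t. b t \<omega>) (\<lambda>t. m t \<omega>) (d n) j)" by eventually_elim auto
  then obtain N where N: "N \<in> null_sets M" "\<And>\<omega>. \<omega> \<in> space M - N \<Longrightarrow> driving_path (\<lambda>t. m t \<omega>) (\<lambda>t. b t \<omega>) \<and>
     (\<forall>n j. V (d n) j \<omega> = path_steps (\<lambda>t. b t \<omega>) (\<lambda>t. m t \<omega>) (d n) j)" by (elim AE_E3) blast
  have good: "exp (s * \<gamma> * total_fall (\<lambda>t. b t \<omega>) (\<lambda>t. m t \<omega>) t) \<le> y" if \<omega>: "\<omega> \<in> space M - (A \<union> N)" for \<omega>
  proof (rule ccontr)
    assume "\<not> exp (s * \<gamma> * total_fall (\<lambda>t. b t \<omega>) (\<lambda>t. m t \<omega>) t) \<le> y"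
    then have lt: "y < exp (s * \<gamma> * total_fall (\<lambda>t. b t \<omega>) (\<lambda>t. m t \<omega>) t)" by simp
    interpret driving_path "\<lambda>t. m t \<omega>" "\<lambda>t. b t \<omega>" using N \<omega> by auto
    have v: "v n \<omega> = path_steps (\<lambda>t. b t \<omega>) (\<lambda>t. m t \<omega>) (d n)" for n
      using N(2)[of \<omega>] \<omega> by (auto simp: v_def)
    have "\<forall>\<^sub>F n in sequentially. y < (\<Prod>j<Suc n. undershoot_weight s \<gamma> (undershoot (walk (v n \<omega>) j) (v n \<omega> j)))"
      unfolding v d_def by (rule weight_product_lower[OF t s g lt])
    then have "\<forall>\<^sub>F n in sequentially. ennreal (y / 2) \<le> ennreal (Z n \<omega>)"
    proof eventually_elim
      case (elim n)
      have "1/2 \<le> barrier s \<gamma> (walk (v n \<omega>) (Suc n))"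
        by (rule barrier_bounds(1)[OF s _ walk_nonneg]) (use g in simp)
      then have "1/2 * y \<le> Z n \<omega>" unfolding Z_def using elim y by (intro mult_mono) auto
      then show ?case by (intro ennreal_leI) simp
    qed
    then have "ennreal (y / 2) \<le> liminf (\<lambda>n. ennreal (Z n \<omega>))" by (rule Liminf_bounded)
    then show False using \<omega> by (auto simp: A_def)
  qed
  have "prob (A \<union> N) \<le> prob A + prob N"
    using N(1) by (intro measure_Un_le) auto
  moreover have "prob N = 0" using N(1) by (simp add: measure_eq_0_null_sets)
  ultimately have "prob (A \<union> N) \<le> 4 * L / y" using pA by simp
  then show ?thesis unfolding holds_except_def L_def[symmetric] using good N(1)
    by (intro bexI[of _ "A \<union> N"]) auto
qed

end

subsection \<open>Increments of the driving processes\<close>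

text \<open>A finite index set splits into fibres over the first coordinate. The intersection over
  one fibre is an event of a single \<open>S d\<close>, so the probability factorises across the
  fibres and then within each of them.\<close>

lemma (in prob_space) indep_vars_nested:
  fixes Y :: "'d \<Rightarrow> nat \<Rightarrow> 'a \<Rightarrow> real"
  assumes ind: "indep_sets (\<lambda>d. sets (S d)) D"
    and sp: "\<And>d. d \<in> D \<Longrightarrow> space (S d) = space M"
    and Y: "\<And>d. d \<in> D \<Longrightarrow> indep_vars (\<lambda>_. borel) (Y d) UNIV"
    and meas: "\<And>d j. d \<in> D \<Longrightarrow> Y d j \<in> borel_measurable (S d)"
  shows "indep_vars (\<lambda>_. borel) (\<lambda>i. Y (fst i) (snd i)) (D \<times> UNIV)"
  unfolding indep_vars_def2
proof (intro conjI ballI indep_setsI)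
  fix i :: "'d \<times> nat" assume i: "i \<in> D \<times> UNIV"
  then show "random_variable borel (Y (fst i) (snd i))" using Y by (auto simp: indep_vars_def)
  then show "{Y (fst i) (snd i) -` A \<inter> space M |A. A \<in> sets borel} \<subseteq> events" by auto
next
  fix A :: "'d \<times> nat \<Rightarrow> 'a set" and J
  assume J: "J \<noteq> {}" "J \<subseteq> D \<times> UNIV" "finite J"
    and A: "\<forall>j\<in>J. A j \<in> {Y (fst j) (snd j) -` A \<inter> space M |A. A \<in> sets borel}"
  define D' where "D' = fst ` J"
  define Jd where "Jd d = {j. (d, j) \<in> J}" for d
  have Jeq: "J = Sigma D' Jd" by (force simp: D'_def Jd_def)
  have D': "D' \<noteq> {}" "D' \<subseteq> D" "finite D'" using J by (auto simp: D'_def)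
  have Jd: "finite (Jd d)" for d
    by (rule finite_subset[OF _ finite_imageI[OF J(3), of snd]]) (force simp: Jd_def)
  have Jd0: "Jd d \<noteq> {}" if "d \<in> D'" for d using that by (auto simp: D'_def Jd_def)
  define C where "C d = (\<Inter>j\<in>Jd d. A (d, j))" for d
  have AS: "A (d, j) \<in> {Y d j -` A \<inter> space M |A. A \<in> sets borel}" if "j \<in> Jd d" for d j
    using A that by (force simp: Jd_def)
  have "C d \<in> sets (S d)" if d: "d \<in> D'" for d
    unfolding C_def
  proof (rule sets.finite_INT[OF Jd Jd0[OF d]])
    fix j assume "j \<in> Jd d"
    then obtain T where "A (d, j) = Y d j -` T \<inter> space M" "T \<in> sets borel" using AS by blast
    then show "A (d, j) \<in> sets (S d)"
      using measurable_sets[OF meas[of d j], of T] sp[of d] d D'(2) by auto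
  qed
  then have "prob (\<Inter>d\<in>D'. C d) = (\<Prod>d\<in>D'. prob (C d))"
    by (intro indep_setsD[OF ind D'(2,1,3)]) auto
  also have "\<dots> = (\<Prod>d\<in>D'. \<Prod>j\<in>Jd d. prob (A (d, j)))"
  proof (rule prod.cong[OF refl])
    fix d assume d: "d \<in> D'"
    have "indep_sets (\<lambda>j. {Y d j -` A \<inter> space M |A. A \<in> sets borel}) UNIV"
      using Y[of d] d D' by (auto simp: indep_vars_def2)
    from indep_setsD[OF this _ Jd0[OF d] Jd, of "\<lambda>j. A (d, j)"]
    show "prob (C d) = (\<Prod>j\<in>Jd d. prob (A (d, j)))" using AS by (simp add: C_def)
  qed
  also have "\<dots> = (\<Prod>j\<in>J. prob (A j))"
    unfolding Jeq using D' Jd by (subst prod.Sigma) auto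
  also have "(\<Inter>d\<in>D'. C d) = (\<Inter>j\<in>J. A j)"
    unfolding Jeq C_def by auto
  finally show "prob (\<Inter>j\<in>J. A j) = (\<Prod>j\<in>J. prob (A j))" .
qed

text \<open>Completing the square moves the mean from 0 to \<theta> \<tau>.\<close>

lemma nn_integral_exp_normal:
  assumes "0 < \<tau>"
  shows "(\<integral>\<^sup>+x. ennreal (normal_density 0 (sqrt \<tau>) x) * ennreal (exp (\<theta> * x)) \<partial>lborel) = ennreal (exp (\<theta>\<^sup>2 * \<tau> / 2))"
proof -
  have eq: "normal_density 0 (sqrt \<tau>) x * exp (\<theta> * x) = exp (\<theta>\<^sup>2 * \<tau> / 2) * normal_density (\<theta> * \<tau>) (sqrt \<tau>) x" for x
  proof -
    have "- (x - 0)\<^sup>2 / (2 * (sqrt \<tau>)\<^sup>2) + \<theta> * x = \<theta>\<^sup>2 * \<tau> / 2 + - (x - \<theta> * \<tau>)\<^sup>2 / (2 * (sqrt \<tau>)\<^sup>2)"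
      using assms by (simp add: field_simps power2_eq_square)
    then have "exp (- (x - 0)\<^sup>2 / (2 * (sqrt \<tau>)\<^sup>2)) * exp (\<theta> * x) = exp (\<theta>\<^sup>2 * \<tau> / 2) * exp (- (x - \<theta> * \<tau>)\<^sup>2 / (2 * (sqrt \<tau>)\<^sup>2))"
      by (simp only: exp_add[symmetric])
    then show ?thesis by (simp add: normal_density_def)
  qed
  have "(\<integral>\<^sup>+x. ennreal (normal_density 0 (sqrt \<tau>) x) * ennreal (exp (\<theta> * x)) \<partial>lborel)
     = (\<integral>\<^sup>+x. ennreal (exp (\<theta>\<^sup>2 * \<tau> / 2)) * ennreal (normal_density (\<theta> * \<tau>) (sqrt \<tau>) x) \<partial>lborel)"
    by (simp add: ennreal_mult'[symmetric] eq)
  also have "\<dots> = ennreal (exp (\<theta>\<^sup>2 * \<tau> / 2)) * (\<integral>\<^sup>+x. ennreal (normal_density (\<theta> * \<tau>) (sqrt \<tau>) x) \<partial>lborel)"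
    by (rule nn_integral_cmult) simp
  also have "(\<integral>\<^sup>+x. ennreal (normal_density (\<theta> * \<tau>) (sqrt \<tau>) x) \<partial>lborel) = 1"
    using assms by (subst nn_integral_eq_integral) (auto simp: integral_normal_density integrable_normal_density)
  finally show ?thesis by simp
qed

lemma right_continuous_nat:
  fixes f :: "real \<Rightarrow> nat"
  assumes "continuous (at_right t) (\<lambda>s. real (f s))"
  shows "\<exists>e>0. \<forall>s. t \<le> s \<longrightarrow> s < t + e \<longrightarrow> f s = f t"
proof -
  have "((\<lambda>s. real (f s)) \<longlongrightarrow> real (f t)) (at_right t)"
    using assms by (simp add: continuous_within)
  then have "\<forall>\<^sub>F s in at_right t. dist (real (f s)) (real (f t)) < 1"
    by (rule tendstoD) simp
  then obtain c where c: "c > t" "\<And>s. t < s \<Longrightarrow> s < c \<Longrightarrow> dist (real (f s)) (real (f t)) < 1"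
    unfolding eventually_at_right_field by blast
  have "f s = f t" if "t < s" "s < c" for s
    using c(2)[OF that] by (auto simp: dist_real_def abs_if split: if_splits)
  then show ?thesis using c(1) by (intro exI[of _ "c - t"]) (auto simp: less_le)
qed

section \<open>Steps of the driving processes as a killed motion\<close>

locale drivers = prob_space M for M :: "'w measure" +
  fixes B :: "real \<Rightarrow> 'w \<Rightarrow> real" and N :: "nat \<Rightarrow> real \<Rightarrow> 'w \<Rightarrow> nat"
    and X :: "nat \<Rightarrow> 'w \<Rightarrow> 's" and rate :: "nat \<Rightarrow> real"
  assumes sbm: "standard_brownian_motion M B"
    and poisson: "poisson_process M (N i) (rate i)"
    and indep: "independent_drivers M B N X"
begin

sublocale B: standard_brownian_motion M B by (rule sbm)

text \<open>The independence hypothesis is about sets of events. These measures carry exactly those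
  events, so that measurability with respect to a single driver can be expressed.\<close>

definition S :: "driver \<Rightarrow> 'w measure" where
  "S d = sigma (space M) (case d of
            Brownian \<Rightarrow> {B t -` A \<inter> space M | t A. t \<in> {0..} \<and> A \<in> sets borel}
          | Poisson n \<Rightarrow> {N n t -` A \<inter> space M | t A. t \<in> {0..} \<and> A \<in> sets (count_space UNIV)}
          | Chain \<Rightarrow> {X t -` A \<inter> space M | t A. t \<in> UNIV \<and> A \<in> sets (count_space UNIV)})"

lemma space_S: "space (S d) = space M"
  unfolding S_def by (cases d) (auto intro!: space_measure_of)

lemma sets_S: "sets (S d) = (case d of
            Brownian \<Rightarrow> generated_events M {0..} borel B
          | Poisson n \<Rightarrow> generated_events M {0..} (count_space UNIV) (N n)
          | Chain \<Rightarrow> generated_events M UNIV (count_space UNIV) X)"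
  by (cases d) (auto simp: S_def generated_events_def intro!: sets_measure_of)

lemma indep_S: "indep_sets (\<lambda>d. sets (S d)) UNIV"
  using indep unfolding independent_drivers_def sets_S .

lemma B_S:
  assumes "0 \<le> t" shows "B t \<in> borel_measurable (S Brownian)"
proof (rule measurableI)
  fix A :: "real set" assume "A \<in> sets borel"
  then show "B t -` A \<inter> space (S Brownian) \<in> sets (S Brownian)"
    unfolding sets_S space_S generated_events_def driver.case using assms
    by (intro sigma_sets.Basic) auto
qed simp

lemma N_S:
  assumes "0 \<le> t" shows "N i t \<in> measurable (S (Poisson i)) (count_space UNIV)"
proof (rule measurableI)
  fix A :: "nat set" assume "A \<in> sets (count_space UNIV)"
  then show "N i t -` A \<inter> space (S (Poisson i)) \<in> sets (S (Poisson i))"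
    unfolding sets_S space_S generated_events_def driver.case using assms
    by (intro sigma_sets.Basic) auto
qed simp

text \<open>Each Poisson process contributes its own no-arrival factor, which matches the
  independence of the drivers. The sign \<epsilon> also gives access to the falls of - B, and the
  start \<open>a\<close> to windows that begin at a later time.\<close>

definition V :: "nat set \<Rightarrow> real \<Rightarrow> real \<Rightarrow> real \<Rightarrow> nat \<Rightarrow> 'w \<Rightarrow> real \<times> real" where
  "V I a \<epsilon> d j \<omega> = (\<epsilon> * (B (a + real (Suc j) * d) \<omega> - B (a + real j * d) \<omega>),
     \<Prod>i\<in>I. if N i (a + real (Suc j) * d) \<omega> - N i (a + real j * d) \<omega> = 0 then 1 else 0)"

text \<open>Two uses are combined: no arrivals and an arbitrary start for oscillation bounds, or the
  arrivals of \<open>I\<close> from time 0 on, where the counts vanish. The killed moment is the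
  product of the Gaussian moment and the no-arrival probabilities exp (- rate i d).\<close>

lemma killed_motion:
  assumes I: "finite I" and a: "0 \<le> a" "I = {} \<or> a = 0" and e: "\<epsilon> = 1 \<or> \<epsilon> = -1"
  shows "killed_motion M (\<lambda>u \<omega>. \<epsilon> * B (a + u) \<omega>) (\<lambda>u \<omega>. \<Sum>i\<in>I. N i (a + u) \<omega>) (\<Sum>i\<in>I. rate i) (V I a \<epsilon>)"
proof -
  have rate0: "0 \<le> rate i" for i using poisson[of i] by (simp add: poisson_process_def poisson_process_axioms_def)
  have pN0: "AE \<omega> in M. N i 0 \<omega> = 0" and pmono: "AE \<omega> in M. mono_on {0..} (\<lambda>t. N i t \<omega>)"
    and prc: "AE \<omega> in M. \<forall>t\<ge>0. continuous (at_right t) (\<lambda>s. real (N i s \<omega>))" for i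
    using poisson[of i] by (simp_all add: poisson_process_def poisson_process_axioms_def)
  have mono: "AE \<omega> in M. \<forall>i. mono_on {0..} (\<lambda>t. N i t \<omega>)"
    unfolding AE_all_countable using pmono by blast
  have rc: "AE \<omega> in M. \<forall>i. \<forall>t\<ge>0. continuous (at_right t) (\<lambda>s. real (N i s \<omega>))"
    unfolding AE_all_countable using prc by blast
  have N0: "AE \<omega> in M. \<forall>i. N i 0 \<omega> = 0"
    unfolding AE_all_countable using pN0 by blast
  have path: "AE \<omega> in M. driving_path (\<lambda>t. \<Sum>i\<in>I. N i (a + t) \<omega>) (\<lambda>t. \<epsilon> * B (a + t) \<omega>)"
    using mono rc N0 B.continuous_B
  proof eventually_elim
    case (elim \<omega>)
    show ?case
    proof
      show "(\<Sum>i\<in>I. N i (a + 0) \<omega>) = 0" using elim(3) a by auto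
      show "(\<Sum>i\<in>I. N i (a + s) \<omega>) \<le> (\<Sum>i\<in>I. N i (a + t) \<omega>)" if "0 \<le> s" "s \<le> t" for s t
        using elim(1) a that by (intro sum_mono) (auto simp: mono_on_def)
      show "\<exists>e>0. \<forall>s\<ge>t. s < t + e \<longrightarrow> (\<Sum>i\<in>I. N i (a + s) \<omega>) = (\<Sum>i\<in>I. N i (a + t) \<omega>)" if "0 \<le> t" for t
      proof -
        have "continuous (at_right (a + t)) (\<lambda>s. real (\<Sum>i\<in>I. N i s \<omega>))"
          unfolding of_nat_sum using elim(2) a that by (intro continuous_intros) auto
        from right_continuous_nat[OF this] obtain e where
          e: "e > 0" "\<And>s. a + t \<le> s \<Longrightarrow> s < a + t + e \<Longrightarrow> (\<Sum>i\<in>I. N i s \<omega>) = (\<Sum>i\<in>I. N i (a + t) \<omega>)" by blast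
        show ?thesis using e(1)
        proof (intro exI[of _ e] conjI allI impI)
          fix s assume "t \<le> s" "s < t + e"
          then show "(\<Sum>i\<in>I. N i (a + s) \<omega>) = (\<Sum>i\<in>I. N i (a + t) \<omega>)" by (intro e(2)) auto
        qed
      qed
      have "continuous_on {0..} (\<lambda>t. B (a + t) \<omega>)"
        by (rule continuous_on_compose2[OF elim(4)]) (use a in \<open>auto intro!: continuous_intros\<close>)
      then show "continuous_on {0..} (\<lambda>t. \<epsilon> * B (a + t) \<omega>)" by (intro continuous_intros)
    qed
  qed
  define Y where "Y d h j \<omega> = (case h of Brownian \<Rightarrow> \<epsilon> * (B (a + real (Suc j) * d) \<omega> - B (a + real j * d) \<omega>)
    | Poisson i \<Rightarrow> if N i (a + real (Suc j) * d) \<omega> - N i (a + real j * d) \<omega> = 0 then 1 else 0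
    | Chain \<Rightarrow> 0)" for d h j \<omega>
  define H where "H = insert Brownian (Poisson ` I)"
  have Yind: "indep_vars (\<lambda>_. borel) (\<lambda>i. Y d (fst i) (snd i)) (H \<times> UNIV)" if d: "0 < d" for d
  proof (rule indep_vars_nested[where S = S])
    show "indep_sets (\<lambda>d. sets (S d)) H"
      by (rule indep_sets_mono_index[OF _ indep_S]) simp
    show "space (S h) = space M" for h by (rule space_S)
    have inc: "incseq (\<lambda>j. a + real j * d)" using d by (auto simp: incseq_def)
    fix h assume h: "h \<in> H"
    then consider "h = Brownian" | i where "h = Poisson i" by (auto simp: H_def)
    note hc = this
    show "indep_vars (\<lambda>_. borel) (Y d h) UNIV"
    proof (cases rule: hc)
      case 1
      have "indep_vars (\<lambda>_. borel) (\<lambda>k \<omega>. B (a + real (Suc k) * d) \<omega> - B (a + real k * d) \<omega>) UNIV"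
        by (rule B.indep_increments_B[unfolded indep_increments_def, rule_format, of "\<lambda>j. a + real j * d"])
           (use inc a in simp)
      from indep_vars_compose2[OF this, of "\<lambda>_ x. \<epsilon> * x" "\<lambda>_. borel"]
      show ?thesis by (simp add: Y_def[abs_def] 1)
    next
      case (2 i)
      have "indep_increments (count_space UNIV) (N i)"
        using poisson[of i] by (simp add: poisson_process_def poisson_process_axioms_def)
      note * = this[unfolded indep_increments_def, rule_format, of "\<lambda>j. a + real j * d"]
      have "indep_vars (\<lambda>_. count_space UNIV) (\<lambda>k \<omega>. N i (a + real (Suc k) * d) \<omega> - N i (a + real k * d) \<omega>) UNIV"
        by (rule *) (use inc a in simp)
      from indep_vars_compose2[OF this, of "\<lambda>_ x. if x = 0 then 1 else 0" "\<lambda>_. borel"]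
      show ?thesis by (simp add: Y_def[abs_def] 2)
    qed
    show "Y d h j \<in> borel_measurable (S h)" for j
    proof (cases rule: hc)
      case 1
      have [measurable]: "B (a + real j * d) \<in> borel_measurable (S Brownian)"
        "B (a + real (Suc j) * d) \<in> borel_measurable (S Brownian)"
        using B_S a d by auto
      show ?thesis unfolding Y_def[abs_def] 1 driver.case by measurable
    next
      case (2 i)
      have [measurable]: "N i (a + real j * d) \<in> measurable (S (Poisson i)) (count_space UNIV)"
        "N i (a + real (Suc j) * d) \<in> measurable (S (Poisson i)) (count_space UNIV)"
        using N_S a d by auto
      show ?thesis unfolding Y_def[abs_def] 2 driver.case by measurable
    qed
  qed
  have V_Y: "V I a \<epsilon> d j \<omega> = (Y d Brownian j \<omega>, \<Prod>i\<in>I. Y d (Poisson i) j \<omega>)" for d j \<omega>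
    by (simp add: V_def Y_def)
  show ?thesis
  proof
    show "0 \<le> (\<Sum>i\<in>I. rate i)" by (intro sum_nonneg rate0)
    show "AE \<omega> in M. driving_path (\<lambda>t. \<Sum>i\<in>I. N i (a + t) \<omega>) (\<lambda>t. \<epsilon> * B (a + t) \<omega>)" by (rule path)
    show "indep_vars (\<lambda>_. borel \<Otimes>\<^sub>M borel) (V I a \<epsilon> d) UNIV" if d: "0 < d" for d
    proof -
      have "indep_vars (\<lambda>j. PiM (H \<times> {j}) (\<lambda>_. borel)) (\<lambda>j \<omega>. restrict (\<lambda>i. Y d (fst i) (snd i) \<omega>) (H \<times> {j})) UNIV"
        by (rule indep_vars_restrict[OF Yind[OF d]]) (auto simp: disjoint_family_on_def)
      from indep_vars_compose2[OF this, of "\<lambda>j f. (f (Brownian, j), \<Prod>i\<in>I. f (Poisson i, j))" "\<lambda>_. borel \<Otimes>\<^sub>M borel"]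
      have "indep_vars (\<lambda>_. borel \<Otimes>\<^sub>M borel) (\<lambda>j \<omega>. (restrict (\<lambda>i. Y d (fst i) (snd i) \<omega>) (H \<times> {j}) (Brownian, j),
           \<Prod>i\<in>I. restrict (\<lambda>i. Y d (fst i) (snd i) \<omega>) (H \<times> {j}) (Poisson i, j))) UNIV"
        by (auto simp: H_def intro!: measurable_Pair borel_measurable_prod measurable_component_singleton)
      then show ?thesis
        by (rule back_subst[of "\<lambda>F. indep_vars (\<lambda>_. borel \<Otimes>\<^sub>M borel) F UNIV"])
           (auto simp: fun_eq_iff V_Y H_def)
    qed
    show "snd (V I a \<epsilon> d j \<omega>) = 0 \<or> snd (V I a \<epsilon> d j \<omega>) = 1" for d j \<omega>
    proof (cases "\<forall>i\<in>I. N i (a + real (Suc j) * d) \<omega> - N i (a + real j * d) \<omega> = 0")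
      case False then show ?thesis using I by (auto simp: V_def prod_zero_iff simp del: diff_is_0_eq)
    qed (simp add: V_def)
    show "has_bochner_integral M (\<lambda>\<omega>. snd (V I a \<epsilon> d j \<omega>) * exp (\<theta> * fst (V I a \<epsilon> d j \<omega>)))
       (exp (- ((\<Sum>i\<in>I. rate i) * d)) * exp (\<theta>\<^sup>2 * d / 2))" if d: "0 < d" for d j \<theta>
    proof (rule has_bochner_integral_nn_integral)
      define Z where "Z h \<omega> = (if h = Brownian then exp (\<theta> * Y d h j \<omega>) else Y d h j \<omega>)" for h \<omega>
      have "indep_vars (\<lambda>_. borel) (\<lambda>i. Y d (fst i) (snd i)) (H \<times> {j})"
        by (rule indep_vars_subset[OF Yind[OF d]]) auto
      from indep_vars_compose2[OF this, of "\<lambda>i x. if fst i = Brownian then exp (\<theta> * x) else x" "\<lambda>_. borel"]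
      have "indep_vars (\<lambda>_. borel) (\<lambda>i x. if fst i = Brownian then exp (\<theta> * Y d (fst i) (snd i) x) else Y d (fst i) (snd i) x) (H \<times> {j})"
        by simp
      then have Zind: "indep_vars (\<lambda>_. borel) (\<lambda>i. Z (fst i)) (H \<times> {j})"
        by (subst indep_vars_cong[OF refl _ refl]) (auto simp: Z_def fun_eq_iff)
      have prH: "(\<Prod>h\<in>H. f h) = (\<Prod>i\<in>H \<times> {j}. f (fst i))" for f :: "driver \<Rightarrow> ennreal"
        by (rule prod.reindex_bij_witness[of _ fst "\<lambda>h. (h, j)"]) auto
      have Z0: "0 \<le> Z h \<omega>" for h \<omega> by (cases h) (auto simp: Z_def Y_def)
      have VZ: "snd (V I a \<epsilon> d j \<omega>) * exp (\<theta> * fst (V I a \<epsilon> d j \<omega>)) = (\<Prod>h\<in>H. Z h \<omega>)" for \<omega>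
      proof -
        have "(\<Prod>h\<in>H. Z h \<omega>) = Z Brownian \<omega> * (\<Prod>h\<in>Poisson ` I. Z h \<omega>)"
          unfolding H_def using I by (subst prod.insert) auto
        also have "(\<Prod>h\<in>Poisson ` I. Z h \<omega>) = (\<Prod>i\<in>I. Y d (Poisson i) j \<omega>)"
          by (subst prod.reindex) (auto simp: inj_on_def Z_def)
        finally show ?thesis by (simp add: V_Y Z_def)
      qed
      have [measurable]: "Z h \<in> borel_measurable M" if "h \<in> H" for h
        using Zind that by (force simp: indep_vars_def)
      show "(\<lambda>\<omega>. snd (V I a \<epsilon> d j \<omega>) * exp (\<theta> * fst (V I a \<epsilon> d j \<omega>))) \<in> borel_measurable M"
        unfolding VZ by (intro borel_measurable_prod) auto
      show "AE \<omega> in M. 0 \<le> snd (V I a \<epsilon> d j \<omega>) * exp (\<theta> * fst (V I a \<epsilon> d j \<omega>))"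
        unfolding VZ by (intro AE_I2 prod_nonneg Z0)
      have ZB: "(\<integral>\<^sup>+\<omega>. ennreal (Z Brownian \<omega>) \<partial>M) = ennreal (exp (\<theta>\<^sup>2 * d / 2))"
      proof -
        have dist: "distributed M lborel (\<lambda>\<omega>. B (a + real (Suc j) * d) \<omega> - B (a + real j * d) \<omega>) (normal_density 0 (sqrt d))"
          using B.normal_increments_B[of "a + real j * d" "a + real (Suc j) * d"] a d by (simp add: algebra_simps)
        have "(\<integral>\<^sup>+\<omega>. ennreal (Z Brownian \<omega>) \<partial>M) = (\<integral>\<^sup>+\<omega>. (\<lambda>x. ennreal (exp (\<theta> * \<epsilon> * x))) (B (a + real (Suc j) * d) \<omega> - B (a + real j * d) \<omega>) \<partial>M)"
          by (simp add: Z_def Y_def mult.assoc)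
        also have "\<dots> = (\<integral>\<^sup>+x. ennreal (normal_density 0 (sqrt d) x) * ennreal (exp (\<theta> * \<epsilon> * x)) \<partial>lborel)"
          by (subst distributed_nn_integral[OF dist, symmetric]) auto
        also have "\<dots> = ennreal (exp ((\<theta> * \<epsilon>)\<^sup>2 * d / 2))" by (rule nn_integral_exp_normal[OF d])
        finally show ?thesis using e by auto
      qed
      have ZP: "(\<integral>\<^sup>+\<omega>. ennreal (Z (Poisson i) \<omega>) \<partial>M) = ennreal (exp (- (rate i * d)))" for i
      proof -
        define K where "K = {\<omega>\<in>space M. N i (a + real (Suc j) * d) \<omega> - N i (a + real j * d) \<omega> = 0}"
        have [measurable]: "N i t \<in> measurable M (count_space UNIV)" if "0 \<le> t" for t
          using poisson[of i] that by (simp add: poisson_process_def poisson_process_axioms_def)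
        have "0 \<le> a + real (Suc j) * d" "0 \<le> a + real j * d" using a d by auto
        then have [measurable]: "K \<in> events" unfolding K_def by measurable
        have "prob K = ((rate i * (a + real (Suc j) * d - (a + real j * d))) ^ 0 / fact 0 * exp (- (rate i * (a + real (Suc j) * d - (a + real j * d)))))"
          unfolding K_def using a d by (intro poisson_process.poisson_increments_N[OF poisson]) auto
        then have "prob K = exp (- (rate i * d))" by (simp add: algebra_simps)
        moreover have "(\<integral>\<^sup>+\<omega>. ennreal (Z (Poisson i) \<omega>) \<partial>M) = (\<integral>\<^sup>+\<omega>. indicator K \<omega> \<partial>M)"
          by (intro nn_integral_cong) (auto simp: Z_def Y_def K_def indicator_def)
        ultimately show ?thesis by (simp add: emeasure_eq_measure)
      qed
      have "(\<integral>\<^sup>+\<omega>. ennreal (\<Prod>h\<in>H. Z h \<omega>) \<partial>M) = (\<integral>\<^sup>+\<omega>. (\<Prod>h\<in>H. ennreal (Z h \<omega>)) \<partial>M)"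
        by (simp add: prod_ennreal Z0)
      also have "\<dots> = (\<Prod>h\<in>H. \<integral>\<^sup>+\<omega>. ennreal (Z h \<omega>) \<partial>M)"
        unfolding prH using I
        by (intro indep_vars_nn_integral indep_vars_compose2[OF Zind]) (auto simp: H_def)
      also have "\<dots> = ennreal (exp (\<theta>\<^sup>2 * d / 2)) * (\<Prod>i\<in>I. ennreal (exp (- (rate i * d))))"
        unfolding H_def using I by (subst prod.insert) (auto simp: ZB ZP prod.reindex inj_on_def)
      also have "\<dots> = ennreal (exp (\<theta>\<^sup>2 * d / 2)) * ennreal (exp (\<Sum>i\<in>I. - (rate i * d)))"
        using I by (simp add: prod_ennreal exp_sum)
      also have "\<dots> = ennreal (exp (- ((\<Sum>i\<in>I. rate i) * d)) * exp (\<theta>\<^sup>2 * d / 2))"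
        by (simp add: ennreal_mult'[symmetric] sum_negf sum_distrib_left mult.commute)
      finally show "(\<integral>\<^sup>+\<omega>. ennreal (snd (V I a \<epsilon> d j \<omega>) * exp (\<theta> * fst (V I a \<epsilon> d j \<omega>))) \<partial>M) =
        ennreal (exp (- ((\<Sum>i\<in>I. rate i) * d)) * exp (\<theta>\<^sup>2 * d / 2))" unfolding VZ .
    qed simp
    show "AE \<omega> in M. \<forall>j. V I a \<epsilon> d j \<omega> = path_steps (\<lambda>t. \<epsilon> * B (a + t) \<omega>) (\<lambda>t. \<Sum>i\<in>I. N i (a + t) \<omega>) d j"
      if d: "0 < d" for d
      using mono
    proof eventually_elim
      case (elim \<omega>)
      show ?case
      proof
        fix j
        have le: "N i (a + real j * d) \<omega> \<le> N i (a + real (Suc j) * d) \<omega>" for i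
          using elim a d by (auto simp: mono_on_def)
        \<comment> \<open>A truncated difference vanishes when the count does not increase; as no
          count decreases, equal sums force each summand to be equal.\<close>
        have "((\<Sum>i\<in>I. N i (a + real (Suc j) * d) \<omega>) = (\<Sum>i\<in>I. N i (a + real j * d) \<omega>)) \<longleftrightarrow>
          (\<forall>i\<in>I. N i (a + real (Suc j) * d) \<omega> - N i (a + real j * d) \<omega> = 0)"
        proof
          assume eq: "(\<Sum>i\<in>I. N i (a + real (Suc j) * d) \<omega>) = (\<Sum>i\<in>I. N i (a + real j * d) \<omega>)"
          show "\<forall>i\<in>I. N i (a + real (Suc j) * d) \<omega> - N i (a + real j * d) \<omega> = 0"
          proof
            fix i assume "i \<in> I"
            then have "N i (a + real j * d) \<omega> = N i (a + real (Suc j) * d) \<omega>"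
              using sum_mono_inv[OF eq[symmetric] le _ I] by blast
            then show "N i (a + real (Suc j) * d) \<omega> - N i (a + real j * d) \<omega> = 0" by simp
          qed
        next
          assume "\<forall>i\<in>I. N i (a + real (Suc j) * d) \<omega> - N i (a + real j * d) \<omega> = 0"
          then show "(\<Sum>i\<in>I. N i (a + real (Suc j) * d) \<omega>) = (\<Sum>i\<in>I. N i (a + real j * d) \<omega>)"
            using le by (intro sum.cong refl) (metis diff_is_0_eq le_antisym)
        qed
        then show "V I a \<epsilon> d j \<omega> = path_steps (\<lambda>t. \<epsilon> * B (a + t) \<omega>) (\<lambda>t. \<Sum>i\<in>I. N i (a + t) \<omega>) d j"
          unfolding V_def path_steps_def using I
          by (simp add: right_diff_distrib prod_zero_iff del: diff_is_0_eq of_nat_Suc)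
      qed
    qed
  qed
qed

end

subsection \<open>Good events\<close>

context prob_space
begin

lemma holds_except_mono:
  assumes "holds_except e P" "e \<le> e'" "\<And>\<omega>. \<omega> \<in> space M \<Longrightarrow> P \<omega> \<Longrightarrow> Q \<omega>"
  shows "holds_except e' Q"
  using assms unfolding holds_except_def by (meson DiffD1 order_trans)

lemma holds_except_conj:
  assumes "holds_except e P" "holds_except e' Q"
  shows "holds_except (e + e') (\<lambda>\<omega>. P \<omega> \<and> Q \<omega>)"
proof -
  obtain A A' where A: "A \<in> events" "prob A \<le> e" "\<forall>\<omega>\<in>space M - A. P \<omega>"
    "A' \<in> events" "prob A' \<le> e'" "\<forall>\<omega>\<in>space M - A'. Q \<omega>"
    using assms unfolding holds_except_def by blast
  have "prob (A \<union> A') \<le> prob A + prob A'" using A by (intro measure_Un_le) auto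
  then show ?thesis unfolding holds_except_def
    using A by (intro bexI[of _ "A \<union> A'"]) auto
qed

lemma holds_except_AE:
  assumes "AE \<omega> in M. P \<omega>" shows "holds_except 0 P"
proof -
  from assms obtain A where "\<And>\<omega>. \<omega> \<in> space M - A \<Longrightarrow> P \<omega>" "A \<in> null_sets M" by (elim AE_E3) blast
  then show ?thesis unfolding holds_except_def
    by (intro bexI[of _ A]) (auto simp: measure_eq_0_null_sets)
qed

lemma holds_except_ball:
  assumes "finite I" "\<And>i. i \<in> I \<Longrightarrow> holds_except e (P i)" "0 \<le> e"
  shows "holds_except (real (card I) * e) (\<lambda>\<omega>. \<forall>i\<in>I. P i \<omega>)"
  using assms
proof (induction I rule: finite_induct)
  case empty show ?case by (auto intro: holds_except_AE)
next
  case (insert i I)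
  have "holds_except (e + real (card I) * e) (\<lambda>\<omega>. P i \<omega> \<and> (\<forall>i\<in>I. P i \<omega>))"
    using insert by (intro holds_except_conj) auto
  then show ?case using insert by (simp add: algebra_simps)
qed

end

text \<open>For \<lambda> = 2 n^2 the factor \<open>sqrt 2 / real n\<close> is 2 / sqrt \<lambda>,
  so this concerns the leading term of the epoch clock, on a grid of mesh 1 / n up to time
  2.\<close>

definition fall_good :: "nat \<Rightarrow> real \<Rightarrow> (real \<Rightarrow> real) \<Rightarrow> (real \<Rightarrow> nat) \<Rightarrow> bool" where
  "fall_good n c b m \<longleftrightarrow>
     (\<forall>i\<in>{1..2*n}. \<bar>sqrt 2 / real n * total_fall b m (real i / real n) - real i / real n\<bar> \<le> c * (ln (real n) / real n))"

definition osc_good :: "nat \<Rightarrow> real \<Rightarrow> real \<Rightarrow> (real \<Rightarrow> real) \<Rightarrow> bool" where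
  "osc_good n \<kappa> c b \<longleftrightarrow> (\<forall>i\<in>{0..2*n}. \<forall>u\<in>{0..\<kappa> * (ln (real n) / real n)}.
     \<bar>b (real i / real n + u) - b (real i / real n)\<bar> \<le> c * (ln (real n) / sqrt (real n)))"

definition sup_good :: "nat \<Rightarrow> real \<Rightarrow> (real \<Rightarrow> real) \<Rightarrow> bool" where
  "sup_good n c b \<longleftrightarrow> (\<forall>u\<in>{0..3}. \<bar>b u\<bar> \<le> c * ln (real n))"

definition count_good :: "nat \<Rightarrow> real \<Rightarrow> nat \<Rightarrow> (real \<Rightarrow> nat) \<Rightarrow> bool" where
  "count_good n \<kappa> k m \<longleftrightarrow> (\<forall>i\<in>{0..2*n}. m (real i / real n + \<kappa> * (ln (real n) / real n)) \<le> m (real i / real n) + k)"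

definition gap_good :: "nat \<Rightarrow> (real \<Rightarrow> nat) \<Rightarrow> bool" where
  "gap_good n m \<longleftrightarrow> (\<forall>i\<in>{..<2*n}. m (real i / real n) < m (real (Suc i) / real n))"

section \<open>Polynomially small tails for the good events\<close>

context drivers
begin

text \<open>Without arrivals the total fall is the greatest descent below the starting value, and
  the exponential bound with s = 1/2, r = 0 and y = exp (\<gamma> x / 2) is a maximal inequality.
  Using it for \<open>B\<close> and for - B doubles the constant 4.\<close>

lemma oscillation_tail:
  assumes a: "0 \<le> a" and t: "0 < \<tau>" and g: "0 < \<gamma>"
  shows "holds_except (8 * exp (\<gamma>\<^sup>2 * \<tau> / 2 - \<gamma> * x / 2)) (\<lambda>\<omega>. \<forall>u\<in>{0..\<tau>}. \<bar>B (a + u) \<omega> - B a \<omega>\<bar> \<le> x)"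
proof -
  have one: "holds_except (4 * exp (\<gamma>\<^sup>2 * \<tau> / 2 - \<gamma> * x / 2)) (\<lambda>\<omega>. \<forall>u\<in>{0..\<tau>}. \<epsilon> * (B a \<omega> - B (a + u) \<omega>) \<le> x)"
    if e: "\<epsilon> = 1 \<or> \<epsilon> = - 1" for \<epsilon> :: real
  proof -
    interpret K: killed_motion M "\<lambda>u \<omega>. \<epsilon> * B (a + u) \<omega>" "\<lambda>u \<omega>. \<Sum>i\<in>{}. N i (a + u) \<omega>" "\<Sum>i\<in>{}. rate i" "V {} a \<epsilon>"
      by (rule killed_motion) (use a e in auto)
    have 1: "holds_except (4 * exp (\<gamma>\<^sup>2 / 2 * \<tau>) / exp (\<gamma> * x / 2))
      (\<lambda>\<omega>. exp (1/2 * \<gamma> * total_fall (\<lambda>u. \<epsilon> * B (a + u) \<omega>) (\<lambda>u. 0) \<tau>) \<le> exp (\<gamma> * x / 2))"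
      using K.exp_total_fall_tail[of "1/2" \<gamma> \<tau> "exp (\<gamma> * x / 2)"] g t by simp
    have 2: "holds_except (4 * exp (\<gamma>\<^sup>2 / 2 * \<tau>) / exp (\<gamma> * x / 2) + 0)
      (\<lambda>\<omega>. exp (1/2 * \<gamma> * total_fall (\<lambda>u. \<epsilon> * B (a + u) \<omega>) (\<lambda>u. 0) \<tau>) \<le> exp (\<gamma> * x / 2) \<and>
        driving_path (\<lambda>u. \<Sum>i\<in>{}. N i (a + u) \<omega>) (\<lambda>u. \<epsilon> * B (a + u) \<omega>))"
      by (intro holds_except_conj[OF 1] holds_except_AE K.paths)
    show ?thesis
    proof (rule holds_except_mono[OF 2])
      show "4 * exp (\<gamma>\<^sup>2 / 2 * \<tau>) / exp (\<gamma> * x / 2) + 0 \<le> 4 * exp (\<gamma>\<^sup>2 * \<tau> / 2 - \<gamma> * x / 2)"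
        by (simp add: exp_diff)
      fix \<omega> assume *: "exp (1/2 * \<gamma> * total_fall (\<lambda>u. \<epsilon> * B (a + u) \<omega>) (\<lambda>u. 0) \<tau>) \<le> exp (\<gamma> * x / 2) \<and>
        driving_path (\<lambda>u. \<Sum>i\<in>{}. N i (a + u) \<omega>) (\<lambda>u. \<epsilon> * B (a + u) \<omega>)"
      then interpret driving_path "\<lambda>u. 0" "\<lambda>u. \<epsilon> * B (a + u) \<omega>" by simp
      have "\<gamma> * total_fall (\<lambda>u. \<epsilon> * B (a + u) \<omega>) (\<lambda>u. 0) \<tau> \<le> \<gamma> * x" using * by simp
      then have le: "fall (\<lambda>u. \<epsilon> * B (a + u) \<omega>) 0 \<tau> \<le> x" using g by (simp add: total_fall_def ep_0)
      show "\<forall>u\<in>{0..\<tau>}. \<epsilon> * (B a \<omega> - B (a + u) \<omega>) \<le> x"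
      proof
        fix u assume u: "u \<in> {0..\<tau>}"
        have "\<epsilon> * B (a + 0) \<omega> - \<epsilon> * B (a + u) \<omega> \<le> fall (\<lambda>u. \<epsilon> * B (a + u) \<omega>) 0 \<tau>"
          by (rule fall_ge[OF cont_sub u]) simp
        then show "\<epsilon> * (B a \<omega> - B (a + u) \<omega>) \<le> x" using le by (simp add: right_diff_distrib)
      qed
    qed
  qed
  show ?thesis
    by (rule holds_except_mono[OF holds_except_conj[OF one[of 1] one[of "- 1"]]]) (auto simp: abs_le_iff)
qed

text \<open>With \<gamma> = sqrt 2 n and s = \<epsilon> / n, the exponent s \<gamma> D is \<epsilon>
  sqrt 2 D, and the threshold \<open>y\<close> contains the matching centring \<epsilon> n t. The
  two signs give the two tails.\<close>

lemma fall_tail: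
  assumes n: "2 \<le> n" and rates: "(\<Sum>i\<le>n. rate i) = (real n)\<^sup>2" and t: "0 < t" "t \<le> 2"
  shows "holds_except (8 * exp 4 * real n powr (- \<beta>))
     (\<lambda>\<omega>. \<bar>sqrt 2 / real n * total_fall (\<lambda>u. B u \<omega>) (\<lambda>u. \<Sum>i\<le>n. N i u \<omega>) t - t\<bar> \<le> \<beta> * (ln (real n) / real n))"
proof -
  interpret K: killed_motion M "\<lambda>u \<omega>. 1 * B (0 + u) \<omega>" "\<lambda>u \<omega>. \<Sum>i\<in>{..n}. N i (0 + u) \<omega>" "\<Sum>i\<in>{..n}. rate i" "V {..n} 0 1"
    by (rule killed_motion) auto
  define D where "D \<omega> = total_fall (\<lambda>u. B u \<omega>) (\<lambda>u. \<Sum>i\<le>n. N i u \<omega>) t" for \<omega>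
  define \<gamma> where "\<gamma> = sqrt 2 * real n"
  have g: "0 < \<gamma>" "\<gamma>\<^sup>2 / 2 = (real n)\<^sup>2" using n by (auto simp: \<gamma>_def power_mult_distrib)
  have nn: "real n \<ge> 2" using n by simp
  have one: "holds_except (4 * exp 4 * real n powr (- \<beta>)) (\<lambda>\<omega>. \<epsilon> * (sqrt 2 * D \<omega> - real n * t) \<le> \<beta> * ln (real n))"
    if e: "\<epsilon> = 1 \<or> \<epsilon> = - 1" for \<epsilon> :: real
  proof -
    define s where "s = \<epsilon> / real n"
    have s: "\<bar>s\<bar> \<le> 1/2" using e nn by (auto simp: s_def field_simps)
    have sg: "s * \<gamma> = \<epsilon> * sqrt 2" using nn by (simp add: s_def \<gamma>_def)
    define y where "y = exp (\<epsilon> * (real n * t) + \<beta> * ln (real n))"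
    have 1: "holds_except (4 * exp (s / (1 - s) * ((real n)\<^sup>2 * t)) / y) (\<lambda>\<omega>. exp (\<epsilon> * sqrt 2 * D \<omega>) \<le> y)"
      using K.exp_total_fall_tail[OF s g(1) t(1), of y] rates g(2) by (simp add: D_def y_def sg)
    \<comment> \<open>Since \<epsilon>^2 = 1, s / (1 - s) n^2 equals \<epsilon> n + n / (n -
      \<epsilon>) exactly. The first part is the centring; the second is at most 2 and is multiplied
      by t <= 2, whence exp 4.\<close>
    have "s / (1 - s) * (real n)\<^sup>2 * t - \<epsilon> * (real n * t) \<le> 4"
    proof -
      have "s / (1 - s) * (real n)\<^sup>2 = \<epsilon> * (real n)\<^sup>2 / (real n - \<epsilon>)"
        using nn e by (auto simp: s_def field_simps)
      also have "\<dots> = \<epsilon> * real n + real n / (real n - \<epsilon>)"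
        using nn e by (auto simp: field_simps power2_eq_square)
      finally have "s / (1 - s) * (real n)\<^sup>2 * t - \<epsilon> * (real n * t) = real n / (real n - \<epsilon>) * t"
        by (simp add: algebra_simps)
      also have "\<dots> \<le> 2 * 2"
        using nn e t by (intro mult_mono) (auto simp: field_simps)
      finally show ?thesis by simp
    qed
    then have "exp (s / (1 - s) * ((real n)\<^sup>2 * t)) / y \<le> exp (4 - \<beta> * ln (real n))"
      unfolding y_def exp_diff[symmetric] by (simp add: mult.assoc)
    also have "\<dots> = exp 4 * real n powr (- \<beta>)"
      using nn by (simp add: powr_def exp_diff exp_minus field_simps)
    finally have le: "4 * exp (s / (1 - s) * ((real n)\<^sup>2 * t)) / y \<le> 4 * exp 4 * real n powr (- \<beta>)" by simp
    show ?thesis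
      by (rule holds_except_mono[OF 1 le]) (simp add: y_def algebra_simps)
  qed
  have "holds_except (4 * exp 4 * real n powr (- \<beta>) + 4 * exp 4 * real n powr (- \<beta>))
     (\<lambda>\<omega>. 1 * (sqrt 2 * D \<omega> - real n * t) \<le> \<beta> * ln (real n) \<and> - 1 * (sqrt 2 * D \<omega> - real n * t) \<le> \<beta> * ln (real n))"
    by (intro holds_except_conj one) auto
  then show ?thesis
  proof (rule holds_except_mono)
    fix \<omega> assume "1 * (sqrt 2 * D \<omega> - real n * t) \<le> \<beta> * ln (real n) \<and> - 1 * (sqrt 2 * D \<omega> - real n * t) \<le> \<beta> * ln (real n)"
    then have "\<bar>sqrt 2 * D \<omega> - real n * t\<bar> \<le> \<beta> * ln (real n)" by auto
    then have "\<bar>sqrt 2 * D \<omega> - real n * t\<bar> / real n \<le> \<beta> * ln (real n) / real n" by (intro divide_right_mono) auto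
    moreover have "\<bar>sqrt 2 * D \<omega> - real n * t\<bar> / real n = \<bar>sqrt 2 / real n * D \<omega> - t\<bar>"
    proof -
      have "(sqrt 2 * D \<omega> - real n * t) / real n = sqrt 2 / real n * D \<omega> - t" using nn by (simp add: field_simps)
      then show ?thesis using nn by (metis abs_divide abs_of_nat)
    qed
    ultimately show "\<bar>sqrt 2 / real n * total_fall (\<lambda>u. B u \<omega>) (\<lambda>u. \<Sum>i\<le>n. N i u \<omega>) t - t\<bar> \<le> \<beta> * (ln (real n) / real n)"
      by (simp add: D_def)
  qed simp
qed

text \<open>As (k + j)! >= j!, the tail series is at most x^k times the total mass of the Poisson
  law with mean x.\<close>

lemma poisson_tail:
  assumes "0 \<le> s" "s \<le> t"
  shows "holds_except ((rate i * (t - s)) ^ k) (\<lambda>\<omega>. N i t \<omega> - N i s \<omega> < k)"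
proof -
  define x where "x = rate i * (t - s)"
  have x: "0 \<le> x" using poisson[of i] assms by (simp add: x_def poisson_process_def poisson_process_axioms_def)
  have [measurable]: "N i s \<in> measurable M (count_space UNIV)" "N i t \<in> measurable M (count_space UNIV)"
    using poisson[of i] assms by (auto simp: poisson_process_def poisson_process_axioms_def)
  define A where "A j = {\<omega>\<in>space M. N i t \<omega> - N i s \<omega> = k + j}" for j
  have [measurable]: "A j \<in> events" for j unfolding A_def by measurable
  have pA: "prob (A j) = x ^ (k + j) / fact (k + j) * exp (- x)" for j
    unfolding A_def x_def using assms by (intro poisson_process.poisson_increments_N[OF poisson]) auto
  have le: "prob (A j) \<le> x ^ k * exp (- x) * (inverse (fact j) * x ^ j)" for j
  proof -
    have "x ^ (k + j) / fact (k + j) \<le> x ^ (k + j) / fact j"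
      using x by (intro divide_left_mono fact_mono) auto
    then have "x ^ (k + j) / fact (k + j) * exp (- x) \<le> x ^ (k + j) / fact j * exp (- x)"
      by (intro mult_right_mono) auto
    then show ?thesis unfolding pA by (simp add: power_add field_simps)
  qed
  have sm: "summable (\<lambda>j. x ^ k * exp (- x) * (inverse (fact j) * x ^ j))"
    by (intro summable_mult summable_exp)
  then have smA: "summable (\<lambda>j. prob (A j))"
    by (rule summable_comparison_test'[where N=0]) (use le in auto)
  have "prob (\<Union>j. A j) \<le> (\<Sum>j. prob (A j))"
    by (rule finite_measure_subadditive_countably) (auto simp: smA)
  also have "\<dots> \<le> (\<Sum>j. x ^ k * exp (- x) * (inverse (fact j) * x ^ j))"
    by (rule suminf_le[OF le smA sm])
  also have "\<dots> = x ^ k * exp (- x) * exp x"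
    by (subst suminf_mult[OF summable_exp]) (simp add: exp_def scaleR_conv_of_real divide_inverse)
  also have "\<dots> = x ^ k" by (simp add: exp_minus)
  finally have "prob (\<Union>j. A j) \<le> x ^ k" .
  moreover have "N i t \<omega> - N i s \<omega> < k" if "\<omega> \<in> space M - (\<Union>j. A j)" for \<omega>
  proof (rule ccontr)
    assume "\<not> N i t \<omega> - N i s \<omega> < k"
    then obtain j where "N i t \<omega> - N i s \<omega> = k + j" by (metis le_Suc_ex not_le)
    then have "\<omega> \<in> A j" using that by (simp add: A_def)
    then show False using that by blast
  qed
  ultimately show ?thesis unfolding holds_except_def x_def by (intro bexI[of _ "\<Union>j. A j"]) auto
qed

text \<open>At total rate n^2 a cell of length 1 / n has mean n; the probability that it stays empty
  is the killed moment at \<theta> = 0.\<close>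

lemma no_arrival:
  assumes n: "1 \<le> n" and rates: "(\<Sum>i\<le>n. rate i) = (real n)\<^sup>2"
  shows "holds_except (exp (- real n)) (\<lambda>\<omega>. (\<Sum>i\<le>n. N i (real j / real n) \<omega>) < (\<Sum>i\<le>n. N i (real (Suc j) / real n) \<omega>))"
proof -
  interpret K: killed_motion M "\<lambda>u \<omega>. 1 * B (0 + u) \<omega>" "\<lambda>u \<omega>. \<Sum>i\<in>{..n}. N i (0 + u) \<omega>" "\<Sum>i\<in>{..n}. rate i" "V {..n} 0 1"
    by (rule killed_motion) auto
  define d where "d = 1 / real n"
  have d: "0 < d" using n by (simp add: d_def)
  define A where "A = {\<omega>\<in>space M. snd (V {..n} 0 1 d j \<omega>) = 1}"
  have [measurable]: "V {..n} 0 1 d j \<in> measurable M (borel \<Otimes>\<^sub>M borel)"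
    using K.V_indep[OF d] by (auto simp: indep_vars_def)
  have [measurable]: "A \<in> events" unfolding A_def by measurable
  have "has_bochner_integral M (\<lambda>\<omega>. snd (V {..n} 0 1 d j \<omega>)) (exp (- real n))"
    using K.V_mgf[OF d, of j 0] rates n by (simp add: d_def power2_eq_square)
  moreover have "snd (V {..n} 0 1 d j \<omega>) = indicat_real A \<omega>" if "\<omega> \<in> space M" for \<omega>
    using K.V_01[of d j \<omega>] that by (auto simp: A_def indicator_def)
  ultimately have "has_bochner_integral M (indicat_real A) (exp (- real n))"
    by (subst has_bochner_integral_cong[OF refl _ refl, symmetric]) auto
  then have pA: "prob A = exp (- real n)"
    by (simp add: has_bochner_integral_iff)
  have 1: "holds_except (exp (- real n)) (\<lambda>\<omega>. snd (V {..n} 0 1 d j \<omega>) \<noteq> 1)"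
    unfolding holds_except_def by (rule bexI[of _ A]) (auto simp: pA, auto simp: A_def)
  have "holds_except (exp (- real n) + 0) (\<lambda>\<omega>. snd (V {..n} 0 1 d j \<omega>) \<noteq> 1 \<and>
    ((\<forall>j. V {..n} 0 1 d j \<omega> = path_steps (\<lambda>t. 1 * B (0 + t) \<omega>) (\<lambda>t. \<Sum>i\<in>{..n}. N i (0 + t) \<omega>) d j) \<and>
     driving_path (\<lambda>u. \<Sum>i\<in>{..n}. N i (0 + u) \<omega>) (\<lambda>u. 1 * B (0 + u) \<omega>)))"
    by (intro holds_except_conj 1 holds_except_AE) (use K.V_path[OF d] K.paths in eventually_elim, auto)
  then show ?thesis
  proof (rule holds_except_mono)
    fix \<omega> assume *: "snd (V {..n} 0 1 d j \<omega>) \<noteq> 1 \<and>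
    ((\<forall>j. V {..n} 0 1 d j \<omega> = path_steps (\<lambda>t. 1 * B (0 + t) \<omega>) (\<lambda>t. \<Sum>i\<in>{..n}. N i (0 + t) \<omega>) d j) \<and>
     driving_path (\<lambda>u. \<Sum>i\<in>{..n}. N i (0 + u) \<omega>) (\<lambda>u. 1 * B (0 + u) \<omega>))"
    then interpret driving_path "\<lambda>u. \<Sum>i\<le>n. N i u \<omega>" "\<lambda>u. B u \<omega>" by simp
    have dn: "real i * d = real i / real n" for i by (simp add: d_def)
    have "V {..n} 0 1 d j \<omega> = path_steps (\<lambda>t. 1 * B (0 + t) \<omega>) (\<lambda>t. \<Sum>i\<in>{..n}. N i (0 + t) \<omega>) d j"
      using * by blast
    then have "(\<Sum>i\<le>n. N i (real (Suc j) / real n) \<omega>) \<noteq> (\<Sum>i\<le>n. N i (real j / real n) \<omega>)"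
      using * unfolding path_steps_def dn by (auto simp del: of_nat_Suc)
    moreover have "(\<Sum>i\<le>n. N i (real j / real n) \<omega>) \<le> (\<Sum>i\<le>n. N i (real (Suc j) / real n) \<omega>)"
      by (rule m_mono) (auto simp: divide_right_mono)
    ultimately show "(\<Sum>i\<le>n. N i (real j / real n) \<omega>) < (\<Sum>i\<le>n. N i (real (Suc j) / real n) \<omega>)" by simp
  qed simp
qed

lemma n_powr_shift: "1 \<le> n \<Longrightarrow> real n * real n powr (- (q + 1)) = real n powr (- q)"
  using powr_mult_base[of "real n" "- (q + 1)"] by simp

lemma fall_good_prob:
  assumes n: "2 \<le> n" and rates: "(\<Sum>i\<le>n. rate i) = (real n)\<^sup>2"
  shows "holds_except (16 * exp 4 * real n powr (- q)) (\<lambda>\<omega>. fall_good n (q + 1) (\<lambda>u. B u \<omega>) (\<lambda>u. \<Sum>i\<le>n. N i u \<omega>))"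
proof -
  have "holds_except (real (card {1..2*n}) * (8 * exp 4 * real n powr (- (q + 1)))) (\<lambda>\<omega>. fall_good n (q + 1) (\<lambda>u. B u \<omega>) (\<lambda>u. \<Sum>i\<le>n. N i u \<omega>))"
    unfolding fall_good_def using n
    by (intro holds_except_ball fall_tail[OF n rates]) (auto simp: field_simps)
  also have "real (card {1..2*n}) * (8 * exp 4 * real n powr (- (q + 1))) = 16 * exp 4 * (real n * real n powr (- (q + 1)))" by simp
  also have "\<dots> = 16 * exp 4 * real n powr (- q)" using n_powr_shift[of n q] n by simp
  finally show ?thesis .
qed

text \<open>For \<gamma> = sqrt n the summand \<kappa> of the constant cancels the Gaussian exponent
  \<kappa> ln n / 2, and 2 (q + 1) leaves n^-(q + 1). One power of n is spent on the union over the
  grid, as in the other bounds of this kind.\<close>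

lemma osc_good_prob:
  assumes n: "3 \<le> n" and k: "0 < \<kappa>"
  shows "holds_except (24 * real n powr (- q)) (\<lambda>\<omega>. osc_good n \<kappa> (\<kappa> + 2 * (q + 1)) (\<lambda>u. B u \<omega>))"
proof -
  have l: "0 < ln (real n)" using n by simp
  have tail: "8 * exp ((sqrt (real n))\<^sup>2 * (\<kappa> * (ln (real n) / real n)) / 2 - sqrt (real n) * ((\<kappa> + 2 * (q + 1)) * (ln (real n) / sqrt (real n))) / 2)
     = 8 * real n powr (- (q + 1))"
    using n by (simp add: powr_def field_simps)
  have "holds_except (real (card {0..2*n}) * (8 * real n powr (- (q + 1)))) (\<lambda>\<omega>. osc_good n \<kappa> (\<kappa> + 2 * (q + 1)) (\<lambda>u. B u \<omega>))"
    unfolding osc_good_def tail[symmetric] using n k l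
    by (intro holds_except_ball oscillation_tail) auto
  then show ?thesis
  proof (rule holds_except_mono)
    have "real (card {0..2*n}) \<le> 3 * real n" using n by simp
    then have "real (card {0..2*n}) * (8 * real n powr (- (q + 1))) \<le> 3 * real n * (8 * real n powr (- (q + 1)))"
      by (intro mult_right_mono) auto
    also have "\<dots> = 24 * real n powr (- q)" using n_powr_shift[of n q] n by simp
    finally show "real (card {0..2*n}) * (8 * real n powr (- (q + 1))) \<le> 24 * real n powr (- q)" .
  qed
qed

lemma sup_good_prob:
  assumes n: "1 \<le> n"
  shows "holds_except (8 * exp (3/2) * real n powr (- q)) (\<lambda>\<omega>. sup_good n (2 * q) (\<lambda>u. B u \<omega>))"
proof -
  have "holds_except (8 * exp (1\<^sup>2 * 3 / 2 - 1 * (2 * q * ln (real n)) / 2) + 0)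
    (\<lambda>\<omega>. (\<forall>u\<in>{0..3}. \<bar>B (0 + u) \<omega> - B 0 \<omega>\<bar> \<le> 2 * q * ln (real n)) \<and> B 0 \<omega> = 0)"
    by (intro holds_except_conj oscillation_tail holds_except_AE B.B_0) auto
  then show ?thesis
  proof (rule holds_except_mono)
    have "1\<^sup>2 * 3 / 2 - 1 * (2 * q * ln (real n)) / 2 = 3 / 2 + - q * ln (real n)" by simp
    then show "8 * exp (1\<^sup>2 * 3 / 2 - 1 * (2 * q * ln (real n)) / 2) + 0 \<le> 8 * exp (3/2) * real n powr (- q)"
      using n by (simp only: exp_add powr_def) simp
  qed (auto simp: sup_good_def)
qed

text \<open>By ln n <= 2 sqrt n, the mean number of arrivals in a window is at most c / sqrt n.
  Hence \<open>poisson_tail\<close> with k >= 2 (q + 1) reaches the required power, with a bound on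
  the count that does not depend on n.\<close>

lemma count_good_prob:
  assumes k: "0 < \<kappa>"
  shows "\<exists>k C. \<forall>n\<ge>3. holds_except (C * real n powr (- q)) (\<lambda>\<omega>. count_good n \<kappa> k (\<lambda>u. N 0 u \<omega>))"
proof -
  define k where "k = nat \<lceil>2 * (q + 1)\<rceil>"
  have kq: "2 * (q + 1) \<le> real k" unfolding k_def by (rule real_nat_ceiling_ge)
  define c where "c = 2 * \<kappa> * rate 0"
  have r0: "0 \<le> rate 0" using poisson[of 0] by (simp add: poisson_process_def poisson_process_axioms_def)
  have c0: "0 \<le> c" using k r0 by (simp add: c_def)
  have "holds_except (3 * c ^ k * real n powr (- q)) (\<lambda>\<omega>. count_good n \<kappa> k (\<lambda>u. N 0 u \<omega>))" if n: "3 \<le> n" for n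
  proof -
    have n0: "real n \<ge> 3" using n by simp
    have "ln (sqrt (real n)) \<le> sqrt (real n)" using ln_bound[of "sqrt (real n)"] n0 by simp
    then have ln: "ln (real n) \<le> 2 * sqrt (real n)" using n0 by (simp add: ln_sqrt)
    have l0: "0 \<le> ln (real n)" using n0 by simp
    have e: "(rate 0 * (\<kappa> * (ln (real n) / real n))) ^ k \<le> c ^ k * real n powr (- (q + 1))"
    proof -
      have "rate 0 * (\<kappa> * (ln (real n) / real n)) \<le> rate 0 * (\<kappa> * (2 * sqrt (real n) / real n))"
        using r0 k ln n0 by (intro mult_left_mono divide_right_mono) auto
      also have "\<dots> = c / sqrt (real n)"
        using n0 by (simp add: c_def field_simps)
      finally have "(rate 0 * (\<kappa> * (ln (real n) / real n))) ^ k \<le> (c / sqrt (real n)) ^ k"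
        using r0 k l0 n0 by (intro power_mono) auto
      also have "\<dots> = c ^ k * real n powr (- (real k / 2))"
        using n0 by (simp add: power_divide powr_half_sqrt[symmetric] powr_powr powr_realpow[symmetric] powr_minus field_simps)
      also have "\<dots> \<le> c ^ k * real n powr (- (q + 1))"
        using kq n0 c0 by (intro mult_left_mono powr_mono) auto
      finally show ?thesis .
    qed
    have "holds_except (real (card {0..2*n}) * (c ^ k * real n powr (- (q + 1)))) (\<lambda>\<omega>. count_good n \<kappa> k (\<lambda>u. N 0 u \<omega>))"
      unfolding count_good_def
    proof (intro holds_except_ball)
      fix i assume "i \<in> {0..2*n}"
      have "holds_except ((rate 0 * (real i / real n + \<kappa> * (ln (real n) / real n) - real i / real n)) ^ k)
        (\<lambda>\<omega>. N 0 (real i / real n + \<kappa> * (ln (real n) / real n)) \<omega> - N 0 (real i / real n) \<omega> < k)"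
        using k l0 by (intro poisson_tail) auto
      then show "holds_except (c ^ k * real n powr (- (q + 1)))
         (\<lambda>\<omega>. N 0 (real i / real n + \<kappa> * (ln (real n) / real n)) \<omega> \<le> N 0 (real i / real n) \<omega> + k)"
        by (rule holds_except_mono) (use e in auto)
    qed (use c0 in auto)
    then show ?thesis
    proof (rule holds_except_mono)
      have "real (card {0..2*n}) \<le> 3 * real n" using n by simp
      then have "real (card {0..2*n}) * (c ^ k * real n powr (- (q + 1))) \<le> 3 * real n * (c ^ k * real n powr (- (q + 1)))"
        using c0 by (intro mult_right_mono) auto
      also have "\<dots> = 3 * c ^ k * (real n * real n powr (- (q + 1)))" by simp
      also have "\<dots> = 3 * c ^ k * real n powr (- q)" using n_powr_shift[of n q] n by simp
      finally show "real (card {0..2*n}) * (c ^ k * real n powr (- (q + 1))) \<le> 3 * c ^ k * real n powr (- q)" .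
    qed
  qed
  then show ?thesis by blast
qed

lemma gap_good_prob:
  "\<exists>C. \<forall>n\<ge>1. (\<Sum>i\<le>n. rate i) = (real n)\<^sup>2 \<longrightarrow>
     holds_except (C * real n powr (- q)) (\<lambda>\<omega>. gap_good n (\<lambda>u. \<Sum>i\<le>n. N i u \<omega>))"
proof -
  have "(\<lambda>n. real n powr (q + 1) * exp (- real n)) \<longlonglongrightarrow> 0" by real_asymp
  then have "Bseq (\<lambda>n. real n powr (q + 1) * exp (- real n))" by (intro convergent_imp_Bseq convergentI)
  then obtain C where C: "C > 0" "\<And>n. norm (real n powr (q + 1) * exp (- real n)) \<le> C" by (auto simp: Bseq_def)
  have "holds_except (2 * C * real n powr (- q)) (\<lambda>\<omega>. gap_good n (\<lambda>u. \<Sum>i\<le>n. N i u \<omega>))"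
    if n: "1 \<le> n" and r: "(\<Sum>i\<le>n. rate i) = (real n)\<^sup>2" for n
  proof -
    have "holds_except (real (card {..<2*n}) * exp (- real n)) (\<lambda>\<omega>. gap_good n (\<lambda>u. \<Sum>i\<le>n. N i u \<omega>))"
      unfolding gap_good_def by (intro holds_except_ball no_arrival n r) auto
    then show ?thesis
    proof (rule holds_except_mono)
      have "exp (- real n) = real n powr (- (q + 1)) * (real n powr (q + 1) * exp (- real n))"
        using n by (simp add: powr_minus[of _ "q + 1"] del: minus_add_distrib)
      also have "\<dots> \<le> real n powr (- (q + 1)) * C" using C(2)[of n] by (intro mult_left_mono) auto
      finally have "real (card {..<2*n}) * exp (- real n) \<le> real (2 * n) * (real n powr (- (q + 1)) * C)"
        unfolding card_lessThan by (rule mult_left_mono) simp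
      also have "\<dots> = 2 * C * (real n * real n powr (- (q + 1)))" by simp
      also have "\<dots> = 2 * C * real n powr (- q)" using n_powr_shift[OF n, of q] by (simp only:)
      finally show "real (card {..<2*n}) * exp (- real n) \<le> 2 * C * real n powr (- q)" .
    qed
  qed
  then show ?thesis by blast
qed

end

subsection \<open>Modulated paths\<close>

lemma bounded_borel_integrable_on:
  fixes f :: "real \<Rightarrow> real"
  assumes "f \<in> borel_measurable borel" "\<And>x. \<bar>f x\<bar> \<le> C"
  shows "f integrable_on {a..b}"
proof (rule measurable_bounded_by_integrable_imp_integrable)
  have "f \<in> borel_measurable lebesgue" using assms(1) by (simp add: measurable_completion)
  then show "f \<in> borel_measurable (lebesgue_on {a..b})" by (rule measurable_restrict_space1)
  show "(\<lambda>_. C) integrable_on {a..b}" by (rule integrable_const_ivl)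
  show "{a..b} \<in> sets lebesgue" by simp
qed (use assms in auto)

text \<open>When every count is reached, no epoch is the infimum of an empty set, and epochs and
  counts form a Galois connection, \<open>ep_le_iff\<close>.\<close>

locale unbounded_counting = counting_path +
  assumes unbounded: "\<exists>t\<ge>0. k \<le> m t"
begin

lemma ep_nonneg: "0 \<le> ep k"
  using unbounded[of k] ep_ge_0 by blast

lemma ep_le_iff: "0 \<le> t \<Longrightarrow> ep k \<le> t \<longleftrightarrow> k \<le> m t"
  using ep_le[of t k] less_ep[of t k] unbounded[of k] m_ep m_mono[OF ep_nonneg, of k t] by fastforce

lemma m_ep_ge: "k \<le> m (ep k)"
  using ep_le_iff[OF ep_nonneg, of k k] by simp

lemma ep_mono_all: "k \<le> l \<Longrightarrow> ep k \<le> ep l"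
  using unbounded[of l] ep_mono by blast

lemma current: "0 \<le> t \<Longrightarrow> ep (m t) \<le> t" "0 \<le> t \<Longrightarrow> t < ep (Suc (m t))" "0 \<le> t \<Longrightarrow> m (ep (m t)) = m t"
proof -
  assume t: "0 \<le> t"
  show 1: "ep (m t) \<le> t" using ep_le_iff[OF t, of "m t"] by simp
  show "t < ep (Suc (m t))" using ep_le_iff[OF t, of "Suc (m t)"] by auto
  show "m (ep (m t)) = m t" using m_ep_ge[of "m t"] m_mono[OF ep_nonneg 1] by simp
qed

lemma m_const: "ep k \<le> u \<Longrightarrow> u < ep (Suc k) \<Longrightarrow> m u = k"
proof -
  assume u: "ep k \<le> u" "u < ep (Suc k)"
  have u0: "0 \<le> u" using ep_nonneg[of k] u(1) by linarith
  have "k \<le> m u" using iffD1[OF ep_le_iff[OF u0] u(1)] .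
  moreover have "\<not> Suc k \<le> m u"
  proof
    assume "Suc k \<le> m u"
    from iffD2[OF ep_le_iff[OF u0] this] u(2) show False by linarith
  qed
  ultimately show "m u = k" by linarith
qed

text \<open>The index sets \<open>ep k < t\<close> and \<open>k \<le> m t\<close> differ only in
  epochs equal to \<open>t\<close>, and their increments vanish because the right end is cut off at
  \<open>t\<close>.\<close>

lemma stochastic_integral_eq:
  assumes t: "0 \<le> t"
  shows "simple_stochastic_integral ep h b t =
    (\<Sum>k<m t. h k * (b (ep (Suc k)) - b (ep k))) + h (m t) * (b t - b (ep (m t)))"
proof -
  have sub: "{k. ep k < t} \<subseteq> {..m t}"
  proof
    fix k assume "k \<in> {k. ep k < t}"
    then have "ep k \<le> t" by simp
    then show "k \<in> {..m t}" using iffD1[OF ep_le_iff[OF t]] by simp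
  qed
  have "simple_stochastic_integral ep h b t = (\<Sum>k\<le>m t. h k * (b (min t (ep (Suc k))) - b (ep k)))"
    unfolding simple_stochastic_integral_def
  proof (rule sum.mono_neutral_cong_left)
    show "\<forall>k\<in>{..m t} - {k. ep k < t}. h k * (b (min t (ep (Suc k))) - b (ep k)) = 0"
    proof
    fix k assume k: "k \<in> {..m t} - {k. ep k < t}"
    have "ep k \<le> t" using iffD2[OF ep_le_iff[OF t], of k] k by simp
    moreover have "\<not> ep k < t" using k by blast
    ultimately have "ep k = t" by linarith
    moreover from this have "t \<le> ep (Suc k)" using ep_mono_all[of k "Suc k"] by simp
    ultimately show "h k * (b (min t (ep (Suc k))) - b (ep k)) = 0" by simp
    qed
  qed (use sub in auto)
  also have "\<dots> = (\<Sum>k<m t. h k * (b (min t (ep (Suc k))) - b (ep k))) + h (m t) * (b (min t (ep (Suc (m t)))) - b (ep (m t)))"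
    by (simp add: lessThan_Suc_atMost[symmetric])
  also have "min t (ep (Suc (m t))) = t" using current(2)[OF t] by simp
  also have "(\<Sum>k<m t. h k * (b (min t (ep (Suc k))) - b (ep k))) = (\<Sum>k<m t. h k * (b (ep (Suc k)) - b (ep k)))"
  proof (rule sum.cong[OF refl])
    fix k assume "k \<in> {..<m t}"
    then have "ep (Suc k) \<le> t" using ep_le_iff[OF t, of "Suc k"] by auto
    then show "h k * (b (min t (ep (Suc k))) - b (ep k)) = h k * (b (ep (Suc k)) - b (ep k))" by (simp add: min_def)
  qed
  finally show ?thesis .
qed

end

locale modulated_path = P: unbounded_counting m0
  for m0 :: "real \<Rightarrow> nat" +
  fixes b :: "real \<Rightarrow> real" and x :: "nat \<Rightarrow> 's" and \<mu> \<sigma> :: "'s \<Rightarrow> real" and A :: real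
  assumes cont_b: "continuous_on {0..} b" and b_0: "b 0 = 0"
    and A: "1 \<le> A" "\<bar>\<mu> i\<bar> \<le> A" "\<sigma> i \<le> A" "1 / \<sigma> i \<le> A" "0 < \<sigma> i"
begin

abbreviation "j \<equiv> mmbm_phase m0 x"
abbreviation "r \<equiv> mmbm_level \<mu> \<sigma> b m0 x"

lemma j_eq: "j t = x (m0 t)"
  by (simp add: mmbm_phase_def)

lemma drift_integrable: "(\<lambda>s. \<mu> (j s)) integrable_on {s..t}" if "0 \<le> s"
proof -
  \<comment> \<open>The count is monotone only for nonnegative times; \<open>max u 0\<close> extends
    it to a monotone, hence Borel, function on the whole line.\<close>
  have "mono (\<lambda>u. real (m0 (max u 0)))" by (intro monoI) (auto intro!: P.m_mono)
  then have "(\<lambda>u. real (m0 (max u 0))) \<in> borel_measurable borel" by (rule borel_measurable_mono)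
  then have "(\<lambda>u. nat \<lfloor>real (m0 (max u 0))\<rfloor>) \<in> measurable borel (count_space UNIV)" by measurable
  then have 1: "(\<lambda>u. m0 (max u 0)) \<in> measurable borel (count_space UNIV)" by simp
  have "(\<lambda>k. \<mu> (x k)) \<in> measurable (count_space UNIV) borel" by simp
  from measurable_compose[OF 1 this] have "(\<lambda>u. \<mu> (x (m0 (max u 0)))) \<in> borel_measurable borel" .
  then have "(\<lambda>u. \<mu> (x (m0 (max u 0)))) integrable_on {s..t}"
    by (rule bounded_borel_integrable_on[where C=A]) (rule A)
  then show ?thesis by (rule integrable_eq) (use that in \<open>auto simp: j_eq max_absorb1\<close>)
qed

lemma r_0: "r 0 = 0"
  using P.stochastic_integral_eq[of 0 _ b] by (simp add: mmbm_level_def P.m_0 P.ep_0)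

text \<open>Constancy on the half-open interval is enough: an arrival at \<open>t\<close> changes
  the drift on a null set only, and the stochastic integral uses the left-continuous integrand. All
  epochs counted between \<open>s\<close> and \<open>t\<close> then coincide with \<open>t\<close>
  and contribute zero increments.\<close>

lemma r_increment:
  assumes st: "0 \<le> s" "s \<le> t" and const: "\<And>u. s \<le> u \<Longrightarrow> u < t \<Longrightarrow> m0 u = m0 s"
  shows "r t - r s = \<mu> (j s) * (t - s) + \<sigma> (j s) * (b t - b s)"
proof -
  have t: "0 \<le> t" using st by simp
  have 1: "integral {0..t} (\<lambda>s. \<mu> (j s)) = integral {0..s} (\<lambda>s. \<mu> (j s)) + integral {s..t} (\<lambda>s. \<mu> (j s))"
    using st drift_integrable[of 0 t] by (intro Henstock_Kurzweil_Integration.integral_combine[symmetric]) auto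
  have 2: "integral {s..t} (\<lambda>s. \<mu> (j s)) = \<mu> (j s) * (t - s)"
  proof -
    have "integral {s..t} (\<lambda>u. \<mu> (j u)) = integral {s..t} (\<lambda>u. \<mu> (j s))"
      
    proof (rule integral_spike[of "{t}"])
      fix u assume "u \<in> {s..t} - {t}"
      then have "m0 u = m0 s" using const[of u] by simp
      then show "\<mu> (j s) = \<mu> (j u)" by (simp add: j_eq)
    qed simp
    then show ?thesis using st by simp
  qed
  define h where "h k = \<sigma> (j (P.ep k))" for k
  have hK: "h (m0 s) = \<sigma> (j s)" using P.current(3)[OF st(1)] by (simp add: h_def j_eq)
  have 3: "simple_stochastic_integral P.ep h b t - simple_stochastic_integral P.ep h b s = \<sigma> (j s) * (b t - b s)"
  proof (cases "m0 t = m0 s")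
    case True
    then show ?thesis unfolding P.stochastic_integral_eq[OF t] P.stochastic_integral_eq[OF st(1)]
      using hK by (simp add: algebra_simps)
  next
    case False
    then have lt: "m0 s < m0 t" using P.m_mono[OF st] by simp
    have ep: "P.ep k = t" if k: "m0 s < k" "k \<le> m0 t" for k
    proof (rule antisym)
      show "P.ep k \<le> t" using iffD2[OF P.ep_le_iff[OF t] k(2)] .
      show "t \<le> P.ep k"
      proof (rule ccontr)
        assume "\<not> t \<le> P.ep k"
        moreover have "s \<le> P.ep k"
        proof (rule ccontr)
          assume "\<not> s \<le> P.ep k"
          then have "k \<le> m0 s" using iffD1[OF P.ep_le_iff[OF st(1)], of k] by simp
          then show False using k by simp
        qed
        ultimately have "m0 (P.ep k) = m0 s" using const[of "P.ep k"] by simp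
        then show False using P.m_ep_ge[of k] k by simp
      qed
    qed
    have "(\<Sum>k<m0 t. h k * (b (P.ep (Suc k)) - b (P.ep k))) =
        (\<Sum>k<m0 s. h k * (b (P.ep (Suc k)) - b (P.ep k))) + (\<Sum>k=m0 s..<m0 t. h k * (b (P.ep (Suc k)) - b (P.ep k)))"
      unfolding lessThan_atLeast0 using lt by (intro sum.atLeastLessThan_concat[symmetric]) auto
    also have "(\<Sum>k=m0 s..<m0 t. h k * (b (P.ep (Suc k)) - b (P.ep k))) = (\<Sum>k\<in>{m0 s}. h k * (b (P.ep (Suc k)) - b (P.ep k)))"
      by (rule sum.mono_neutral_right) (use lt ep in auto)
    also have "\<dots> = h (m0 s) * (b t - b (P.ep (m0 s)))" using ep[of "Suc (m0 s)"] lt by simp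
    finally show ?thesis
      unfolding P.stochastic_integral_eq[OF t] P.stochastic_integral_eq[OF st(1)]
      using hK ep[of "m0 t"] lt by (simp add: algebra_simps)
  qed
  show ?thesis using 1 2 3 unfolding mmbm_level_def h_def by simp
qed

text \<open>Induction over the phase arrivals in (s, t]: the coefficients are constant up to the
  next arrival, and each stretch costs one oscillation of \<open>b\<close>.\<close>

lemma r_modulus:
  assumes "0 \<le> s" "s \<le> t" "\<And>u v. u \<in> {s..t} \<Longrightarrow> v \<in> {s..t} \<Longrightarrow> \<bar>b u - b v\<bar> \<le> e"
  shows "\<bar>r t - r s\<bar> \<le> A * (t - s) + A * (real (m0 t - m0 s) + 1) * e"
  using assms
proof (induction "m0 t - m0 s" arbitrary: s rule: less_induct)
  case less
  have e0: "0 \<le> e" using less.prems(3)[of s s] less.prems(2) by auto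
  have piece: "\<bar>r v - r s\<bar> \<le> A * (v - s) + A * e"
    if v: "s \<le> v" "v \<le> t" "\<And>u. s \<le> u \<Longrightarrow> u < v \<Longrightarrow> m0 u = m0 s" for v
  proof -
    have "r v - r s = \<mu> (j s) * (v - s) + \<sigma> (j s) * (b v - b s)"
      using r_increment[OF less.prems(1) v(1)] v(3) by blast
    also have "\<bar>\<dots>\<bar> \<le> \<bar>\<mu> (j s)\<bar> * \<bar>v - s\<bar> + \<bar>\<sigma> (j s)\<bar> * \<bar>b v - b s\<bar>"
      by (metis abs_mult abs_triangle_ineq)
    also have "\<dots> \<le> A * (v - s) + A * e"
      using v A(2,3,5)[of "j s"] A(1) less.prems(3)[of v s] e0
      by (intro add_mono mult_mono) auto
    finally show ?thesis .
  qed
  show ?case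
  proof (cases "m0 t = m0 s")
    case True
    have "m0 u = m0 s" if "s \<le> u" "u < t" for u
      using P.m_mono[of s u] P.m_mono[of u t] less.prems(1,2) that True by simp
    from piece[OF less.prems(2) order_refl this] show ?thesis using True by simp
  next
    case False
    then have lt: "m0 s < m0 t" using P.m_mono[of s t] less.prems by simp
    define v where "v = P.ep (Suc (m0 s))"
    have v1: "s < v" using P.current(2)[OF less.prems(1)] by (simp add: v_def)
    have "0 \<le> t" using less.prems(1,2) by simp
    from iffD2[OF P.ep_le_iff[OF this], of "Suc (m0 s)"] have v2: "v \<le> t" using lt by (simp add: v_def)
    note v = v1 v2
    have c: "m0 u = m0 s" if "s \<le> u" "u < v" for u
      by (rule P.m_const) (use P.current(1)[OF less.prems(1)] that in \<open>auto simp: v_def\<close>)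
    have mv: "Suc (m0 s) \<le> m0 v" using P.m_ep_ge[of "Suc (m0 s)"] by (simp add: v_def)
    have mvt: "m0 v \<le> m0 t" using P.m_mono[of v t] v less.prems by simp
    have "\<bar>r t - r v\<bar> \<le> A * (t - v) + A * (real (m0 t - m0 v) + 1) * e"
    proof (rule less.hyps)
      show "m0 t - m0 v < m0 t - m0 s" "0 \<le> v" using mv mvt v less.prems(1) by auto
      show "\<bar>b y - b z\<bar> \<le> e" if "y \<in> {v..t}" "z \<in> {v..t}" for y z
        using less.prems(3)[of y z] that v by auto
    qed (rule v2)
    moreover have "\<bar>r v - r s\<bar> \<le> A * (v - s) + A * e" by (rule piece[OF _ v2 c]) (use v1 in auto)
    moreover have "A * (real (m0 t - m0 v) + 1) * e + A * e \<le> A * (real (m0 t - m0 s) + 1) * e"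
    proof -
      have "A * e * (real (m0 t - m0 v) + 2) \<le> A * e * (real (m0 t - m0 s) + 1)"
        using mv mvt e0 A(1) by (intro mult_left_mono) auto
      then show ?thesis by (simp add: algebra_simps)
    qed
    ultimately show ?thesis by (simp add: algebra_simps)
  qed
qed

text \<open>On [0, t] there are at most \<open>m0 t\<close> arrivals of the phase clock, so
  \<open>r_modulus\<close> transfers uniform continuity from \<open>b\<close> to \<open>r\<close>
  with one constant.\<close>

lemma continuous_r: "continuous_on {0..} r"
proof -
  have ct: "continuous_on {0..t} r" for t
  proof (cases "0 \<le> t")
    case True
    define C where "C = A * (real (m0 t) + 1)"
    have C: "A \<le> C" "0 < C" using A(1) by (auto simp: C_def)
    have "uniformly_continuous_on {0..t} b"
      by (intro compact_uniformly_continuous continuous_on_subset[OF cont_b]) auto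
    then have uc: "\<And>e. e > 0 \<Longrightarrow> \<exists>d>0. \<forall>u\<in>{0..t}. \<forall>v\<in>{0..t}. dist v u < d \<longrightarrow> dist (b v) (b u) < e"
      unfolding uniformly_continuous_on_def by blast
    have "uniformly_continuous_on {0..t} r"
      unfolding uniformly_continuous_on_def
    proof (intro allI impI)
      fix e :: real assume e: "0 < e"
      obtain d where d: "d > 0" "\<forall>u\<in>{0..t}. \<forall>v\<in>{0..t}. dist v u < d \<longrightarrow> dist (b v) (b u) < e / (2 * C)"
        using uc[of "e / (2 * C)"] e C by auto
      define d' where "d' = min d (e / (4 * C))"
      have d': "d' > 0" "d' \<le> d" "C * d' \<le> e / 4" using d e C
        by (auto simp: d'_def min_def field_simps)
      have main: "\<bar>r v - r u\<bar> < e" if uv: "0 \<le> u" "u \<le> v" "v \<le> t" "v - u < d'" for u v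
      proof -
        have "\<bar>r v - r u\<bar> \<le> A * (v - u) + A * (real (m0 v - m0 u) + 1) * (e / (2 * C))"
        proof (rule r_modulus[OF uv(1,2)])
          fix y z assume "y \<in> {u..v}" "z \<in> {u..v}"
          then have "dist (b y) (b z) < e / (2 * C)" using d(2) uv d' by (auto simp: dist_real_def)
          then show "\<bar>b y - b z\<bar> \<le> e / (2 * C)" by (simp add: dist_real_def)
        qed
        also have "\<dots> \<le> C * d' + C * (e / (2 * C))"
          using P.m_mono[of v t] uv C A(1) e d' unfolding C_def
          by (intro add_mono mult_mono) auto
        also have "\<dots> \<le> e / 4 + e / 2" using d' C by simp
        finally show ?thesis using e by simp
      qed
      show "\<exists>d>0. \<forall>u\<in>{0..t}. \<forall>v\<in>{0..t}. dist v u < d \<longrightarrow> dist (r v) (r u) < e"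
      proof (intro exI[of _ d'] conjI ballI impI d')
        fix u v assume "u \<in> {0..t}" "v \<in> {0..t}" "dist v u < d'"
        then show "dist (r v) (r u) < e"
          using main[of u v] main[of v u] by (cases "u \<le> v") (auto simp: dist_real_def abs_minus_commute)
      qed
    qed
    then show ?thesis by (rule uniformly_continuous_imp_continuous)
  qed simp
  have c: "continuous_on {0..<t} r" for t
    by (rule continuous_on_subset[OF ct[of t]]) auto
  show ?thesis
    unfolding continuous_on_eq_continuous_within
  proof
    fix s :: real assume s: "s \<in> {0..}"
    have "continuous (at s within {0..<s+1}) r" using c[of "s + 1"] s by (auto simp: continuous_on_eq_continuous_within)
    moreover have "at s within {0..<s+1} = at s within {0..}"
      by (rule at_within_nhd[of _ "{..<s+1}"]) auto
    ultimately show "continuous (at s within {0..}) r" by (simp add: continuous_within)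
  qed
qed

end

subsection \<open>Fluid epochs\<close>

text \<open>\<open>refine\<close> says that \<open>m\<close> has at least as many arrivals as
  \<open>m0\<close> in every interval, so that the phase can only change at epochs of
  \<open>m\<close>.\<close>

locale fluid_path = modulated_path m0 b x \<mu> \<sigma> A + Q: unbounded_counting m
  for m0 b and x :: "nat \<Rightarrow> 's" and \<mu> \<sigma> A m +
  fixes l :: real
  assumes l: "0 < l"
    and refine: "0 \<le> s \<Longrightarrow> s \<le> t \<Longrightarrow> m0 t + m s \<le> m t + m0 s"
begin

abbreviation "\<theta> \<equiv> arrival_epoch m"
abbreviation "L \<equiv> fluid_L m r"
abbreviation "H \<equiv> fluid_H m r"
abbreviation "Lh \<equiv> fluid_Lhat \<mu> \<sigma> l m r j"
abbreviation "Hh \<equiv> fluid_Hhat \<mu> \<sigma> l m r j"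
abbreviation "c \<equiv> fluid_epoch \<mu> \<sigma> l m r j"
abbreviation "om i \<equiv> omega_rate \<mu> \<sigma> l i"
abbreviation "et i \<equiv> eta_rate \<mu> \<sigma> l i"
abbreviation "phase \<equiv> fluid_phase \<mu> \<sigma> l m r j"

text \<open>\<open>om\<close> and \<open>et\<close> are the exponential rates in the Wiener-Hopf
  factorisation of Brownian motion with drift at an exponential time of rate l / 2, and this is
  their mean. Hence om L + et H = 2 mean_rate L + et (H - L), where H - L is an increment of the
  level.\<close>

definition mean_rate :: "'s \<Rightarrow> real" where "mean_rate i = sqrt ((\<mu> i)\<^sup>2 / (\<sigma> i)^4 + l / (\<sigma> i)\<^sup>2)"
text \<open>An increment of \<open>b\<close> enters an epoch with coefficient et \<sigma> / l. The
  leading part 1 / sqrt l is the same for all phases and telescopes; the rest depends on the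
  phase.\<close>

definition increment_excess :: "'s \<Rightarrow> real" where "increment_excess i = et i * \<sigma> i / l - 1 / sqrt l"
abbreviation "gap k \<equiv> \<theta> (Suc k) - \<theta> k"
abbreviation "f k \<equiv> fall b (\<theta> k) (\<theta> (Suc k))"

lemma om_eq: "om i = mean_rate i + \<mu> i / (\<sigma> i)\<^sup>2" and et_eq: "et i = mean_rate i - \<mu> i / (\<sigma> i)\<^sup>2"
  by (simp_all add: omega_rate_def eta_rate_def mean_rate_def)

lemma rate_pos: "0 < om i" "0 < et i"
proof -
  have "\<bar>\<mu> i / (\<sigma> i)\<^sup>2\<bar> = sqrt ((\<mu> i)\<^sup>2 / (\<sigma> i)^4)"
    unfolding real_sqrt_abs[symmetric] power_divide power_mult[symmetric] by simp
  also have "\<dots> < mean_rate i" unfolding mean_rate_def using A(5)[of i] l by (intro real_sqrt_less_mono) simp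
  finally show "0 < om i" "0 < et i" unfolding om_eq et_eq by linarith+
qed

text \<open>The product \<open>mean_rate i * \<sigma> i\<close> is sqrt ((\<mu> / \<sigma>)^2 + l),
  which lies between sqrt l and sqrt l + \<bar>\<mu> / \<sigma>\<bar>. The other estimates follow
  from this one.\<close>

lemma rate_bounds:
  assumes "1 \<le> l"
  shows "sqrt l \<le> mean_rate i * \<sigma> i" "mean_rate i * \<sigma> i \<le> sqrt l + A\<^sup>2" "0 \<le> mean_rate i" "mean_rate i \<le> 2 * A^3 * sqrt l"
  "et i \<le> 3 * A^3 * sqrt l" "\<bar>increment_excess i\<bar> \<le> 2 * A\<^sup>2 / l"
proof -
  have s: "0 < \<sigma> i" by (rule A)
  have l1: "1 \<le> sqrt l" using assms by simp
  have eq: "mean_rate i * \<sigma> i = sqrt ((\<mu> i / \<sigma> i)\<^sup>2 + l)"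
  proof -
    have "mean_rate i * \<sigma> i = sqrt ((\<mu> i)\<^sup>2 / (\<sigma> i)^4 + l / (\<sigma> i)\<^sup>2) * sqrt ((\<sigma> i)\<^sup>2)" using s by (simp add: mean_rate_def)
    also have "\<dots> = sqrt (((\<mu> i)\<^sup>2 / (\<sigma> i)^4 + l / (\<sigma> i)\<^sup>2) * (\<sigma> i)\<^sup>2)" by (simp only: real_sqrt_mult)
    also have "((\<mu> i)\<^sup>2 / (\<sigma> i)^4 + l / (\<sigma> i)\<^sup>2) * (\<sigma> i)\<^sup>2 = (\<mu> i / \<sigma> i)\<^sup>2 + l"
      using s by (simp add: field_simps power2_eq_square power4_eq_xxxx)
    finally show ?thesis .
  qed
  show 1: "sqrt l \<le> mean_rate i * \<sigma> i" unfolding eq by (intro real_sqrt_le_mono) simp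
  have q: "\<bar>\<mu> i / \<sigma> i\<bar> \<le> A\<^sup>2"
  proof -
    have "\<bar>\<mu> i / \<sigma> i\<bar> = \<bar>\<mu> i\<bar> * (1 / \<sigma> i)" using s by (simp add: abs_divide)
    also have "\<dots> \<le> A * A" using A(1) A(2,4,5)[of i] by (intro mult_mono) auto
    finally show ?thesis by (simp add: power2_eq_square)
  qed
  have "sqrt ((\<mu> i / \<sigma> i)\<^sup>2 + l) \<le> sqrt ((\<mu> i / \<sigma> i)\<^sup>2) + sqrt l" using l by (intro sqrt_add_le_add_sqrt) auto
  then show 2: "mean_rate i * \<sigma> i \<le> sqrt l + A\<^sup>2" unfolding eq using q by simp
  show 3: "0 \<le> mean_rate i" using l by (simp add: mean_rate_def)
  have A1: "1 \<le> A\<^sup>2" "A \<le> A^3" using A(1) self_le_power[of A 3] by (auto simp: one_le_power)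
  show 4: "mean_rate i \<le> 2 * A^3 * sqrt l"
  proof -
    have "mean_rate i = (mean_rate i * \<sigma> i) * (1 / \<sigma> i)" using s by simp
    also have "\<dots> \<le> (sqrt l + A\<^sup>2) * A" using 1 2 A(1) A(4,5)[of i] l1 by (intro mult_mono) auto
    also have "\<dots> = A * sqrt l + A^3 * 1" by (simp add: algebra_simps power2_eq_square power3_eq_cube)
    also have "\<dots> \<le> A^3 * sqrt l + A^3 * sqrt l" using A1 l1 A(1) by (intro add_mono mult_mono) auto
    finally show ?thesis by (simp add: mult_ac)
  qed
  have mu: "\<bar>\<mu> i / (\<sigma> i)\<^sup>2\<bar> \<le> A^3"
  proof -
    have "\<bar>\<mu> i / (\<sigma> i)\<^sup>2\<bar> = \<bar>\<mu> i / \<sigma> i\<bar> * (1 / \<sigma> i)" using s by (simp add: abs_divide power2_eq_square)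
    also have "\<dots> \<le> A\<^sup>2 * A" using q A(4,5)[of i] by (intro mult_mono) auto
    finally show ?thesis by (simp add: power2_eq_square power3_eq_cube)
  qed
  have "A^3 * 1 \<le> A^3 * sqrt l" using A(1) l1 by (intro mult_left_mono) auto
  then show "et i \<le> 3 * A^3 * sqrt l" using 4 mu unfolding et_eq by linarith
  have "increment_excess i = (mean_rate i * \<sigma> i - sqrt l - \<mu> i / \<sigma> i) / l"
  proof -
    have "1 / sqrt l = sqrt l / l" using l by (simp add: field_simps)
    moreover have "et i * \<sigma> i = mean_rate i * \<sigma> i - \<mu> i / \<sigma> i"
      using s by (simp add: et_eq left_diff_distrib power2_eq_square)
    ultimately show ?thesis by (simp add: increment_excess_def diff_divide_distrib)
  qed
  then have "\<bar>increment_excess i\<bar> = \<bar>mean_rate i * \<sigma> i - sqrt l - \<mu> i / \<sigma> i\<bar> / l" using l by simp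
  also have "\<bar>mean_rate i * \<sigma> i - sqrt l - \<mu> i / \<sigma> i\<bar> \<le> 2 * A\<^sup>2" using 1 2 q by linarith
  then have "\<bar>mean_rate i * \<sigma> i - sqrt l - \<mu> i / \<sigma> i\<bar> / l \<le> 2 * A\<^sup>2 / l" using l by (intro divide_right_mono) auto
  finally show "\<bar>increment_excess i\<bar> \<le> 2 * A\<^sup>2 / l" .
qed

lemma gap_nonneg: "0 \<le> gap k"
  using Q.ep_mono_all[of k "Suc k"] by simp

text \<open>While \<open>m\<close> stands still, \<open>refine\<close> prevents \<open>m0\<close>
  from moving. The right end is included although the phase may change there, since
  \<open>r_increment\<close> only looks at earlier times.\<close>

lemma r_gap:
  assumes "u \<in> {\<theta> k..\<theta> (Suc k)}"
  shows "r u - r (\<theta> k) = \<mu> (j (\<theta> k)) * (u - \<theta> k) + \<sigma> (j (\<theta> k)) * (b u - b (\<theta> k))"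
proof (rule r_increment[OF Q.ep_nonneg])
  show "\<theta> k \<le> u" using assms by simp
  fix v assume v: "\<theta> k \<le> v" "v < u"
  have "m v = k" using v assms by (intro Q.m_const) auto
  then have "m0 v + m (\<theta> k) \<le> k + m0 (\<theta> k)" using refine[OF Q.ep_nonneg v(1)] by simp
  then have "m0 v \<le> m0 (\<theta> k)" using Q.m_ep_ge[of k] by linarith
  moreover have "m0 (\<theta> k) \<le> m0 v" by (rule P.m_mono[OF Q.ep_nonneg v(1)])
  ultimately show "m0 v = m0 (\<theta> k)" by simp
qed

lemma cont_b_gap: "continuous_on {\<theta> k..u} b"
  by (rule continuous_on_subset[OF cont_b]) (use Q.ep_nonneg[of k] in auto)

lemma cont_r_gap: "continuous_on {\<theta> k..u} r"
  by (rule continuous_on_subset[OF continuous_r]) (use Q.ep_nonneg[of k] in auto)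

lemma L_fall: "L k = fall r (\<theta> k) (\<theta> (Suc k))"
  by (simp add: fluid_L_def fall_def)

lemma H_eq: "H k = L k + (r (\<theta> (Suc k)) - r (\<theta> k))"
  by (simp add: fluid_L_def fluid_H_def)

lemma LH_nonneg: "0 \<le> L k" "0 \<le> H k"
proof -
  show "0 \<le> L k" unfolding L_fall using gap_nonneg by (intro fall_nonneg cont_r_gap) auto
  have "r (\<theta> k) - r (\<theta> (Suc k)) \<le> L k" unfolding L_fall using gap_nonneg[of k] by (intro fall_ge cont_r_gap) auto
  then show "0 \<le> H k" unfolding H_eq by simp
qed

text \<open>The minima of \<open>r\<close> and of \<open>b\<close> over the gap may be attained at
  different times; evaluating each path at the minimiser of the other gives the two inequalities,
  with the drift as error.\<close>

lemma L_approx: "\<bar>L k - \<sigma> (j (\<theta> k)) * f k\<bar> \<le> A * gap k"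
proof -
  define i where "i = j (\<theta> k)"
  have s: "0 < \<sigma> i" by (rule A)
  have g: "\<theta> k \<le> \<theta> (Suc k)" using gap_nonneg[of k] by simp
  have inc: "\<bar>(r (\<theta> k) - r u) - \<sigma> i * (b (\<theta> k) - b u)\<bar> \<le> A * gap k" if u: "u \<in> {\<theta> k..\<theta> (Suc k)}" for u
  proof -
    have "(r (\<theta> k) - r u) - \<sigma> i * (b (\<theta> k) - b u) = - (\<mu> i * (u - \<theta> k))"
      using r_gap[OF u] by (simp add: i_def algebra_simps)
    also have "\<bar>\<dots>\<bar> = \<bar>\<mu> i\<bar> * (u - \<theta> k)" using u by (simp add: abs_mult)
    also have "\<dots> \<le> A * gap k" using A(1) A(2)[of i] u by (intro mult_mono) auto
    finally show ?thesis .
  qed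
  obtain u where u: "u \<in> {\<theta> k..\<theta> (Suc k)}" "L k = r (\<theta> k) - r u"
    using fall_ex[OF cont_r_gap g] unfolding L_fall by blast
  obtain v where v: "v \<in> {\<theta> k..\<theta> (Suc k)}" "f k = b (\<theta> k) - b v"
    using fall_ex[OF cont_b_gap g] by blast
  have 1: "r (\<theta> k) - r v \<le> L k" unfolding L_fall by (rule fall_ge[OF cont_r_gap v(1)])
  have "b (\<theta> k) - b u \<le> f k" by (rule fall_ge[OF cont_b_gap u(1)])
  then have 2: "\<sigma> i * (b (\<theta> k) - b u) \<le> \<sigma> i * f k" using s by simp
  show ?thesis using inc[OF u(1)] inc[OF v(1)] 1 2 u(2) v(2) unfolding i_def[symmetric] by (simp add: abs_le_iff)
qed

lemma f_nonneg: "0 \<le> f k"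
  using gap_nonneg by (intro fall_nonneg cont_b_gap) auto

text \<open>After H is replaced by L plus an increment of the level, three errors remain: the drift
  in L, the excess of \<open>mean_rate i * \<sigma> i\<close> over sqrt l, and the drift in the
  increment.\<close>

lemma c_step_approx:
  assumes l1: "1 \<le> l"
  shows "\<bar>Lh k + Hh k - 2 / sqrt l * f k - (1 / sqrt l + increment_excess (j (\<theta> k))) * (b (\<theta> (Suc k)) - b (\<theta> k))\<bar>
    \<le> 2 * A\<^sup>2 / l * f k + 7 * A^4 / sqrt l * gap k"
proof -
  define i where "i = j (\<theta> k)"
  define q where "q = sqrt l"
  have q: "1 \<le> q" "l = q * q" using l1 by (auto simp: q_def)
  define db where "db = b (\<theta> (Suc k)) - b (\<theta> k)"
  have dr: "r (\<theta> (Suc k)) - r (\<theta> k) = \<mu> i * gap k + \<sigma> i * db"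
    using r_gap[of "\<theta> (Suc k)" k] gap_nonneg[of k] by (simp add: i_def db_def)
  have LH: "Lh k + Hh k = (2 * mean_rate i * L k + et i * (\<mu> i * gap k + \<sigma> i * db)) / l"
    unfolding fluid_Lhat_def fluid_Hhat_def H_eq dr i_def[symmetric] om_eq et_eq
    using l A(5)[of i] by (simp add: field_simps)
  have eq: "Lh k + Hh k - 2 / q * f k - (1 / q + increment_excess i) * db =
     2 * mean_rate i / l * (L k - \<sigma> i * f k) + 2 * (mean_rate i * \<sigma> i - q) / l * f k + et i * \<mu> i / l * gap k"
    unfolding LH increment_excess_def q_def[symmetric] using q by (simp add: field_simps)
  have 1: "\<bar>2 * mean_rate i / l * (L k - \<sigma> i * f k)\<bar> \<le> 4 * A^4 / q * gap k"
  proof -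
    have "\<bar>2 * mean_rate i / l * (L k - \<sigma> i * f k)\<bar> = 2 * mean_rate i / l * \<bar>L k - \<sigma> i * f k\<bar>"
      using rate_bounds(3)[OF l1, of i] l by (simp add: abs_mult)
    also have "\<dots> \<le> 2 * (2 * A^3 * q) / l * (A * gap k)"
      using rate_bounds(3,4)[OF l1, of i] l L_approx[of k] by (intro mult_mono divide_right_mono) (auto simp: q_def i_def)
    also have "\<dots> = 4 * A^4 / q * gap k" using q by (simp add: power3_eq_cube power4_eq_xxxx)
    finally show ?thesis .
  qed
  have 2: "\<bar>2 * (mean_rate i * \<sigma> i - q) / l * f k\<bar> \<le> 2 * A\<^sup>2 / l * f k"
  proof -
    have "\<bar>2 * (mean_rate i * \<sigma> i - q) / l * f k\<bar> = 2 * (mean_rate i * \<sigma> i - q) / l * f k"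
      using rate_bounds(1)[OF l1, of i] f_nonneg[of k] l by (simp add: q_def)
    also have "\<dots> \<le> 2 * A\<^sup>2 / l * f k"
      using rate_bounds(2)[OF l1, of i] f_nonneg[of k] l by (intro mult_right_mono divide_right_mono) (auto simp: q_def)
    finally show ?thesis .
  qed
  have 3: "\<bar>et i * \<mu> i / l * gap k\<bar> \<le> 3 * A^4 / q * gap k"
  proof -
    have "\<bar>et i * \<mu> i / l * gap k\<bar> = et i * \<bar>\<mu> i\<bar> / l * gap k"
      using rate_pos(2)[of i] gap_nonneg[of k] l by (simp add: abs_mult)
    also have "\<dots> \<le> (3 * A^3 * q) * A / l * gap k"
      using rate_bounds(5)[OF l1, of i] rate_pos(2)[of i] gap_nonneg[of k] l A(1) A(2)[of i]
      by (intro mult_right_mono divide_right_mono mult_mono) (auto simp: q_def)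
    also have "\<dots> = 3 * A^4 / q * gap k" using q by (simp add: power3_eq_cube power4_eq_xxxx)
    finally show ?thesis .
  qed
  have 4: "4 * A^4 / q * gap k + 3 * A^4 / q * gap k = 7 * A^4 / q * gap k"
    using q by (simp add: field_simps)
  have aux: "\<bar>u\<bar> \<le> U \<Longrightarrow> \<bar>v\<bar> \<le> V \<Longrightarrow> \<bar>w\<bar> \<le> W \<Longrightarrow> U + W = T \<Longrightarrow> \<bar>u + v + w\<bar> \<le> V + T"
    for u v w U V W T :: real by linarith
  show ?thesis unfolding q_def[symmetric] i_def[symmetric] db_def[symmetric] eq by (rule aux[OF 1 2 3 4])
qed

text \<open>Summation by parts: the phase changes at most \<open>m0\<close> times, and the coefficients are \<open>O(1 / l)\<close>.\<close>

lemma increment_excess_sum: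
  assumes l1: "1 \<le> l" and S: "\<And>k. k \<le> K \<Longrightarrow> \<bar>b (\<theta> k)\<bar> \<le> S"
  shows "\<bar>\<Sum>k<K. increment_excess (j (\<theta> k)) * (b (\<theta> (Suc k)) - b (\<theta> k))\<bar> \<le> 2 * A\<^sup>2 / l * S * (1 + 2 * real (m0 (\<theta> K)))"
proof -
  define E where "E = 2 * A\<^sup>2 / l"
  have S0: "0 \<le> S" using S[of 0] by auto
  have E0: "0 \<le> E" using l by (simp add: E_def)
  have E: "\<bar>increment_excess i\<bar> \<le> E" for i using rate_bounds(6)[OF l1] by (simp add: E_def)
  \<comment> \<open>Subtracting the boundary term makes the induction step vanish whenever the phase
    does not change.\<close>
  have "\<bar>(\<Sum>k<K'. increment_excess (j (\<theta> k)) * (b (\<theta> (Suc k)) - b (\<theta> k))) - increment_excess (j (\<theta> K')) * b (\<theta> K')\<bar>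
     \<le> E * S * (2 * real (m0 (\<theta> K')))" if "K' \<le> K" for K'
    using that
  proof (induction K')
    case 0 show ?case using E0 S0 by (simp add: Q.ep_0 b_0)
  next
    case (Suc K')
    let ?s = "\<lambda>K'. \<Sum>k<K'. increment_excess (j (\<theta> k)) * (b (\<theta> (Suc k)) - b (\<theta> k))"
    have IH: "\<bar>?s K' - increment_excess (j (\<theta> K')) * b (\<theta> K')\<bar> \<le> E * S * (2 * real (m0 (\<theta> K')))" using Suc by simp
    have eq: "?s (Suc K') - increment_excess (j (\<theta> (Suc K'))) * b (\<theta> (Suc K')) =
      (?s K' - increment_excess (j (\<theta> K')) * b (\<theta> K')) + (increment_excess (j (\<theta> K')) - increment_excess (j (\<theta> (Suc K')))) * b (\<theta> (Suc K'))"
      by (simp add: algebra_simps)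
    have mono: "m0 (\<theta> K') \<le> m0 (\<theta> (Suc K'))" using gap_nonneg[of K'] by (intro P.m_mono Q.ep_nonneg) simp
    have "\<bar>(increment_excess (j (\<theta> K')) - increment_excess (j (\<theta> (Suc K')))) * b (\<theta> (Suc K'))\<bar> \<le> E * S * (2 * real (m0 (\<theta> (Suc K')) - m0 (\<theta> K')))"
    proof (cases "m0 (\<theta> (Suc K')) = m0 (\<theta> K')")
      case True then show ?thesis by (simp add: j_eq)
    next
      case False
      have "\<bar>(increment_excess (j (\<theta> K')) - increment_excess (j (\<theta> (Suc K')))) * b (\<theta> (Suc K'))\<bar> \<le> (2 * E) * S"
        unfolding abs_mult using E[of "j (\<theta> K')"] E[of "j (\<theta> (Suc K'))"] S[of "Suc K'"] Suc.prems E0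
        by (intro mult_mono) auto
      also have "\<dots> \<le> (2 * E) * S * real (m0 (\<theta> (Suc K')) - m0 (\<theta> K'))"
        using False mono E0 S0 mult_left_mono[of 1 "real (m0 (\<theta> (Suc K')) - m0 (\<theta> K'))" "2 * E * S"] by simp
      finally show ?thesis by (simp add: mult_ac)
    qed
    then have "\<bar>?s (Suc K') - increment_excess (j (\<theta> (Suc K'))) * b (\<theta> (Suc K'))\<bar> \<le>
       E * S * (2 * real (m0 (\<theta> K'))) + E * S * (2 * real (m0 (\<theta> (Suc K')) - m0 (\<theta> K')))"
      unfolding eq using IH by linarith
    also have "\<dots> = E * S * (2 * real (m0 (\<theta> (Suc K'))))" using mono by (simp add: of_nat_diff algebra_simps)
    finally show ?case .
  qed
  from this[of K] have "\<bar>(\<Sum>k<K. increment_excess (j (\<theta> k)) * (b (\<theta> (Suc k)) - b (\<theta> k))) - increment_excess (j (\<theta> K)) * b (\<theta> K)\<bar>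
     \<le> E * S * (2 * real (m0 (\<theta> K)))" by simp
  moreover have "\<bar>increment_excess (j (\<theta> K)) * b (\<theta> K)\<bar> \<le> E * S"
    unfolding abs_mult using E S[of K] E0 by (intro mult_mono) auto
  ultimately show ?thesis unfolding E_def[symmetric] by (simp add: algebra_simps)
qed

lemma c_Suc: "c (Suc k) = c k + (Lh k + Hh k)"
  by (simp add: fluid_epoch_def)

lemma c_0: "c 0 = 0"
  by (simp add: fluid_epoch_def)

lemma Lh_nonneg: "0 \<le> Lh k" and Hh_nonneg: "0 \<le> Hh k"
  using LH_nonneg[of k] rate_pos[of "j (\<theta> k)"] l by (auto simp: fluid_Lhat_def fluid_Hhat_def)

lemma c_mono: "k \<le> k' \<Longrightarrow> c k \<le> c k'"
  by (rule lift_Suc_mono_le[of c]) (auto simp: c_Suc Lh_nonneg Hh_nonneg)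

text \<open>Of the 5 S, one is the telescoped value of \<open>b\<close> at the last epoch, and four
  come from the unfinished fall, which \<open>total_fall\<close> contains but the epoch does not: at
  most 2 S, with the factor 2 / sqrt l.\<close>

lemma c_approx:
  assumes l1: "1 \<le> l" and t: "0 \<le> t" and S: "\<And>u. u \<in> {0..t} \<Longrightarrow> \<bar>b u\<bar> \<le> S"
  shows "\<bar>c (m t) - 2 / sqrt l * total_fall b m t\<bar> \<le>
    2 * A\<^sup>2 / l * total_fall b m t + (7 * A^4 * t + 5 * S) / sqrt l + 2 * A\<^sup>2 / l * S * (1 + 2 * real (m0 t))"
proof -
  define K where "K = m t"
  define F where "F = (\<Sum>k<K. f k)"
  define q where "q = sqrt l"
  have q: "1 \<le> q" using l1 by (simp add: q_def)
  define E where "E = 2 * A\<^sup>2 / l"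
  have E0: "0 \<le> E" using l by (simp add: E_def)
  have S0: "0 \<le> S" using S[of 0] t by auto
  have tK: "\<theta> K \<le> t" using Q.current(1)[OF t] by (simp add: K_def)
  have tk: "\<theta> k \<in> {0..t}" if "k \<le> K" for k
    using Q.ep_mono_all[OF that] tK Q.ep_nonneg[of k] by auto
  have bK: "\<bar>b (\<theta> k)\<bar> \<le> S" if "k \<le> K" for k using S tk[OF that] by blast
  have cK: "c K = (\<Sum>k<K. Lh k + Hh k)" by (simp add: fluid_epoch_def)
  have cF: "c K - 2 / q * F - (\<Sum>k<K. (1 / q + increment_excess (j (\<theta> k))) * (b (\<theta> (Suc k)) - b (\<theta> k)))
     = (\<Sum>k<K. Lh k + Hh k - 2 / q * f k - (1 / q + increment_excess (j (\<theta> k))) * (b (\<theta> (Suc k)) - b (\<theta> k)))"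
    unfolding cK F_def sum_distrib_left sum_subtractf[symmetric] by (rule refl)
  have "\<bar>c K - 2 / q * F - (\<Sum>k<K. (1 / q + increment_excess (j (\<theta> k))) * (b (\<theta> (Suc k)) - b (\<theta> k)))\<bar> \<le> (\<Sum>k<K. E * f k + 7 * A^4 / q * gap k)"
    unfolding cF unfolding E_def q_def by (intro order_trans[OF sum_abs] sum_mono c_step_approx[OF l1])
  also have "\<dots> = E * F + 7 * A^4 / q * (\<Sum>k<K. gap k)" by (simp add: F_def sum.distrib sum_distrib_left)
  also have "(\<Sum>k<K. gap k) = \<theta> K" by (simp add: sum_lessThan_telescope Q.ep_0)
  also have "7 * A^4 / q * \<theta> K \<le> 7 * A^4 / q * t" using tK q A(1) by (intro mult_left_mono) auto
  finally have 1: "\<bar>c K - 2 / q * F - (\<Sum>k<K. (1 / q + increment_excess (j (\<theta> k))) * (b (\<theta> (Suc k)) - b (\<theta> k)))\<bar> \<le> E * F + 7 * A^4 / q * t"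
    by simp
  have 2: "(\<Sum>k<K. (1 / q + increment_excess (j (\<theta> k))) * (b (\<theta> (Suc k)) - b (\<theta> k))) =
    1 / q * b (\<theta> K) + (\<Sum>k<K. increment_excess (j (\<theta> k)) * (b (\<theta> (Suc k)) - b (\<theta> k)))"
  proof -
    have "(\<Sum>k<K. b (\<theta> (Suc k)) - b (\<theta> k)) = b (\<theta> K)"
      using sum_lessThan_telescope[of "\<lambda>k. b (\<theta> k)" K] by (simp add: Q.ep_0 b_0)
    then show ?thesis by (simp add: distrib_right sum.distrib sum_distrib_left[symmetric] sum_divide_distrib[symmetric])
  qed
  have 3: "\<bar>1 / q * b (\<theta> K)\<bar> \<le> S / q" using bK[of K] q by (simp add: abs_mult divide_right_mono)
  have 4: "\<bar>\<Sum>k<K. increment_excess (j (\<theta> k)) * (b (\<theta> (Suc k)) - b (\<theta> k))\<bar> \<le> E * S * (1 + 2 * real (m0 t))"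
  proof -
    have "m0 (\<theta> K) \<le> m0 t" by (rule P.m_mono[OF Q.ep_nonneg tK])
    then have "E * S * (1 + 2 * real (m0 (\<theta> K))) \<le> E * S * (1 + 2 * real (m0 t))" using E0 S0 by (intro mult_left_mono) auto
    from order_trans[OF _ this] show ?thesis using increment_excess_sum[OF l1, of K S] bK unfolding E_def by blast
  qed
  have D: "total_fall b m t = F + fall b (\<theta> K) t" by (simp add: total_fall_def F_def K_def)
  have pf: "0 \<le> fall b (\<theta> K) t" "fall b (\<theta> K) t \<le> 2 * S"
  proof -
    have "\<bar>b u - b (\<theta> K)\<bar> \<le> 2 * S" if "u \<in> {\<theta> K..t}" for u
      using S[of u] bK[of K] that Q.ep_nonneg[of K] by auto
    from fall_bounds[OF cont_b_gap tK, of "2 * S"] this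
    show "0 \<le> fall b (\<theta> K) t" "fall b (\<theta> K) t \<le> 2 * S" by blast+
  qed
  have 5: "\<bar>2 / q * F - 2 / q * total_fall b m t\<bar> \<le> 4 * S / q"
  proof -
    have "\<bar>2 / q * F - 2 / q * total_fall b m t\<bar> = 2 / q * fall b (\<theta> K) t"
      using pf q unfolding D by (simp add: distrib_left)
    also have "\<dots> \<le> 2 / q * (2 * S)" using pf q by (intro mult_left_mono) auto
    finally show ?thesis by simp
  qed
  have 6: "E * F \<le> E * total_fall b m t" unfolding D using pf E0 by (intro mult_left_mono) auto
  have 7: "(7 * A^4 * t + 5 * S) / q = 7 * A^4 / q * t + S / q + 4 * S / q" using q by (simp add: field_simps)
  have aux: "\<bar>u - f' - (v + w)\<bar> \<le> g + h \<Longrightarrow> \<bar>v\<bar> \<le> V \<Longrightarrow> \<bar>w\<bar> \<le> W \<Longrightarrow> \<bar>f' - d\<bar> \<le> V' \<Longrightarrow> g \<le> g' \<Longrightarrow>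
     T = h + V + V' \<Longrightarrow> \<bar>u - d\<bar> \<le> g' + T + W" for u f' v w g h V W d V' g' T :: real by linarith
  show ?thesis unfolding E_def[symmetric] q_def[symmetric] K_def[symmetric]
    by (rule aux[OF 1[unfolded 2] 3 4 5 6 7])
qed

end

section \<open>The fluid level along one path\<close>

lemma has_integral_piece:
  fixes f :: "real \<Rightarrow> real"
  assumes "a \<le> b" "\<And>u. a \<le> u \<Longrightarrow> u < b \<Longrightarrow> f u = v"
  shows "(f has_integral v * (b - a)) {a..b}"
proof (rule has_integral_spike_finite[of "{b}"])
  show "((\<lambda>_. v) has_integral v * (b - a)) {a..b}"
    using has_integral_const_real[of v a b] assms(1) by (simp add: mult.commute)
qed (use assms in auto)

context fluid_path
begin

lemma phase_eq:
  assumes "c k \<le> t" "t < c (Suc k)"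
  shows "phase t = (if t < c k + Lh k then Minus else Plus, j (\<theta> k))"
proof -
  have "(THE k. c k \<le> t \<and> t < c (Suc k)) = k"
  proof (rule the_equality)
    fix k' assume k': "c k' \<le> t \<and> t < c (Suc k')"
    have "\<not> Suc k' \<le> k"
    proof
      assume "Suc k' \<le> k"
      from c_mono[OF this] show False using k' assms by linarith
    qed
    moreover have "\<not> Suc k \<le> k'"
    proof
      assume "Suc k \<le> k'"
      from c_mono[OF this] show False using k' assms by linarith
    qed
    ultimately show "k' = k" by linarith
  qed (use assms in simp)
  then show ?thesis by (simp add: fluid_phase_def Let_def)
qed

text \<open>The fluid rates undo the scaling of the durations: speed times duration is the true
  fall, and likewise the true rise in \<open>Hh_scale\<close>.\<close>

lemma Lh_scale: "l / om (j (\<theta> k)) * Lh k = L k"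
  using rate_pos(1)[of "j (\<theta> k)"] l by (simp add: fluid_Lhat_def)

lemma Hh_scale: "l / et (j (\<theta> k)) * Hh k = H k"
  using rate_pos(2)[of "j (\<theta> k)"] l by (simp add: fluid_Hhat_def)

abbreviation "speed t \<equiv> fluid_rate \<mu> \<sigma> l (phase t)"

text \<open>The fluid descends by \<open>L k\<close> and then climbs by \<open>H k\<close>. A
  partial integral stays within the sum of the two, and the full one is the increment of the level
  over the gap.\<close>

lemma speed_piece:
  assumes "c k \<le> s" "s \<le> c (Suc k)"
  shows "\<exists>v. (speed has_integral v) {c k..s} \<and> \<bar>v\<bar> \<le> L k + H k \<and> (s = c (Suc k) \<longrightarrow> v = H k - L k)"
proof -
  define w where "w = c k + Lh k"
  have w: "c k \<le> w" "w \<le> c (Suc k)" using Lh_nonneg[of k] Hh_nonneg[of k] by (auto simp: w_def c_Suc)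
  have minus: "speed u = - (l / om (j (\<theta> k)))" if "c k \<le> u" "u < w" for u
    using phase_eq[of k u] that w by (simp add: fluid_rate_def w_def)
  have plus: "speed u = l / et (j (\<theta> k))" if "w \<le> u" "u < c (Suc k)" for u
    using phase_eq[of k u] that w by (simp add: fluid_rate_def w_def)
  have om0: "0 \<le> l / om (j (\<theta> k))" and et0: "0 \<le> l / et (j (\<theta> k))" using rate_pos[of "j (\<theta> k)"] l by auto
  show ?thesis
  proof (cases "s \<le> w")
    case True
    have 1: "(speed has_integral - (l / om (j (\<theta> k))) * (s - c k)) {c k..s}"
      by (rule has_integral_piece[OF assms(1)]) (use minus True in auto)
    have 2: "0 \<le> l / om (j (\<theta> k)) * (s - c k)" using om0 assms by (intro mult_nonneg_nonneg) auto
    have "l / om (j (\<theta> k)) * (s - c k) \<le> l / om (j (\<theta> k)) * Lh k"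
      using om0 True by (intro mult_left_mono) (auto simp: w_def)
    then have 3: "l / om (j (\<theta> k)) * (s - c k) \<le> L k" by (simp only: Lh_scale)
    \<comment> \<open>The end of the piece is reached during the descent only if the ascent has
      duration 0; then \<open>H k\<close> vanishes too.\<close>
    have 4: "- (l / om (j (\<theta> k))) * (s - c k) = H k - L k" if "s = c (Suc k)"
    proof -
      have "Hh k = 0" "s - c k = Lh k" using that True w by (auto simp: w_def c_Suc)
      then show ?thesis using Hh_scale[of k] Lh_scale[of k] by simp
    qed
    show ?thesis using 1 2 3 4 LH_nonneg[of k] by (intro exI[of _ "- (l / om (j (\<theta> k))) * (s - c k)"]) auto
  next
    case False
    have i1: "(speed has_integral - (l / om (j (\<theta> k))) * (w - c k)) {c k..w}"
      by (rule has_integral_piece[OF w(1)]) (use minus in auto)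
    have i2: "(speed has_integral (l / et (j (\<theta> k))) * (s - w)) {w..s}"
      by (rule has_integral_piece) (use plus False assms in auto)
    have "(speed has_integral - (l / om (j (\<theta> k))) * (w - c k) + (l / et (j (\<theta> k))) * (s - w)) {c k..s}"
      by (rule has_integral_combine[OF w(1) _ i1 i2]) (use False in simp)
    moreover have "- (l / om (j (\<theta> k))) * (w - c k) = - L k" using Lh_scale[of k] by (simp add: w_def)
    ultimately have 1: "(speed has_integral - L k + (l / et (j (\<theta> k))) * (s - w)) {c k..s}" by simp
    have 2: "0 \<le> l / et (j (\<theta> k)) * (s - w)" using et0 False by (intro mult_nonneg_nonneg) auto
    have "l / et (j (\<theta> k)) * (s - w) \<le> l / et (j (\<theta> k)) * Hh k"
      using et0 assms by (intro mult_left_mono) (auto simp: w_def c_Suc)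
    then have 3: "l / et (j (\<theta> k)) * (s - w) \<le> H k" by (simp only: Hh_scale)
    have 4: "l / et (j (\<theta> k)) * (s - w) = H k" if "s = c (Suc k)"
      using Hh_scale[of k] that by (simp add: w_def c_Suc)
    show ?thesis using 1 2 3 4 LH_nonneg[of k]
      by (intro exI[of _ "- L k + (l / et (j (\<theta> k))) * (s - w)"]) auto
  qed
qed

lemma speed_integral_epoch: "(speed has_integral r (\<theta> k)) {0..c k}"
proof (induction k)
  case 0 show ?case by (simp add: c_0 Q.ep_0 r_0 has_integral_refl)
next
  case (Suc k)
  obtain v where v: "(speed has_integral v) {c k..c (Suc k)}" "v = H k - L k"
    using speed_piece[OF c_mono[of k "Suc k"] order_refl] by auto
  have "(speed has_integral r (\<theta> k) + v) {0..c (Suc k)}"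
    using c_mono[of 0 k] c_mono[of k "Suc k"] by (intro has_integral_combine[OF _ _ Suc v(1)]) (auto simp: c_0)
  then show ?case using v(2) H_eq[of k] by simp
qed

lemma fluid_level_approx:
  assumes "c k \<le> s" "s \<le> c (Suc k)"
  shows "\<bar>fluid_level \<mu> \<sigma> l m r j s - r (\<theta> k)\<bar> \<le> L k + H k"
proof -
  obtain v where v: "(speed has_integral v) {c k..s}" "\<bar>v\<bar> \<le> L k + H k" using speed_piece[OF assms] by blast
  have "(speed has_integral r (\<theta> k) + v) {0..s}"
    using c_mono[of 0 k] assms by (intro has_integral_combine[OF _ _ speed_integral_epoch v(1)]) (auto simp: c_0)
  then have "fluid_level \<mu> \<sigma> l m r j s = r (\<theta> k) + v" unfolding fluid_level_def by (rule integral_unique)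
  then show ?thesis using v(2) by simp
qed

end

text \<open>The summand \<open>cf + 1\<close> is the error of the interpolated fall; the others are
  the three errors of \<open>c_approx\<close> for l = 2 n^2 and t <= 2, in units of ln n /
  n.\<close>

definition time_const :: "real \<Rightarrow> real \<Rightarrow> real \<Rightarrow> nat \<Rightarrow> real" where
  "time_const A cf cs k = (cf + 1) + (A\<^sup>2 * (cf + 3) + (14 * A^4 + 5 * cs) + A\<^sup>2 * cs * (1 + 4 * real k))"

section \<open>Deterministic error bounds for a path with all good properties\<close>

lemma log_bounds:
  assumes "3 \<le> n"
  shows "1 \<le> ln (real n)" "1 / real n \<le> ln (real n) / real n" "ln (real n) / real n \<le> 1"
    "ln (real n) / real n \<le> ln (real n) / sqrt (real n)"
proof -
  have n: "3 \<le> real n" using assms by simp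
  show l: "1 \<le> ln (real n)" using exp_le n by (subst ln_ge_iff) auto
  show "1 / real n \<le> ln (real n) / real n" using l n by (intro divide_right_mono) auto
  show "ln (real n) / real n \<le> 1" using ln_bound[of "real n"] n by simp
  have "sqrt (real n) \<le> sqrt ((real n)\<^sup>2)" using n by (intro real_sqrt_le_mono) (simp add: power2_eq_square)
  then show "ln (real n) / real n \<le> ln (real n) / sqrt (real n)" using l n by (intro divide_left_mono) auto
qed

lemma grid_below:
  assumes "1 \<le> n" "0 \<le> u" "u \<le> 2"
  obtains i where "i \<le> 2 * n" "real i / real n \<le> u" "u < real i / real n + 1 / real n"
proof -
  define i where "i = nat \<lfloor>real n * u\<rfloor>"
  have i0: "0 \<le> real n * u" using assms by simp
  then have i: "real i \<le> real n * u" "real n * u < real i + 1" unfolding i_def by linarith+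
  have "real n * u \<le> real n * 2" using assms by (intro mult_left_mono) auto
  then have "real i \<le> 2 * real n" using i by linarith
  then have "i \<le> 2 * n" by linarith
  moreover have "real i / real n \<le> u" "u < real i / real n + 1 / real n"
    using i assms by (auto simp: field_simps)
  ultimately show ?thesis using that by blast
qed

context fluid_path
begin

text \<open>A window of length ln n / n covers a grid cell, and 2 n cells reach time 2. The bound of
  order n is crude, but the coefficients in \<open>increment_excess_sum\<close> are of order n^-2,
  which still leaves ln n / n.\<close>

lemma count_bound:
  assumes n: "3 \<le> n" and cg: "count_good n 1 k m0" and t: "0 \<le> t" "t \<le> 2"
  shows "real (m0 t) \<le> 2 * real n * real k"
proof -
  have "i \<le> 2 * n \<Longrightarrow> m0 (real i / real n) \<le> i * k" for i
  proof (induction i)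
    case (Suc i)
    have "real (Suc i) / real n \<le> real i / real n + 1 * (ln (real n) / real n)"
      using log_bounds(2)[OF n] by (simp add: add_divide_distrib)
    then have "m0 (real (Suc i) / real n) \<le> m0 (real i / real n + 1 * (ln (real n) / real n))"
      by (intro P.m_mono) auto
    also have "\<dots> \<le> m0 (real i / real n) + k" using cg Suc.prems unfolding count_good_def by simp
    also have "\<dots> \<le> i * k + k" using Suc by simp
    finally show ?case by simp
  qed (simp add: P.m_0)
  from this[of "2 * n"] have "m0 2 \<le> 2 * n * k" using n by simp
  then have "m0 t \<le> 2 * n * k" using P.m_mono[OF t] by linarith
  then show ?thesis by (metis of_nat_le_iff of_nat_mult of_nat_numeral)
qed

text \<open>Monotonicity of the fall encloses its value between those at the neighbouring grid
  points, at the cost of one mesh width.\<close>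

lemma fall_interpolation:
  assumes n: "3 \<le> n" and fg: "fall_good n cf b m" and t: "0 \<le> t" "t \<le> 2" and cf: "0 \<le> cf"
  shows "\<bar>sqrt 2 / real n * total_fall b m t - t\<bar> \<le> (cf + 1) * (ln (real n) / real n)"
proof -
  interpret R: driving_path m b by unfold_locales (rule cont_b)
  define h where "h = ln (real n) / real n"
  have h: "1 / real n \<le> h" "0 \<le> cf * h" using log_bounds[OF n] cf by (auto simp: h_def)
  obtain i where i: "i \<le> 2 * n" "real i / real n \<le> t" "t < real i / real n + 1 / real n"
    using grid_below[of n t] n t by auto
  have fg': "\<bar>sqrt 2 / real n * total_fall b m (real i / real n) - real i / real n\<bar> \<le> cf * h" if "i \<le> 2 * n" for i
  proof (cases "i = 0")
    case True then show ?thesis using h R.D_0 by simp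
  next
    case False then show ?thesis using fg that unfolding fall_good_def h_def by auto
  qed
  have lower: "sqrt 2 / real n * total_fall b m (real i / real n) \<le> sqrt 2 / real n * total_fall b m t"
    using i by (intro mult_left_mono R.D_mono) auto
  have "sqrt 2 / real n * total_fall b m t \<le> t + 1 / real n + cf * h"
  \<comment> \<open>The last grid point has no successor, but there \<open>t\<close> is the grid
    point itself.\<close>
  proof (cases "i = 2 * n")
    case True
    then have "real i / real n = t" using i t n by auto
    then have "\<bar>sqrt 2 / real n * total_fall b m t - t\<bar> \<le> cf * h" using fg'[OF i(1)] by metis
    moreover have "0 \<le> 1 / real n" by simp
    ultimately show ?thesis by linarith
  next
    case False
    have "sqrt 2 / real n * total_fall b m t \<le> sqrt 2 / real n * total_fall b m (real (Suc i) / real n)"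
      using i t by (intro mult_left_mono R.D_mono) (auto simp: add_divide_distrib)
    moreover have "\<bar>sqrt 2 / real n * total_fall b m (real (Suc i) / real n) - real (Suc i) / real n\<bar> \<le> cf * h"
      using False i by (intro fg') simp
    moreover have "real (Suc i) / real n \<le> t + 1 / real n" using i by (simp add: add_divide_distrib)
    ultimately show ?thesis by linarith
  qed
  moreover have "t - 1 / real n - cf * h \<le> sqrt 2 / real n * total_fall b m t"
    using lower fg'[OF i(1)] i(3) by linarith
  moreover have "(cf + 1) * h = cf * h + h" by (simp add: distrib_right)
  ultimately show ?thesis using h(1) unfolding h_def[symmetric] by linarith
qed

lemma time_change:
  assumes n: "3 \<le> n" and ln: "l = 2 * (real n)\<^sup>2"
    and fg: "fall_good n cf b m" and sg: "sup_good n cs b" and cg: "count_good n 1 k m0"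
    and cf: "0 \<le> cf" and cs: "0 \<le> cs" and t: "0 \<le> t" "t \<le> 2"
  shows "\<bar>c (m t) - t\<bar> \<le> time_const A cf cs k * (ln (real n) / real n)"
proof -
  define h where "h = ln (real n) / real n"
  define D where "D = total_fall b m t"
  define N where "N = real n"
  have N: "3 \<le> N" using n by (simp add: N_def)
  have h: "1 / N \<le> h" "h \<le> 1" "1 \<le> ln N" "ln N = h * N" using log_bounds[OF n] N by (auto simp: h_def N_def)
  have h0: "0 \<le> h" using h(1) N by (smt (verit) divide_nonneg_nonneg)
  have q: "sqrt l = sqrt 2 * N" by (simp add: ln real_sqrt_mult N_def)
  have q2: "2 / sqrt l = sqrt 2 / N" using N unfolding q by (simp add: field_simps)
  have fi: "\<bar>sqrt 2 / N * D - t\<bar> \<le> (cf + 1) * h"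
    using fall_interpolation[OF n fg t cf] by (simp add: N_def h_def D_def)
  have s1: "1 \<le> sqrt 2" by simp
  have D0: "0 \<le> D"
  proof -
    interpret R: driving_path m b by unfold_locales (rule cont_b)
    show ?thesis using R.D_mono[of 0 t] R.D_0(1) t by (simp add: D_def)
  qed
  have "(cf + 1) * h \<le> (cf + 1) * 1" using h cf by (intro mult_left_mono) auto
  moreover have "sqrt 2 / N * D - t \<le> (cf + 1) * h" by (rule order_trans[OF abs_ge_self fi])
  ultimately have "sqrt 2 / N * D - t \<le> (cf + 1) * 1" by (rule order_trans[rotated])
  then have "sqrt 2 / N * D \<le> cf + 3" using t(2) by simp
  moreover have "1 / N * D \<le> sqrt 2 / N * D" using D0 N s1 by (intro mult_right_mono divide_right_mono) auto
  ultimately have D1: "D / N \<le> cf + 3" by simp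
  have S: "\<bar>b u\<bar> \<le> cs * ln N" if "u \<in> {0..t}" for u
    using sg that t unfolding sup_good_def N_def by auto
  have main: "\<bar>c (m t) - 2 / sqrt l * D\<bar> \<le> 2 * A\<^sup>2 / l * D + (7 * A^4 * t + 5 * (cs * ln N)) / sqrt l
     + 2 * A\<^sup>2 / l * (cs * ln N) * (1 + 2 * real (m0 t))"
    unfolding D_def
  proof (rule c_approx[OF _ t(1) S])
    have "1 \<le> N\<^sup>2" using N by (intro one_le_power) simp
    then show "1 \<le> l" unfolding ln N_def[symmetric] by linarith
  qed
  have t1: "2 * A\<^sup>2 / l * D \<le> A\<^sup>2 * (cf + 3) * h"
  proof -
    have "2 * A\<^sup>2 / l * D = A\<^sup>2 * (D / N) * (1 / N)" using N by (simp add: ln N_def power2_eq_square)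
    also have "\<dots> \<le> A\<^sup>2 * (cf + 3) * h" using D0 D1 h h0 N cf by (intro mult_mono) auto
    finally show ?thesis .
  qed
  have t2: "(7 * A^4 * t + 5 * (cs * ln N)) / sqrt l \<le> (14 * A^4 + 5 * cs) * h"
  proof -
    have nn: "0 \<le> 7 * A^4 * t + 5 * (cs * ln N)" using t cs h by simp
    have "(7 * A^4 * t + 5 * (cs * ln N)) / sqrt l \<le> (7 * A^4 * t + 5 * (cs * ln N)) / N"
      unfolding q using nn N s1 by (intro divide_left_mono) auto
    also have "\<dots> \<le> (7 * A^4 * 2 + 5 * (cs * ln N)) / N"
      using t N by (intro divide_right_mono add_mono mult_left_mono order_refl) auto
    also have "\<dots> = 14 * A^4 * (1 / N) + 5 * cs * h" using N h(4) by (simp add: field_simps)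
    also have "\<dots> \<le> 14 * A^4 * h + 5 * cs * h" using h cs by (intro add_mono mult_left_mono) auto
    finally show ?thesis by (simp add: algebra_simps)
  qed
  have t3: "2 * A\<^sup>2 / l * (cs * ln N) * (1 + 2 * real (m0 t)) \<le> A\<^sup>2 * cs * (1 + 4 * real k) * h"
  proof -
    have "1 + 2 * real (m0 t) \<le> (1 + 4 * real k) * N"
      using count_bound[OF n cg t] N by (simp add: N_def algebra_simps)
    then have "A\<^sup>2 / N * cs * h * (1 + 2 * real (m0 t)) \<le> A\<^sup>2 / N * cs * h * ((1 + 4 * real k) * N)"
      using cs h0 N by (intro mult_left_mono) auto
    also have "\<dots> = A\<^sup>2 * cs * (1 + 4 * real k) * h" using N by simp
    also have "A\<^sup>2 / N * cs * h * (1 + 2 * real (m0 t)) = 2 * A\<^sup>2 / l * (cs * ln N) * (1 + 2 * real (m0 t))"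
      using N unfolding h(4) ln N_def[symmetric] by (simp add: power2_eq_square)
    finally show ?thesis .
  qed
  have "time_const A cf cs k * h = (cf + 1) * h + (A\<^sup>2 * (cf + 3) * h + (14 * A^4 + 5 * cs) * h + A\<^sup>2 * cs * (1 + 4 * real k) * h)"
    unfolding time_const_def by (simp only: distrib_right)
  moreover have "\<bar>c (m t) - t\<bar> \<le> \<bar>c (m t) - P\<bar> + \<bar>P - t\<bar>" for P by linarith
  note this[of "sqrt 2 / N * D"]
  ultimately show ?thesis using main fi t1 t2 t3 unfolding q2 h_def[symmetric] by simp
qed

text \<open>The clock is monotone, so its error bound on [0, 2] can be inverted: were \<theta> (Suc
  k) beyond s + E, some time t between them would have c (m t) <= c k <= s, whereas c (m t) >= t - E
  > s.\<close>

lemma epoch_index: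
  assumes E: "\<And>t. 0 \<le> t \<Longrightarrow> t \<le> 2 \<Longrightarrow> \<bar>c (m t) - t\<bar> \<le> E" "E \<le> 1/4"
    and n: "1 \<le> n" and gg: "gap_good n m" and s: "0 \<le> s" "s \<le> 5/4"
  obtains k where "c k \<le> s" "s < c (Suc k)" "\<bar>\<theta> (Suc k) - s\<bar> \<le> E" "gap k \<le> 2 / real n"
proof -
  have E0: "0 \<le> E" using E(1)[of 0] by simp
  \<comment> \<open>The clock at 7/4 shows at least 7/4 - 1/4, which exceeds 5/4; hence a least
    index beyond \<open>s\<close> exists.\<close>
  have ex: "s < c (m (7/4))" using E(1)[of "7/4"] E(2) s by (simp add: abs_le_iff)
  define K where "K = (LEAST K. s < c K)"
  have K: "s < c K" unfolding K_def using ex by (rule LeastI)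
  have "K \<noteq> 0" using K s c_0 by (metis not_less)
  then obtain k where k: "K = Suc k" using not0_implies_Suc by blast
  have ck: "c k \<le> s" using not_less_Least[of k "\<lambda>K. s < c K"] k K_def by simp
  have ck1: "s < c (Suc k)" using K k by simp
  have up: "\<theta> (Suc k) \<le> s + E"
  proof (rule ccontr)
    assume "\<not> \<theta> (Suc k) \<le> s + E"
    then have "s + E < min (\<theta> (Suc k)) 2" using s E by simp
    then obtain t where t: "s + E < t" "t < min (\<theta> (Suc k)) 2" using dense by blast
    have t0: "0 \<le> t" using t s E0 by linarith
    have "\<not> Suc k \<le> m t"
    proof
      assume "Suc k \<le> m t"
      from iffD2[OF Q.ep_le_iff[OF t0] this] t show False by simp
    qed
    then have "c (m t) \<le> c k" by (intro c_mono) simp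
    then show False using E(1)[OF t0] t ck by (simp add: abs_le_iff)
  qed
  have u2: "\<theta> (Suc k) \<le> 2" using up s E by linarith
  have "c (Suc k) \<le> c (m (\<theta> (Suc k)))" by (intro c_mono Q.m_ep_ge)
  then have lo: "s - E \<le> \<theta> (Suc k)" using E(1)[OF Q.ep_nonneg u2] ck1 by (simp add: abs_le_iff)
  have "gap k \<le> 2 / real n"
  proof (rule ccontr)
    assume g: "\<not> gap k \<le> 2 / real n"
    \<comment> \<open>A gap longer than two mesh widths contains a whole grid cell, starting at the
      first grid point after \<theta> k; \<open>m\<close> would be constant on it.\<close>
    define i where "i = nat \<lceil>real n * \<theta> k\<rceil>"
    have "0 \<le> real n * \<theta> k" using Q.ep_nonneg by simp
    then have "real n * \<theta> k \<le> real i" "real i < real n * \<theta> k + 1" unfolding i_def by linarith+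
    then have i: "\<theta> k \<le> real i / real n" "real i / real n < \<theta> k + 1 / real n" using n by (auto simp: field_simps)
    have Si: "real (Suc i) / real n = real i / real n + 1 / real n" by (simp add: add_divide_distrib)
    have "2 / real n = 1 / real n + 1 / real n" by simp
    then have i2: "real (Suc i) / real n < \<theta> (Suc k)" using i g Si by linarith
    then have "real (Suc i) / real n < 2" using u2 by linarith
    then have "real (Suc i) < 2 * real n" using n by (simp add: field_simps)
    then have "i < 2 * n" by linarith
    then have "m (real i / real n) < m (real (Suc i) / real n)" using gg unfolding gap_good_def by blast
    moreover have "m (real i / real n) = k" "m (real (Suc i) / real n) = k"
    proof -
      have p: "0 < 1 / real n" using n by simp
      show "m (real i / real n) = k" by (rule Q.m_const[OF i(1)]) (use i2 Si p in linarith)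
      show "m (real (Suc i) / real n) = k" by (rule Q.m_const[OF _ i2]) (use i(1) Si p in linarith)
    qed
    ultimately show False by simp
  qed
  then show ?thesis using that[OF ck ck1] up lo by (simp add: abs_le_iff)
qed

text \<open>The good events control \<open>b\<close> and \<open>m0\<close> in windows that begin at
  grid points. Moving \<open>u\<close> down to a grid point costs at most 1 / n <= ln n / n, hence
  \<kappa> - 1 in the hypothesis.\<close>

lemma r_oscillation:
  assumes n: "3 \<le> n" and k: "1 \<le> \<kappa>" and og: "osc_good n \<kappa> cB b" and cg: "count_good n \<kappa> k m0"
    and cB: "0 \<le> cB" and u: "0 \<le> u" "u \<le> v" "v \<le> 2" "v - u \<le> (\<kappa> - 1) * (ln (real n) / real n)"
  shows "\<bar>r v - r u\<bar> \<le> A * (\<kappa> + 2 * (real k + 1) * cB) * (ln (real n) / sqrt (real n))"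
proof -
  define h where "h = ln (real n) / real n"
  define e where "e = ln (real n) / sqrt (real n)"
  have h: "1 / real n \<le> h" "0 \<le> h" "h \<le> e" using log_bounds[OF n] by (auto simp: h_def e_def)
  obtain i where i: "i \<le> 2 * n" "real i / real n \<le> u" "u < real i / real n + 1 / real n"
    using grid_below[of n u] n u by auto
  have kh: "(\<kappa> - 1) * h = \<kappa> * h - h" by (simp add: left_diff_distrib)
  have vi: "v \<le> real i / real n + \<kappa> * h" using u(4) i(3) h(1) kh unfolding h_def[symmetric] by linarith
  have ob: "\<bar>b w - b (real i / real n)\<bar> \<le> cB * e" if "real i / real n \<le> w" "w \<le> v" for w
  proof -
    have "w - real i / real n \<in> {0..\<kappa> * h}" using that vi by simp
    then have "\<bar>b (real i / real n + (w - real i / real n)) - b (real i / real n)\<bar> \<le> cB * e"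
      using og i(1) unfolding osc_good_def h_def e_def by (meson atLeastAtMost_iff zero_le)
    then show ?thesis by simp
  qed
  have "\<bar>r v - r u\<bar> \<le> A * (v - u) + A * (real (m0 v - m0 u) + 1) * (2 * cB * e)"
  proof (rule r_modulus[OF u(1,2)])
    fix y z assume "y \<in> {u..v}" "z \<in> {u..v}"
    then have "\<bar>b y - b (real i / real n)\<bar> \<le> cB * e" "\<bar>b z - b (real i / real n)\<bar> \<le> cB * e"
      using ob[of y] ob[of z] i by auto
    then show "\<bar>b y - b z\<bar> \<le> 2 * cB * e" by linarith
  qed
  also have "A * (v - u) \<le> A * (\<kappa> * e)"
  proof (intro mult_left_mono)
    have "v - u \<le> \<kappa> * h" using u(4) kh h unfolding h_def[symmetric] by linarith
    also have "\<dots> \<le> \<kappa> * e" using h k by (intro mult_left_mono) auto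
    finally show "v - u \<le> \<kappa> * e" .
  qed (use A(1) in simp)
  also have "A * (real (m0 v - m0 u) + 1) * (2 * cB * e) \<le> A * (real k + 1) * (2 * cB * e)"
  proof -
    have "m0 v \<le> m0 (real i / real n + \<kappa> * h)" using u vi by (intro P.m_mono) auto
    also have "\<dots> \<le> m0 (real i / real n) + k" using cg i unfolding count_good_def h_def by auto
    also have "m0 (real i / real n) \<le> m0 u" using i by (intro P.m_mono) auto
    finally have "m0 v - m0 u \<le> k" by simp
    then show ?thesis using A(1) cB h by (intro mult_right_mono mult_left_mono) auto
  qed
  finally show ?thesis unfolding e_def[symmetric] by (simp add: algebra_simps)
qed

text \<open>The factor 4 counts oscillations of the level: one between \<open>s\<close> and the
  epoch, one for \<open>L\<close>, and two for \<open>H\<close>, which is \<open>L\<close> plus an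
  increment.\<close>

theorem level_error:
  assumes n: "3 \<le> n" and ln: "l = 2 * (real n)\<^sup>2"
    and fg: "fall_good n cf b m" and sg: "sup_good n cs b" and cg: "count_good n 1 k m0" and gg: "gap_good n m"
    and pos: "0 \<le> cf" "0 \<le> cs" "0 \<le> cB"
    and kappa: "\<kappa> = time_const A cf cs k + 3"
    and og: "osc_good n \<kappa> cB b" and cg': "count_good n \<kappa> k' m0"
    and small: "time_const A cf cs k * (ln (real n) / real n) \<le> 1/4"
    and s: "0 \<le> s" "s \<le> 5/4"
  shows "\<bar>r s - fluid_level \<mu> \<sigma> l m r j s\<bar> \<le> 4 * (A * (\<kappa> + 2 * (real k' + 1) * cB)) * (ln (real n) / sqrt (real n))"
    "\<exists>u\<ge>0. \<bar>u - s\<bar> \<le> \<kappa> * (ln (real n) / real n) \<and> snd (phase s) = j u"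
proof -
  define h where "h = ln (real n) / real n"
  define E where "E = time_const A cf cs k * h"
  define e where "e = A * (\<kappa> + 2 * (real k' + 1) * cB) * (ln (real n) / sqrt (real n))"
  have h: "1 / real n \<le> h" "0 \<le> h" using log_bounds[OF n] by (auto simp: h_def)
  have tc: "\<bar>c (m t) - t\<bar> \<le> E" if "0 \<le> t" "t \<le> 2" for t
    unfolding E_def h_def by (rule time_change[OF n ln fg sg cg pos(1,2) that])
  have E0: "0 \<le> E" "E \<le> 1/4" using tc[of 0] small by (auto simp: E_def h_def)
  have tc0: "0 \<le> time_const A cf cs k" using pos A(1) unfolding time_const_def by simp
  \<comment> \<open>The summand 3 in \<kappa> is used up by the gap, of length at most 2 h, and by
    the shift to the grid in \<open>r_oscillation\<close>.\<close>
  have kE: "(\<kappa> - 1) * h = E + 2 * h" by (simp add: kappa E_def distrib_right)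
  obtain i where i: "c i \<le> s" "s < c (Suc i)" "\<bar>\<theta> (Suc i) - s\<bar> \<le> E" "gap i \<le> 2 / real n"
    using epoch_index[OF tc E0(2) _ gg s] n by auto
  have g2: "gap i \<le> 2 * h" using i(4) h(1) by simp
  have gp: "\<theta> i \<le> \<theta> (Suc i)" using gap_nonneg[of i] by simp
  have u2: "\<theta> (Suc i) \<le> 2" using i(3) s E0 by linarith
  have osc: "\<bar>r v - r u\<bar> \<le> e" if "0 \<le> u" "u \<le> v" "v \<le> 2" "v - u \<le> E + 2 * h" for u v
    unfolding e_def using tc0 that kE by (intro r_oscillation[OF n _ og cg' pos(3)]) (auto simp: kappa h_def)
  have osc1: "\<bar>r u - r (\<theta> i)\<bar> \<le> e" if "u \<in> {\<theta> i..\<theta> (Suc i)}" for u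
    using that g2 u2 E0 by (intro osc Q.ep_nonneg) auto
  have L: "L i \<le> e" unfolding L_fall by (rule fall_bounds(2)[OF cont_r_gap gp osc1])
  have H: "H i \<le> 2 * e" using L osc1[of "\<theta> (Suc i)"] gp unfolding H_eq by auto
  have near: "\<bar>\<theta> i - s\<bar> \<le> E + 2 * h" using i(3) g2 gp by (simp add: abs_le_iff)
  have rs: "\<bar>r s - r (\<theta> i)\<bar> \<le> e"
  proof (cases "\<theta> i \<le> s")
    case True then show ?thesis using near s by (intro osc Q.ep_nonneg) auto
  next
    case False
    then have "\<bar>r (\<theta> i) - r s\<bar> \<le> e" using near s u2 gp by (intro osc) auto
    then show ?thesis by (simp add: abs_minus_commute)
  qed
  have fl: "\<bar>fluid_level \<mu> \<sigma> l m r j s - r (\<theta> i)\<bar> \<le> L i + H i"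
    using i by (intro fluid_level_approx) auto
  show "\<bar>r s - fluid_level \<mu> \<sigma> l m r j s\<bar> \<le> 4 * (A * (\<kappa> + 2 * (real k' + 1) * cB)) * (ln (real n) / sqrt (real n))"
    using fl rs L H unfolding mult.assoc[of 4] e_def[symmetric] by linarith
  have "snd (phase s) = j (\<theta> i)" using phase_eq[OF i(1,2)] by simp
  moreover have "\<bar>\<theta> i - s\<bar> \<le> \<kappa> * h" using near kE h(2) by (simp add: left_diff_distrib)
  ultimately show "\<exists>u\<ge>0. \<bar>u - s\<bar> \<le> \<kappa> * (ln (real n) / real n) \<and> snd (phase s) = j u"
    unfolding h_def using Q.ep_nonneg by blast
qed

end

subsection \<open>Measurability\<close>

lemma floor_grid:
  fixes K u :: real
  assumes "0 < K" "0 \<le> u"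
  shows "real (nat \<lfloor>K * u\<rfloor>) / K \<le> u" "u < (real (nat \<lfloor>K * u\<rfloor>) + 1) / K"
proof -
  have "0 \<le> K * u" using assms by simp
  then have "real (nat \<lfloor>K * u\<rfloor>) \<le> K * u" "K * u < real (nat \<lfloor>K * u\<rfloor>) + 1" by linarith+
  then show "real (nat \<lfloor>K * u\<rfloor>) / K \<le> u" "u < (real (nat \<lfloor>K * u\<rfloor>) + 1) / K"
    using assms(1) by (simp_all add: pos_divide_le_eq pos_less_divide_eq mult.commute)
qed

text \<open>The random time is approximated by times on a grid that lie strictly above it and take
  countably many values; continuity from the right gives the limit.\<close>

lemma borel_measurable_random_time:
  fixes Z :: "real \<Rightarrow> 'w \<Rightarrow> real"
  assumes Z: "\<And>t. 0 \<le> t \<Longrightarrow> Z t \<in> borel_measurable S"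
    and rc: "\<And>t \<omega>. \<omega> \<in> space S \<Longrightarrow> 0 \<le> t \<Longrightarrow> continuous (at_right t) (\<lambda>u. Z u \<omega>)"
    and \<tau>: "\<tau> \<in> borel_measurable S" "\<And>\<omega>. \<omega> \<in> space S \<Longrightarrow> 0 \<le> \<tau> \<omega>"
  shows "(\<lambda>\<omega>. Z (\<tau> \<omega>) \<omega>) \<in> borel_measurable S"
proof (rule borel_measurable_LIMSEQ_metric)
  define g where "g n \<omega> = nat \<lfloor>real (Suc n) * \<tau> \<omega>\<rfloor>" for n \<omega>
  define \<tau>' where "\<tau>' n \<omega> = (real (g n \<omega>) + 1) / real (Suc n)" for n \<omega>
  have g: "g n \<in> measurable S (count_space UNIV)" for n
    unfolding g_def using \<tau>(1) by measurable
  show "(\<lambda>\<omega>. Z (\<tau>' n \<omega>) \<omega>) \<in> borel_measurable S" for n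
    unfolding \<tau>'_def by (rule measurable_compose_countable[OF _ g]) (intro Z, simp)
  fix \<omega> assume \<omega>: "\<omega> \<in> space S"
  have bnd: "\<tau> \<omega> < \<tau>' n \<omega>" "\<tau>' n \<omega> \<le> \<tau> \<omega> + 1 / real (Suc n)" for n
  proof -
    have "real (g n \<omega>) / real (Suc n) \<le> \<tau> \<omega>" "\<tau> \<omega> < (real (g n \<omega>) + 1) / real (Suc n)"
      unfolding g_def by (intro floor_grid \<tau>(2)[OF \<omega>]; simp)+
    then show "\<tau> \<omega> < \<tau>' n \<omega>" "\<tau>' n \<omega> \<le> \<tau> \<omega> + 1 / real (Suc n)"
      by (auto simp: \<tau>'_def add_divide_distrib simp del: of_nat_Suc)
  qed
  have "(\<lambda>n. \<tau>' n \<omega>) \<longlonglongrightarrow> \<tau> \<omega>"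
  proof (rule tendsto_sandwich[OF _ _ tendsto_const])
    show "(\<lambda>n. \<tau> \<omega> + 1 / real (Suc n)) \<longlonglongrightarrow> \<tau> \<omega>" by real_asymp
    show "\<forall>\<^sub>F n in sequentially. \<tau> \<omega> \<le> \<tau>' n \<omega>"
      by (intro always_eventually allI less_imp_le bnd)
    show "\<forall>\<^sub>F n in sequentially. \<tau>' n \<omega> \<le> \<tau> \<omega> + 1 / real (Suc n)"
      by (intro always_eventually allI bnd)
  qed
  then have "filterlim (\<lambda>n. \<tau>' n \<omega>) (at_right (\<tau> \<omega>)) sequentially"
    unfolding filterlim_at
  proof (intro conjI always_eventually allI)
    fix n show "\<tau>' n \<omega> \<in> {\<tau> \<omega><..}" "\<tau>' n \<omega> \<noteq> \<tau> \<omega>" using bnd(1)[of n] by auto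
  qed
  moreover have "((\<lambda>u. Z u \<omega>) \<longlongrightarrow> Z (\<tau> \<omega>) \<omega>) (at_right (\<tau> \<omega>))"
    using rc[OF \<omega> \<tau>(2)[OF \<omega>]] by (simp add: continuous_within)
  ultimately show "(\<lambda>n. Z (\<tau>' n \<omega>) \<omega>) \<longlonglongrightarrow> Z (\<tau> \<omega>) \<omega>" by (rule filterlim_compose[rotated])
qed

lemma le_from_grid:
  fixes g :: "real \<Rightarrow> real"
  assumes g: "continuous_on {0..1} g" and le: "\<And>n i. i \<le> Suc n \<Longrightarrow> g (real i / real (Suc n)) \<le> y"
    and u: "u \<in> {0..1}"
  shows "g u \<le> y"
proof -
  define q where "q n = real (nat \<lfloor>real (Suc n) * u\<rfloor>) / real (Suc n)" for n
  have b: "q n \<le> u" "u - 1 / real (Suc n) \<le> q n" "0 \<le> q n" "nat \<lfloor>real (Suc n) * u\<rfloor> \<le> Suc n" for n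
  proof -
    have fg: "real (nat \<lfloor>real (Suc n) * u\<rfloor>) / real (Suc n) \<le> u" "u < (real (nat \<lfloor>real (Suc n) * u\<rfloor>) + 1) / real (Suc n)"
      using u by (intro floor_grid; simp)+
    then show "q n \<le> u" "u - 1 / real (Suc n) \<le> q n" "0 \<le> q n"
      by (auto simp: q_def add_divide_distrib simp del: of_nat_Suc)
    have "real (nat \<lfloor>real (Suc n) * u\<rfloor>) / real (Suc n) \<le> 1"
      using u by (intro order_trans[OF fg(1)]) simp
    moreover have "0 < real (Suc n)" by simp
    ultimately have "real (nat \<lfloor>real (Suc n) * u\<rfloor>) \<le> 1 * real (Suc n)"
      by (simp only: pos_divide_le_eq)
    then have "real (nat \<lfloor>real (Suc n) * u\<rfloor>) \<le> real (Suc n)" by (simp only: mult_1)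
    then show "nat \<lfloor>real (Suc n) * u\<rfloor> \<le> Suc n" unfolding of_nat_le_iff .
  qed
  have "q \<longlonglongrightarrow> u"
  proof (rule tendsto_sandwich[OF _ _ _ tendsto_const])
    show "(\<lambda>n. u - 1 / real (Suc n)) \<longlonglongrightarrow> u" by real_asymp
    show "\<forall>\<^sub>F n in sequentially. u - 1 / real (Suc n) \<le> q n" by (intro always_eventually allI b)
    show "\<forall>\<^sub>F n in sequentially. q n \<le> u" by (intro always_eventually allI b)
  qed
  then have "(\<lambda>n. g (q n)) \<longlonglongrightarrow> g u"
    by (rule continuous_on_tendsto_compose[OF g]) (use u b order_trans in \<open>fastforce intro!: always_eventually\<close>)+
  then show ?thesis by (rule LIMSEQ_le_const2) (use le b(4) in \<open>auto simp: q_def\<close>)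
qed

text \<open>Here the paths are regular at every point of \<open>S\<close>, which is meant as a
  probability space with a null set removed. Leaving \<open>S\<close> general allows a second use,
  on the product with the time axis.\<close>

locale path_measurability =
  fixes S :: "'w measure" and B :: "real \<Rightarrow> 'w \<Rightarrow> real" and N0 m :: "real \<Rightarrow> 'w \<Rightarrow> nat"
    and X :: "nat \<Rightarrow> 'w \<Rightarrow> 's::finite" and \<mu> \<sigma> :: "'s \<Rightarrow> real" and A l :: real
  assumes B_meas: "0 \<le> t \<Longrightarrow> B t \<in> borel_measurable S"
    and N0_meas: "0 \<le> t \<Longrightarrow> N0 t \<in> measurable S (count_space UNIV)"
    and m_meas: "0 \<le> t \<Longrightarrow> m t \<in> measurable S (count_space UNIV)"
    and X_meas: "X k \<in> measurable S (count_space UNIV)"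
    and path: "\<omega> \<in> space S \<Longrightarrow> fluid_path (\<lambda>t. N0 t \<omega>) (\<lambda>t. B t \<omega>) \<mu> \<sigma> A (\<lambda>t. m t \<omega>) l"
begin

abbreviation "J t \<omega> \<equiv> mmbm_phase (\<lambda>t. N0 t \<omega>) (\<lambda>k. X k \<omega>) t"
abbreviation "R t \<omega> \<equiv> mmbm_level \<mu> \<sigma> (\<lambda>t. B t \<omega>) (\<lambda>t. N0 t \<omega>) (\<lambda>k. X k \<omega>) t"
abbreviation "\<tau>0 k \<omega> \<equiv> arrival_epoch (\<lambda>t. N0 t \<omega>) k"
abbreviation "\<theta> k \<omega> \<equiv> arrival_epoch (\<lambda>t. m t \<omega>) k"

lemma epoch_measurable:
  assumes M: "\<And>t. 0 \<le> t \<Longrightarrow> (M t :: 'w \<Rightarrow> nat) \<in> measurable S (count_space UNIV)"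
    and p: "\<And>\<omega>. \<omega> \<in> space S \<Longrightarrow> unbounded_counting (\<lambda>t. M t \<omega>)"
  shows "(\<lambda>\<omega>. arrival_epoch (\<lambda>t. M t \<omega>) k) \<in> borel_measurable S"
proof (rule borel_measurableI_le)
  fix y :: real
  show "{\<omega> \<in> space S. arrival_epoch (\<lambda>t. M t \<omega>) k \<le> y} \<in> sets S"
  proof (cases "0 \<le> y")
    case True
    have "{\<omega> \<in> space S. arrival_epoch (\<lambda>t. M t \<omega>) k \<le> y} = {\<omega> \<in> space S. k \<le> M y \<omega>}"
      using unbounded_counting.ep_le_iff[OF p True] by blast
    also have "\<dots> \<in> sets S" using M[OF True] by measurable
    finally show ?thesis .
  next
    case False
    have "\<not> arrival_epoch (\<lambda>t. M t \<omega>) k \<le> y" if "\<omega> \<in> space S" for \<omega>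
      using unbounded_counting.ep_nonneg[OF p[OF that], of k] False by linarith
    then have eq: "{\<omega> \<in> space S. arrival_epoch (\<lambda>t. M t \<omega>) k \<le> y} = {}" by blast
    show ?thesis unfolding eq by (rule sets.empty_sets)
  qed
qed

lemma N0_counting: "\<omega> \<in> space S \<Longrightarrow> unbounded_counting (\<lambda>t. N0 t \<omega>)"
  using path[of \<omega>] by (simp add: fluid_path_def modulated_path_def)

lemma m_counting: "\<omega> \<in> space S \<Longrightarrow> unbounded_counting (\<lambda>t. m t \<omega>)"
  using path[of \<omega>] by (simp add: fluid_path_def)

lemma modulated: "\<omega> \<in> space S \<Longrightarrow> modulated_path (\<lambda>t. N0 t \<omega>) (\<lambda>t. B t \<omega>) \<mu> \<sigma> A"
  using path[of \<omega>] by (simp add: fluid_path_def)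

lemma \<tau>0_meas [measurable]: "\<tau>0 k \<in> borel_measurable S"
  by (rule epoch_measurable[OF N0_meas N0_counting])

lemma \<theta>_meas [measurable]: "\<theta> k \<in> borel_measurable S"
  by (rule epoch_measurable[OF m_meas m_counting])

lemma \<tau>0_nonneg: "\<omega> \<in> space S \<Longrightarrow> 0 \<le> \<tau>0 k \<omega>"
  using unbounded_counting.ep_nonneg[OF N0_counting] .

lemma \<theta>_nonneg: "\<omega> \<in> space S \<Longrightarrow> 0 \<le> \<theta> k \<omega>"
  using unbounded_counting.ep_nonneg[OF m_counting] .

lemma continuous_at_right_of:
  assumes "continuous_on {0..} (f :: real \<Rightarrow> real)" "0 \<le> t"
  shows "continuous (at_right t) f"
proof -
  have "continuous (at t within {0..}) f" using assms by (simp add: continuous_on_eq_continuous_within)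
  then show ?thesis by (rule continuous_within_subset) (use assms in auto)
qed

lemma B_at: "\<tau> \<in> borel_measurable S \<Longrightarrow> (\<And>\<omega>. \<omega> \<in> space S \<Longrightarrow> 0 \<le> \<tau> \<omega>) \<Longrightarrow> (\<lambda>\<omega>. B (\<tau> \<omega>) \<omega>) \<in> borel_measurable S"
  by (rule borel_measurable_random_time[OF B_meas])
     (auto intro!: continuous_at_right_of modulated_path.cont_b[OF modulated])

lemma N0_at:
  assumes "\<tau> \<in> borel_measurable S" "\<And>\<omega>. \<omega> \<in> space S \<Longrightarrow> 0 \<le> \<tau> \<omega>"
  shows "(\<lambda>\<omega>. N0 (\<tau> \<omega>) \<omega>) \<in> measurable S (count_space UNIV)"
proof -
  have "(\<lambda>\<omega>. real (N0 (\<tau> \<omega>) \<omega>)) \<in> borel_measurable S"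
  proof (rule borel_measurable_random_time[of "\<lambda>t \<omega>. real (N0 t \<omega>)", OF _ _ assms])
    show "(\<lambda>\<omega>. real (N0 t \<omega>)) \<in> borel_measurable S" if "0 \<le> t" for t
      using N0_meas[OF that] by measurable
    fix t :: real and \<omega> assume \<omega>: "\<omega> \<in> space S" and t: "0 \<le> t"
    interpret unbounded_counting "\<lambda>t. N0 t \<omega>" by (rule N0_counting[OF \<omega>])
    obtain e where e: "e > 0" "\<And>s. t \<le> s \<Longrightarrow> s < t + e \<Longrightarrow> N0 s \<omega> = N0 t \<omega>" using m_right[OF t] by blast
    have "\<forall>\<^sub>F s in at_right t. real (N0 s \<omega>) = real (N0 t \<omega>)"
      unfolding eventually_at_right_field
    proof (intro exI[of _ "t + e"] conjI allI impI)
      show "t < t + e" using e(1) by simp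
      fix s assume "t < s" "s < t + e"
      then have "N0 s \<omega> = N0 t \<omega>" by (intro e(2)) simp_all
      then show "real (N0 s \<omega>) = real (N0 t \<omega>)" by simp
    qed
    then show "continuous (at_right t) (\<lambda>u. real (N0 u \<omega>))"
      unfolding continuous_within by (rule tendsto_eventually)
  qed
  then have "(\<lambda>\<omega>. nat \<lfloor>real (N0 (\<tau> \<omega>) \<omega>)\<rfloor>) \<in> measurable S (count_space UNIV)" by measurable
  then show ?thesis by simp
qed

lemma J_at:
  assumes "\<tau> \<in> borel_measurable S" "\<And>\<omega>. \<omega> \<in> space S \<Longrightarrow> 0 \<le> \<tau> \<omega>"
  shows "(\<lambda>\<omega>. J (\<tau> \<omega>) \<omega>) \<in> measurable S (count_space UNIV)"
  unfolding mmbm_phase_def by (rule measurable_compose_countable[OF X_meas N0_at[OF assms]])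

lemma function_of_J_at:
  fixes f :: "'s \<Rightarrow> real"
  assumes "\<tau> \<in> borel_measurable S" "\<And>\<omega>. \<omega> \<in> space S \<Longrightarrow> 0 \<le> \<tau> \<omega>"
  shows "(\<lambda>\<omega>. f (J (\<tau> \<omega>) \<omega>)) \<in> borel_measurable S"
proof -
  have "f \<in> measurable (count_space UNIV) borel" by simp
  from measurable_compose[OF J_at[OF assms] this] show ?thesis by simp
qed

text \<open>On this product the time coordinate is itself a random time. Measurability at random
  times thereby becomes joint measurability in time and outcome, which integration over time
  requires.\<close>

lemma product_measurability:
  "path_measurability ((borel :: real measure) \<Otimes>\<^sub>M S) (\<lambda>t z. B t (snd z)) (\<lambda>t z. N0 t (snd z)) (\<lambda>t z. m t (snd z)) (\<lambda>k z. X k (snd z)) \<mu> \<sigma> A l"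
proof (rule path_measurability.intro)
  show "(\<lambda>z. B t (snd z)) \<in> borel_measurable ((borel :: real measure) \<Otimes>\<^sub>M S)" if "0 \<le> t" for t
    by (rule measurable_compose[OF measurable_snd B_meas[OF that]])
  show "(\<lambda>z. N0 t (snd z)) \<in> measurable ((borel :: real measure) \<Otimes>\<^sub>M S) (count_space UNIV)" if "0 \<le> t" for t
    by (rule measurable_compose[OF measurable_snd N0_meas[OF that]])
  show "(\<lambda>z. m t (snd z)) \<in> measurable ((borel :: real measure) \<Otimes>\<^sub>M S) (count_space UNIV)" if "0 \<le> t" for t
    by (rule measurable_compose[OF measurable_snd m_meas[OF that]])
  show "(\<lambda>z. X k (snd z)) \<in> measurable ((borel :: real measure) \<Otimes>\<^sub>M S) (count_space UNIV)" for k
    by (rule measurable_compose[OF measurable_snd X_meas])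
  show "fluid_path (\<lambda>t. N0 t (snd z)) (\<lambda>t. B t (snd z)) \<mu> \<sigma> A (\<lambda>t. m t (snd z)) l"
    if "z \<in> space ((borel :: real measure) \<Otimes>\<^sub>M S)" for z :: "real \<times> 'w"
    using that by (intro path) (auto simp: space_pair_measure)
qed

lemma integral_measurable:
  fixes f :: "real \<Rightarrow> 'w \<Rightarrow> real"
  assumes f: "(\<lambda>z. f (fst z) (snd z)) \<in> borel_measurable ((borel :: real measure) \<Otimes>\<^sub>M S)" and bd: "\<And>u \<omega>. \<bar>f u \<omega>\<bar> \<le> C"
  shows "(\<lambda>\<omega>. integral {0..t} (\<lambda>u. f u \<omega>)) \<in> borel_measurable S"
proof -
  have f': "(\<lambda>z. f (snd z) (fst z)) \<in> borel_measurable (S \<Otimes>\<^sub>M borel)"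
    using measurable_compose[OF measurable_pair_swap' f] by (simp add: split_beta)
  have "(\<lambda>z. indicator {0..t} (snd z) *\<^sub>R f (snd z) (fst z)) \<in> borel_measurable (S \<Otimes>\<^sub>M borel)"
    using f' by measurable
  then have "case_prod (\<lambda>\<omega> u. indicator {0..t} u *\<^sub>R f u \<omega>) \<in> borel_measurable (S \<Otimes>\<^sub>M lborel)"
    by (simp add: case_prod_beta' cong: measurable_cong_sets)
  then have 1: "(\<lambda>\<omega>. LINT u|lborel. indicator {0..t} u *\<^sub>R f u \<omega>) \<in> borel_measurable S"
    by (rule lborel.borel_measurable_lebesgue_integral)
  have 2: "(LINT u|lborel. indicator {0..t} u *\<^sub>R f u \<omega>) = integral {0..t} (\<lambda>u. f u \<omega>)" if "\<omega> \<in> space S" for \<omega>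
  proof -
    have "(\<lambda>u. f u \<omega>) \<in> borel_measurable borel"
      using measurable_compose[OF measurable_Pair1'[OF that] f'] by simp
    then have "set_integrable lborel {0..t} (\<lambda>u. f u \<omega>)"
      unfolding set_integrable_def using bd
      by (intro integrableI_bounded_set_indicator[where B=C]) (auto simp: emeasure_lborel_Icc_eq)
    from set_borel_integral_eq_integral(2)[OF this] show ?thesis by (simp add: set_lebesgue_integral_def)
  qed
  show ?thesis by (rule iffD2[OF measurable_cong[OF 2[symmetric]] 1])
qed

lemma R_meas: "0 \<le> t \<Longrightarrow> R t \<in> borel_measurable S"
proof -
  assume t: "0 \<le> t"
  interpret P: path_measurability "(borel :: real measure) \<Otimes>\<^sub>M S" "\<lambda>t z. B t (snd z)" "\<lambda>t z. N0 t (snd z)" "\<lambda>t z. m t (snd z)" "\<lambda>k z. X k (snd z)" \<mu> \<sigma> A l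
    by (rule product_measurability)
  \<comment> \<open>\<open>max 0 u\<close> keeps the random time nonnegative on the whole product;
    on {0..t} it changes nothing.\<close>
  have 1: "(\<lambda>\<omega>. integral {0..t} (\<lambda>u. \<mu> (J (max 0 u) \<omega>))) \<in> borel_measurable S"
  proof (rule integral_measurable[where C="Max (range (\<lambda>i. \<bar>\<mu> i\<bar>))"])
    show "(\<lambda>z. \<mu> (J (max 0 (fst z)) (snd z))) \<in> borel_measurable ((borel :: real measure) \<Otimes>\<^sub>M S)"
      by (rule P.function_of_J_at) auto
    show "\<bar>\<mu> (J (max 0 u) \<omega>)\<bar> \<le> Max (range (\<lambda>i. \<bar>\<mu> i\<bar>))" for u \<omega> by (intro Max_ge) auto
  qed
  have "integral {0..t} (\<lambda>u. \<mu> (J (max 0 u) \<omega>)) = integral {0..t} (\<lambda>u. \<mu> (J u \<omega>))" for \<omega>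
    by (rule integral_cong) (simp add: max_absorb2)
  with 1 have drift: "(\<lambda>\<omega>. integral {0..t} (\<lambda>u. \<mu> (J u \<omega>))) \<in> borel_measurable S" by simp
  define h where "h k \<omega> = \<sigma> (J (\<tau>0 k \<omega>) \<omega>)" for k \<omega>
  have h: "h k \<in> borel_measurable S" for k
    unfolding h_def by (rule function_of_J_at[OF \<tau>0_meas \<tau>0_nonneg])
  have Bt: "(\<lambda>\<omega>. B (\<tau>0 k \<omega>) \<omega>) \<in> borel_measurable S" for k by (rule B_at[OF \<tau>0_meas \<tau>0_nonneg])
  have "(\<lambda>\<omega>. (\<Sum>k<K. h k \<omega> * (B (\<tau>0 (Suc k) \<omega>) \<omega> - B (\<tau>0 k \<omega>) \<omega>)) + h K \<omega> * (B t \<omega> - B (\<tau>0 K \<omega>) \<omega>)) \<in> borel_measurable S" for K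
    using h Bt B_meas[OF t] by measurable
  from measurable_compose_countable[OF this N0_meas[OF t]]
  have 2: "(\<lambda>\<omega>. (\<Sum>k<N0 t \<omega>. h k \<omega> * (B (\<tau>0 (Suc k) \<omega>) \<omega> - B (\<tau>0 k \<omega>) \<omega>)) + h (N0 t \<omega>) \<omega> * (B t \<omega> - B (\<tau>0 (N0 t \<omega>) \<omega>) \<omega>)) \<in> borel_measurable S" .
  have eq: "R t \<omega> = integral {0..t} (\<lambda>u. \<mu> (J u \<omega>)) + ((\<Sum>k<N0 t \<omega>. h k \<omega> * (B (\<tau>0 (Suc k) \<omega>) \<omega> - B (\<tau>0 k \<omega>) \<omega>)) + h (N0 t \<omega>) \<omega> * (B t \<omega> - B (\<tau>0 (N0 t \<omega>) \<omega>) \<omega>))"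
    if "\<omega> \<in> space S" for \<omega>
    unfolding mmbm_level_def unbounded_counting.stochastic_integral_eq[OF N0_counting[OF that] t] h_def by simp
  show ?thesis by (rule iffD2[OF measurable_cong[OF eq] borel_measurable_add[OF drift 2]])
qed

lemma R_at: "\<tau> \<in> borel_measurable S \<Longrightarrow> (\<And>\<omega>. \<omega> \<in> space S \<Longrightarrow> 0 \<le> \<tau> \<omega>) \<Longrightarrow> (\<lambda>\<omega>. R (\<tau> \<omega>) \<omega>) \<in> borel_measurable S"
  by (rule borel_measurable_random_time[OF R_meas])
     (auto intro!: continuous_at_right_of modulated_path.continuous_r[OF modulated])

abbreviation "L k \<omega> \<equiv> fluid_L (\<lambda>t. m t \<omega>) (\<lambda>t. R t \<omega>) k"
abbreviation "Lh k \<omega> \<equiv> fluid_Lhat \<mu> \<sigma> l (\<lambda>t. m t \<omega>) (\<lambda>t. R t \<omega>) (\<lambda>t. J t \<omega>) k"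
abbreviation "Hh k \<omega> \<equiv> fluid_Hhat \<mu> \<sigma> l (\<lambda>t. m t \<omega>) (\<lambda>t. R t \<omega>) (\<lambda>t. J t \<omega>) k"
abbreviation "c k \<omega> \<equiv> fluid_epoch \<mu> \<sigma> l (\<lambda>t. m t \<omega>) (\<lambda>t. R t \<omega>) (\<lambda>t. J t \<omega>) k"

text \<open>The infimum over a random interval becomes one over [0, 1] by an affine change of time
  \<open>p\<close>, and by continuity countably many points decide whether it stays within a
  bound.\<close>

lemma L_meas: "L k \<in> borel_measurable S"
proof (rule borel_measurableI_le)
  fix y :: real
  define p where "p q \<omega> = \<theta> k \<omega> + q * (\<theta> (Suc k) \<omega> - \<theta> k \<omega>)" for q \<omega>
  have p: "p q \<in> borel_measurable S" for q unfolding p_def by measurable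
  have mono: "\<theta> k \<omega> \<le> \<theta> (Suc k) \<omega>" if "\<omega> \<in> space S" for \<omega>
    using unbounded_counting.ep_mono_all[OF m_counting[OF that], of k "Suc k"] by simp
  have p0: "p q \<omega> \<in> {\<theta> k \<omega>..\<theta> (Suc k) \<omega>}" if "\<omega> \<in> space S" "q \<in> {0..1}" for q \<omega>
  proof -
    have "q * (\<theta> (Suc k) \<omega> - \<theta> k \<omega>) \<le> 1 * (\<theta> (Suc k) \<omega> - \<theta> k \<omega>)"
      using that mono[OF that(1)] by (intro mult_right_mono) auto
    then show ?thesis using mono[OF that(1)] that(2) by (simp add: p_def)
  qed
  have "{\<omega> \<in> space S. L k \<omega> \<le> y} =
    {\<omega> \<in> space S. \<forall>n. \<forall>i\<le>Suc n. R (\<theta> k \<omega>) \<omega> - R (p (real i / real (Suc n)) \<omega>) \<omega> \<le> y}" (is "?l = ?r")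
  proof (rule Collect_cong, rule conj_cong[OF refl])
    fix \<omega> assume \<omega>: "\<omega> \<in> space S"
    interpret F: fluid_path "\<lambda>t. N0 t \<omega>" "\<lambda>t. B t \<omega>" "\<lambda>k. X k \<omega>" \<mu> \<sigma> A "\<lambda>t. m t \<omega>" l by (rule path[OF \<omega>])
    have p0': "p q \<omega> \<in> {\<theta> k \<omega>..\<theta> (Suc k) \<omega>}" if "q \<in> {0..1}" for q by (rule p0[OF \<omega> that])
    show "L k \<omega> \<le> y \<longleftrightarrow> (\<forall>n. \<forall>i\<le>Suc n. R (\<theta> k \<omega>) \<omega> - R (p (real i / real (Suc n)) \<omega>) \<omega> \<le> y)"
    proof
      assume le: "L k \<omega> \<le> y"
      show "\<forall>n. \<forall>i\<le>Suc n. R (\<theta> k \<omega>) \<omega> - R (p (real i / real (Suc n)) \<omega>) \<omega> \<le> y"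
      proof (intro allI impI)
        fix n i assume "i \<le> Suc n"
        then have "R (\<theta> k \<omega>) \<omega> - R (p (real i / real (Suc n)) \<omega>) \<omega> \<le> fall (\<lambda>t. R t \<omega>) (\<theta> k \<omega>) (\<theta> (Suc k) \<omega>)"
          by (intro fall_ge F.cont_r_gap p0') (auto simp: field_simps)
        then show "R (\<theta> k \<omega>) \<omega> - R (p (real i / real (Suc n)) \<omega>) \<omega> \<le> y" using le F.L_fall[of k] by simp
      qed
    next
      assume le: "\<forall>n. \<forall>i\<le>Suc n. R (\<theta> k \<omega>) \<omega> - R (p (real i / real (Suc n)) \<omega>) \<omega> \<le> y"
      have cont: "continuous_on {0..1} (\<lambda>q. R (\<theta> k \<omega>) \<omega> - R (p q \<omega>) \<omega>)"
        by (intro continuous_intros continuous_on_compose2[OF F.cont_r_gap[of k "\<theta> (Suc k) \<omega>"]])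
           (use p0' in \<open>auto simp: p_def intro!: continuous_intros\<close>)
      have all: "R (\<theta> k \<omega>) \<omega> - R (p q \<omega>) \<omega> \<le> y" if "q \<in> {0..1}" for q
        by (rule le_from_grid[OF cont _ that]) (use le in blast)
      obtain u where u: "u \<in> {\<theta> k \<omega>..\<theta> (Suc k) \<omega>}" "L k \<omega> = R (\<theta> k \<omega>) \<omega> - R u \<omega>"
        using fall_ex[OF F.cont_r_gap mono[OF \<omega>]] unfolding F.L_fall by blast
      have "\<exists>q\<in>{0..1}. u = p q \<omega>"
      proof (cases "\<theta> k \<omega> = \<theta> (Suc k) \<omega>")
        case True then show ?thesis using u(1) by (intro bexI[of _ 0]) (auto simp: p_def)
      next
        case False
        then have lt: "0 < \<theta> (Suc k) \<omega> - \<theta> k \<omega>" using mono[OF \<omega>] by simp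
        show ?thesis
          by (rule bexI[of _ "(u - \<theta> k \<omega>) / (\<theta> (Suc k) \<omega> - \<theta> k \<omega>)"]) (use u(1) lt in \<open>auto simp: p_def\<close>)
      qed
      then show "L k \<omega> \<le> y" using all u(2) by auto
    qed
  qed
  also have "?r \<in> sets S"
  proof -
    have "(\<lambda>\<omega>. R (p (real i / real (Suc n)) \<omega>) \<omega>) \<in> borel_measurable S" if "i \<le> Suc n" for n i
    proof (rule R_at[OF p])
      fix \<omega> assume \<omega>: "\<omega> \<in> space S"
      have "p (real i / real (Suc n)) \<omega> \<in> {\<theta> k \<omega>..\<theta> (Suc k) \<omega>}" using that by (intro p0 \<omega>) (auto simp: field_simps)
      then show "0 \<le> p (real i / real (Suc n)) \<omega>" using \<theta>_nonneg[OF \<omega>, of k] by simp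
    qed
    moreover have "(\<lambda>\<omega>. R (\<theta> k \<omega>) \<omega>) \<in> borel_measurable S" by (rule R_at[OF \<theta>_meas \<theta>_nonneg])
    ultimately have "{\<omega> \<in> space S. R (\<theta> k \<omega>) \<omega> - R (p (real i / real (Suc n)) \<omega>) \<omega> \<le> y} \<in> sets S" if "i \<le> Suc n" for n i
      using that by measurable
    then show ?thesis by (intro sets.sets_Collect_countable_All sets.sets_Collect_countable_Ball) auto
  qed
  finally show "{\<omega> \<in> space S. L k \<omega> \<le> y} \<in> sets S" .
qed

lemma Lh_meas [measurable]: "Lh k \<in> borel_measurable S"
  unfolding fluid_Lhat_def
  by (intro borel_measurable_times L_meas function_of_J_at[OF \<theta>_meas \<theta>_nonneg])

lemma Hh_meas [measurable]: "Hh k \<in> borel_measurable S"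
proof -
  have "fluid_H (\<lambda>t. m t \<omega>) (\<lambda>t. R t \<omega>) k = L k \<omega> + (R (\<theta> (Suc k) \<omega>) \<omega> - R (\<theta> k \<omega>) \<omega>)" for \<omega>
    by (simp add: fluid_L_def fluid_H_def)
  note eq = this
  show ?thesis unfolding fluid_Hhat_def eq
    by (intro borel_measurable_times borel_measurable_add borel_measurable_diff L_meas
        function_of_J_at[OF \<theta>_meas \<theta>_nonneg] R_at[OF \<theta>_meas \<theta>_nonneg])
qed

lemma c_meas [measurable]: "c k \<in> borel_measurable S"
  unfolding fluid_epoch_def by measurable

abbreviation "speed u \<omega> \<equiv> fluid_rate \<mu> \<sigma> l (fluid_phase \<mu> \<sigma> l (\<lambda>t. m t \<omega>) (\<lambda>t. R t \<omega>) (\<lambda>t. J t \<omega>) u)"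

lemma speed_at:
  assumes \<tau> [measurable]: "\<tau> \<in> borel_measurable S"
  shows "(\<lambda>\<omega>. speed (\<tau> \<omega>) \<omega>) \<in> borel_measurable S"
proof -
  \<comment> \<open>For negative times no index exists and \<open>THE\<close> returns a fixed
    unspecified value; uniqueness of the index is what measurability depends on.\<close>
  define I where "I \<omega> = (THE k. c k \<omega> \<le> \<tau> \<omega> \<and> \<tau> \<omega> < c (Suc k) \<omega>)" for \<omega>
  have I: "I \<in> measurable S (count_space UNIV)"
    unfolding I_def
  proof (rule measurable_THE)
    show "Measurable.pred S (\<lambda>\<omega>. c k \<omega> \<le> \<tau> \<omega> \<and> \<tau> \<omega> < c (Suc k) \<omega>)" for k by measurable
    fix \<omega> and k k' assume \<omega>: "\<omega> \<in> space S" and "c k \<omega> \<le> \<tau> \<omega> \<and> \<tau> \<omega> < c (Suc k) \<omega>" "c k' \<omega> \<le> \<tau> \<omega> \<and> \<tau> \<omega> < c (Suc k') \<omega>"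
    interpret F: fluid_path "\<lambda>t. N0 t \<omega>" "\<lambda>t. B t \<omega>" "\<lambda>k. X k \<omega>" \<mu> \<sigma> A "\<lambda>t. m t \<omega>" l by (rule path[OF \<omega>])
    have False if "Suc i \<le> i'" "\<tau> \<omega> < c (Suc i) \<omega>" "c i' \<omega> \<le> \<tau> \<omega>" for i i'
      using F.c_mono[OF that(1)] that by simp
    then show "k = k'" using \<open>c k \<omega> \<le> _ \<and> _\<close> \<open>c k' \<omega> \<le> _ \<and> _\<close> by (metis not_less_eq_eq le_antisym)
  qed auto
  have "(\<lambda>\<omega>. if \<tau> \<omega> < c k \<omega> + Lh k \<omega> then - (l / omega_rate \<mu> \<sigma> l (J (\<theta> k \<omega>) \<omega>)) else l / eta_rate \<mu> \<sigma> l (J (\<theta> k \<omega>) \<omega>)) \<in> borel_measurable S" for k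
    by (intro measurable_If function_of_J_at[OF \<theta>_meas \<theta>_nonneg]) measurable
  from measurable_compose_countable[OF this I]
  have "(\<lambda>\<omega>. if \<tau> \<omega> < c (I \<omega>) \<omega> + Lh (I \<omega>) \<omega> then - (l / omega_rate \<mu> \<sigma> l (J (\<theta> (I \<omega>) \<omega>) \<omega>)) else l / eta_rate \<mu> \<sigma> l (J (\<theta> (I \<omega>) \<omega>) \<omega>)) \<in> borel_measurable S" .
  moreover have "speed (\<tau> \<omega>) \<omega> = (if \<tau> \<omega> < c (I \<omega>) \<omega> + Lh (I \<omega>) \<omega> then - (l / omega_rate \<mu> \<sigma> l (J (\<theta> (I \<omega>) \<omega>) \<omega>)) else l / eta_rate \<mu> \<sigma> l (J (\<theta> (I \<omega>) \<omega>) \<omega>))" for \<omega>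
    by (simp add: fluid_phase_def fluid_rate_def Let_def I_def)
  ultimately show ?thesis by simp
qed

abbreviation "Rn t \<omega> \<equiv> fluid_level \<mu> \<sigma> l (\<lambda>t. m t \<omega>) (\<lambda>t. R t \<omega>) (\<lambda>t. J t \<omega>) t"

definition speed_bound :: real where
  "speed_bound = Max (range (\<lambda>i. \<bar>l / omega_rate \<mu> \<sigma> l i\<bar> + \<bar>l / eta_rate \<mu> \<sigma> l i\<bar>))"

lemma speed_le: "\<bar>speed u \<omega>\<bar> \<le> speed_bound"
proof -
  have "\<bar>fluid_rate \<mu> \<sigma> l p\<bar> \<le> speed_bound" for p
  proof -
    have "\<bar>l / omega_rate \<mu> \<sigma> l i\<bar> + \<bar>l / eta_rate \<mu> \<sigma> l i\<bar> \<le> speed_bound" for i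
      unfolding speed_bound_def by (intro Max_ge) auto
    note le = this
    obtain a i where "p = (a, i)" by (cases p)
    then show ?thesis
      using le[of i] abs_ge_zero[of "l / omega_rate \<mu> \<sigma> l i"] abs_ge_zero[of "l / eta_rate \<mu> \<sigma> l i"]
      by (cases a) (auto simp: fluid_rate_def simp del: abs_divide abs_ge_zero)
  qed
  then show ?thesis .
qed

lemma speed_joint: "(\<lambda>z. speed (fst z) (snd z)) \<in> borel_measurable ((borel :: real measure) \<Otimes>\<^sub>M S)"
proof -
  interpret P: path_measurability "(borel :: real measure) \<Otimes>\<^sub>M S" "\<lambda>t z. B t (snd z)" "\<lambda>t z. N0 t (snd z)" "\<lambda>t z. m t (snd z)" "\<lambda>k z. X k (snd z)" \<mu> \<sigma> A l
    by (rule product_measurability)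
  show ?thesis by (rule P.speed_at) simp
qed

lemma Rn_meas: "Rn t \<in> borel_measurable S"
  unfolding fluid_level_def by (rule integral_measurable[OF speed_joint speed_le])

lemma Rn_continuous:
  assumes "\<omega> \<in> space S" shows "continuous_on {0..t} (\<lambda>s. Rn s \<omega>)"
proof -
  have "(\<lambda>u. speed u \<omega>) \<in> borel_measurable borel"
    using measurable_compose[OF measurable_Pair2'[OF assms] speed_joint] by simp
  then have "(\<lambda>u. speed u \<omega>) integrable_on {0..t}" by (rule bounded_borel_integrable_on[OF _ speed_le])
  then show ?thesis unfolding fluid_level_def by (rule indefinite_integral_continuous_1)
qed

text \<open>Both levels have continuous paths, so the supremum exceeds \<alpha> exactly if the error
  does so at one of countably many grid times.\<close>

theorem sup_error_measurable:
  assumes T: "0 \<le> T"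
  shows "{\<omega> \<in> space S. ereal \<alpha> < (SUP s\<in>{0..T}. ereal \<bar>R s \<omega> - Rn s \<omega>\<bar>)} \<in> sets S"
proof -
  define err where "err s \<omega> = \<bar>R s \<omega> - Rn s \<omega>\<bar>" for s \<omega>
  define grid where "grid n i = T * (real i / real (Suc n))" for n i
  have "{\<omega> \<in> space S. ereal \<alpha> < (SUP s\<in>{0..T}. ereal (err s \<omega>))} =
    {\<omega> \<in> space S. \<exists>n. \<exists>i\<le>Suc n. \<alpha> < err (grid n i) \<omega>}"
  proof (rule Collect_cong, rule conj_cong[OF refl])
    fix \<omega> assume \<omega>: "\<omega> \<in> space S"
    have ran: "T * q \<in> {0..T}" if "q \<in> {0..1}" for q using that T mult_left_mono[of q 1 T] by auto
    have cont: "continuous_on {0..1} (\<lambda>q. err (T * q) \<omega>)"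
      unfolding err_def
    proof (intro continuous_intros)
      show "continuous_on {0..1} (\<lambda>q. R (T * q) \<omega>)"
        by (rule continuous_on_compose2[OF modulated_path.continuous_r[OF modulated[OF \<omega>]]])
           (use ran in \<open>auto intro!: continuous_intros\<close>)
      show "continuous_on {0..1} (\<lambda>q. Rn (T * q) \<omega>)"
        by (rule continuous_on_compose2[OF Rn_continuous[OF \<omega>, of T]])
           (use ran in \<open>auto intro!: continuous_intros\<close>)
    qed
    show "ereal \<alpha> < (SUP s\<in>{0..T}. ereal (err s \<omega>)) \<longleftrightarrow>
      (\<exists>n. \<exists>i\<le>Suc n. \<alpha> < err (grid n i) \<omega>)"
    proof
      assume "ereal \<alpha> < (SUP s\<in>{0..T}. ereal (err s \<omega>))"
      then obtain s where s: "s \<in> {0..T}" "\<alpha> < err s \<omega>" by (auto simp: less_SUP_iff)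
      have "\<exists>q\<in>{0..1}. s = T * q"
      proof (cases "T = 0")
        case True then show ?thesis using s by (intro bexI[of _ 0]) auto
      next
        case False then show ?thesis using s T by (intro bexI[of _ "s / T"]) auto
      qed
      then obtain q where q: "q \<in> {0..1}" "s = T * q" by blast
      show "\<exists>n. \<exists>i\<le>Suc n. \<alpha> < err (grid n i) \<omega>"
      proof (rule ccontr)
        assume "\<not> ?thesis"
        then have "err (grid n i) \<omega> \<le> \<alpha>" if "i \<le> Suc n" for n i
          using that by (meson not_less)
        from le_from_grid[OF cont this[unfolded grid_def] q(1)] s(2) q(2) show False by simp
      qed
    next
      assume "\<exists>n. \<exists>i\<le>Suc n. \<alpha> < err (grid n i) \<omega>"
      then obtain n i where i: "i \<le> Suc n" "\<alpha> < err (grid n i) \<omega>" by blast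
      have "grid n i \<in> {0..T}" unfolding grid_def using i by (intro ran) (auto simp: field_simps)
      then show "ereal \<alpha> < (SUP s\<in>{0..T}. ereal (err s \<omega>))" using i(2) by (auto simp: less_SUP_iff)
    qed
  qed
  also have "\<dots> \<in> sets S"
  proof -
    have "R (grid n i) \<in> borel_measurable S" for n i unfolding grid_def using T by (intro R_meas) auto
    then have "{\<omega> \<in> space S. \<alpha> < err (grid n i) \<omega>} \<in> sets S" for n i
      unfolding err_def using Rn_meas by measurable
    then show ?thesis by (intro sets.sets_Collect_countable_Ex sets.sets_Collect_countable_Bex) auto
  qed
  finally show ?thesis unfolding err_def .
qed

end

subsection \<open>Error bounds outside small events\<close>

context prob_space
begin

lemma AE_from_holds_except:
  assumes "\<And>e. 0 < e \<Longrightarrow> holds_except e P"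
  shows "AE \<omega> in M. P \<omega>"
proof -
  have "\<forall>i. \<exists>A\<in>events. prob A \<le> 1 / real (Suc i) \<and> (\<forall>\<omega>\<in>space M - A. P \<omega>)"
    using assms unfolding holds_except_def by simp
  then obtain A where A: "\<And>i. A i \<in> events" "\<And>i. prob (A i) \<le> 1 / real (Suc i)" "\<And>i \<omega>. \<omega> \<in> space M - A i \<Longrightarrow> P \<omega>"
    by metis
  have "prob (\<Inter>i. A i) \<le> 1 / real (Suc i)" for i
    using A(1) by (intro order_trans[OF finite_measure_mono A(2)[of i]]) auto
  moreover have "(\<lambda>i. 1 / real (Suc i)) \<longlonglongrightarrow> 0" by real_asymp
  ultimately have "prob (\<Inter>i. A i) \<le> 0" by (intro LIMSEQ_le_const) auto
  then have "prob (\<Inter>i. A i) = 0" using measure_nonneg[of M "\<Inter>i. A i"] by linarith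
  moreover have "(\<Inter>i. A i) \<in> events" using A(1) by auto
  ultimately have "(\<Inter>i. A i) \<in> null_sets M" by (simp add: null_sets_def emeasure_eq_measure)
  then show ?thesis by (rule AE_I') (use A(3) in auto)
qed

lemma AE_eventually_from_holds_except:
  assumes "summable e" "\<And>n. n0 \<le> n \<Longrightarrow> holds_except (e n) (P n)"
  shows "AE \<omega> in M. \<forall>\<^sub>F n in sequentially. P n \<omega>"
proof -
  have "\<forall>n. \<exists>A\<in>events. n0 \<le> n \<longrightarrow> prob A \<le> e n \<and> (\<forall>\<omega>\<in>space M - A. P n \<omega>)"
    using assms(2) unfolding holds_except_def by blast
  then obtain A where A: "\<And>n. A n \<in> events" "\<And>n. n0 \<le> n \<Longrightarrow> prob (A n) \<le> e n"
    "\<And>n \<omega>. n0 \<le> n \<Longrightarrow> \<omega> \<in> space M - A n \<Longrightarrow> P n \<omega>" by metis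
  have "summable (\<lambda>n. prob (A n))"
    by (rule summable_comparison_test'[OF assms(1), of n0]) (use A(2) in auto)
  then have "AE \<omega> in M. \<forall>\<^sub>F n in sequentially. \<omega> \<in> space M - A n"
    by (intro borel_cantelli_AE1) (auto simp: A(1) emeasure_eq_measure)
  then show ?thesis
  proof eventually_elim
    case (elim \<omega>)
    with eventually_ge_at_top[of n0] show ?case by eventually_elim (rule A(3))
  qed
qed

end

section \<open>Path estimates combined with the probabilities of the good events\<close>

locale fluid_approximation = drivers M B N X rate
  for M :: "'w measure" and B N and X :: "nat \<Rightarrow> 'w \<Rightarrow> 's::finite" and rate +
  fixes \<mu> \<sigma> :: "'s \<Rightarrow> real" and lam :: "nat \<Rightarrow> real"
  assumes \<sigma>: "0 < \<sigma> i"
    and X_measurable: "X k \<in> measurable M (count_space UNIV)"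
    and rate_0: "0 < rate 0"
    and lam_pos: "0 < lam n"
    and rate_sum: "(\<Sum>i\<le>n. rate i) = lam n / 2"
    and lam_large: "\<forall>\<^sub>F n in sequentially. lam n = 2 * (real n)\<^sup>2"
begin

definition A :: real where
  "A = 1 + (\<Sum>i\<in>UNIV. \<bar>\<mu> i\<bar> + \<sigma> i + 1 / \<sigma> i)"

lemma A_bounds: "1 \<le> A" "\<bar>\<mu> i\<bar> \<le> A" "\<sigma> i \<le> A" "1 / \<sigma> i \<le> A"
proof -
  have nn: "0 \<le> \<bar>\<mu> k\<bar> + \<sigma> k + 1 / \<sigma> k" for k using \<sigma>[of k] by simp
  have "\<bar>\<mu> i\<bar> + \<sigma> i + 1 / \<sigma> i \<le> (\<Sum>i\<in>UNIV. \<bar>\<mu> i\<bar> + \<sigma> i + 1 / \<sigma> i)"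
    by (rule member_le_sum) (use nn in auto)
  moreover have "0 \<le> (\<Sum>i\<in>UNIV. \<bar>\<mu> i\<bar> + \<sigma> i + 1 / \<sigma> i)" by (intro sum_nonneg nn)
  moreover have "0 < \<sigma> i" "0 < 1 / \<sigma> i" using \<sigma>[of i] by auto
  ultimately show "1 \<le> A" "\<bar>\<mu> i\<bar> \<le> A" "\<sigma> i \<le> A" "1 / \<sigma> i \<le> A" unfolding A_def by linarith+
qed

abbreviation "Mn n t \<omega> \<equiv> \<Sum>i\<le>n. N i t \<omega>"

lemma N_measurable: "0 \<le> t \<Longrightarrow> N i t \<in> measurable M (count_space UNIV)"
  using poisson[of i] by (simp add: poisson_process_def poisson_process_axioms_def)

text \<open>The probability of fewer than \<open>k\<close> arrivals up to t is a polynomial in t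
  times exp (- rate 0 t), which tends to 0 because \<open>rate 0\<close> is positive.\<close>

lemma AE_unbounded: "AE \<omega> in M. \<forall>k. \<exists>t\<ge>0. k \<le> N 0 t \<omega>"
  unfolding AE_all_countable
proof
  fix k
  show "AE \<omega> in M. \<exists>t\<ge>0. k \<le> N 0 t \<omega>"
  proof (rule AE_from_holds_except)
    fix e :: real assume e: "0 < e"
    define p where "p t = (\<Sum>j<k. (rate 0 * t) ^ j / fact j * exp (- (rate 0 * t)))" for t
    have "((\<lambda>t. (rate 0 * t) ^ j / fact j * exp (- (rate 0 * t))) \<longlongrightarrow> 0) at_top" for j
      using rate_0 by real_asymp
    then have "(p \<longlongrightarrow> (\<Sum>j<k. 0)) at_top" unfolding p_def by (intro tendsto_sum)
    then have "\<forall>\<^sub>F t in at_top. p t < e" using e by (intro order_tendstoD(2)) auto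
    then have "\<forall>\<^sub>F t in at_top. p t < e \<and> 0 \<le> t" using eventually_ge_at_top[of 0] by eventually_elim auto
    then obtain t where t: "p t < e" "0 \<le> t" using eventually_happens[of _ "at_top :: real filter"] by auto
    define C where "C j = {\<omega>\<in>space M. N 0 t \<omega> - N 0 0 \<omega> = j}" for j
    have [measurable]: "N 0 t \<in> measurable M (count_space UNIV)" "N 0 0 \<in> measurable M (count_space UNIV)"
      using N_measurable t(2) by auto
    have C [measurable]: "C j \<in> events" for j unfolding C_def by measurable
    have pC: "prob (C j) = (rate 0 * t) ^ j / fact j * exp (- (rate 0 * t))" for j
      using poisson_process.poisson_increments_N[OF poisson[of 0], of 0 t j] t(2) by (simp add: C_def)
    have "prob (\<Union>j<k. C j) \<le> (\<Sum>j<k. prob (C j))" by (intro finite_measure_subadditive_finite) auto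
    also have "\<dots> = p t" by (simp add: p_def pC)
    finally have "prob (\<Union>j<k. C j) \<le> e" using t(1) by simp
    moreover have "\<exists>t\<ge>0. k \<le> N 0 t \<omega>" if "\<omega> \<in> space M - (\<Union>j<k. C j)" for \<omega>
    proof -
      have "\<not> N 0 t \<omega> - N 0 0 \<omega> < k" using that by (auto simp: C_def)
      then show ?thesis using t(2) by (intro exI[of _ t]) auto
    qed
    ultimately show "holds_except e (\<lambda>\<omega>. \<exists>t\<ge>0. k \<le> N 0 t \<omega>)"
      unfolding holds_except_def by (intro bexI[of _ "\<Union>j<k. C j"]) auto
  qed
qed

lemma AE_paths: "AE \<omega> in M. \<forall>n. fluid_path (\<lambda>t. N 0 t \<omega>) (\<lambda>t. B t \<omega>) \<mu> \<sigma> A (\<lambda>t. Mn n t \<omega>) (lam n)"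
proof -
  have "AE \<omega> in M. \<forall>n. driving_path (\<lambda>t. Mn n t \<omega>) (\<lambda>t. B t \<omega>)"
    unfolding AE_all_countable
  proof
    fix n
    interpret K: killed_motion M "\<lambda>u \<omega>. 1 * B (0 + u) \<omega>" "\<lambda>u \<omega>. \<Sum>i\<in>{..n}. N i (0 + u) \<omega>" "\<Sum>i\<in>{..n}. rate i" "V {..n} 0 1"
      by (rule killed_motion) auto
    show "AE \<omega> in M. driving_path (\<lambda>t. Mn n t \<omega>) (\<lambda>t. B t \<omega>)" using K.paths by simp
  qed
  moreover have "AE \<omega> in M. \<forall>i. mono_on {0..} (\<lambda>t. N i t \<omega>)"
    unfolding AE_all_countable using poisson_process.mono_N[OF poisson] by blast
  ultimately show ?thesis using AE_unbounded B.B_0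
  proof eventually_elim
    case (elim \<omega>)
    show ?case
    proof
      fix n
      have dp: "driving_path (\<lambda>t. Mn k t \<omega>) (\<lambda>t. B t \<omega>)" for k using elim(1) by blast
      have le: "N 0 t \<omega> \<le> Mn k t \<omega>" for t k by (rule member_le_sum[of 0 "{..k}" "\<lambda>i. N i t \<omega>"]) auto
      have uc: "unbounded_counting (\<lambda>t. Mn k t \<omega>)" for k
      proof -
        interpret driving_path "\<lambda>t. Mn k t \<omega>" "\<lambda>t. B t \<omega>" by (rule dp)
        show ?thesis
        proof
          fix i
          obtain t where t: "0 \<le> t" "i \<le> N 0 t \<omega>" using elim(3) by blast
          show "\<exists>t\<ge>0. i \<le> Mn k t \<omega>" by (intro exI[of _ t] conjI t(1) order_trans[OF t(2) le])
        qed
      qed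
      have c0: "unbounded_counting (\<lambda>t. N 0 t \<omega>)" using uc[of 0] by simp
      have cont: "continuous_on {0..} (\<lambda>t. B t \<omega>)" by (rule driving_path.cont_b[OF dp[of 0]])
      \<comment> \<open>\<open>Mn n\<close> exceeds \<open>N 0\<close> by a sum of nondecreasing
        counts.\<close>
      have refine: "N 0 t \<omega> + Mn n s \<omega> \<le> Mn n t \<omega> + N 0 s \<omega>" if "0 \<le> s" "s \<le> t" for s t
      proof -
        have eq: "Mn n u \<omega> = N 0 u \<omega> + (\<Sum>i\<in>{..n} - {0}. N i u \<omega>)" for u
          by (rule sum.remove) auto
        have "(\<Sum>i\<in>{..n} - {0}. N i s \<omega>) \<le> (\<Sum>i\<in>{..n} - {0}. N i t \<omega>)"
          using elim(2) that by (intro sum_mono) (auto simp: mono_on_def)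
        then show ?thesis unfolding eq by simp
      qed
      show "fluid_path (\<lambda>t. N 0 t \<omega>) (\<lambda>t. B t \<omega>) \<mu> \<sigma> A (\<lambda>t. Mn n t \<omega>) (lam n)"
        unfolding fluid_path_def modulated_path_def modulated_path_axioms_def fluid_path_axioms_def
        using c0 uc cont elim(4) A_bounds \<sigma> lam_pos refine by auto
    qed
  qed
qed

abbreviation "J t \<omega> \<equiv> mmbm_phase (\<lambda>t. N 0 t \<omega>) (\<lambda>k. X k \<omega>) t"
abbreviation "R t \<omega> \<equiv> mmbm_level \<mu> \<sigma> (\<lambda>t. B t \<omega>) (\<lambda>t. N 0 t \<omega>) (\<lambda>k. X k \<omega>) t"
abbreviation "Jn n t \<omega> \<equiv> fluid_phase \<mu> \<sigma> (lam n) (\<lambda>t. Mn n t \<omega>) (\<lambda>t. R t \<omega>) (\<lambda>t. J t \<omega>) t"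
abbreviation "Rn n t \<omega> \<equiv> fluid_level \<mu> \<sigma> (lam n) (\<lambda>t. Mn n t \<omega>) (\<lambda>t. R t \<omega>) (\<lambda>t. J t \<omega>) t"

text \<open>The horizon 5/4 leaves room to the right of T < 1, since (ii) also looks at times after
  T. The second condition permits a small shift in time, which is the best that can hold near a jump
  of the phase.\<close>

definition approximates :: "nat \<Rightarrow> real \<Rightarrow> real \<Rightarrow> 'w \<Rightarrow> bool" where
  "approximates n \<alpha> \<kappa> \<omega> \<longleftrightarrow> (\<forall>s\<in>{0..5/4}.
       \<bar>R s \<omega> - Rn n s \<omega>\<bar> \<le> \<alpha> * (ln (real n) / sqrt (real n)) \<and>
       (\<exists>u\<ge>0. \<bar>u - s\<bar> \<le> \<kappa> * (ln (real n) / real n) \<and> snd (Jn n s \<omega>) = J u \<omega>))"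

lemma good_paths:
  assumes q: "0 < q"
  shows "\<exists>\<alpha> \<kappa> C n0. 0 < \<alpha> \<and> 3 \<le> n0 \<and>
    (\<forall>n\<ge>n0. holds_except (C * real n powr (- q)) (approximates n \<alpha> \<kappa>))"
proof -
  obtain k C1 where k: "\<And>n. 3 \<le> n \<Longrightarrow> holds_except (C1 * real n powr (- q)) (\<lambda>\<omega>. count_good n 1 k (\<lambda>u. N 0 u \<omega>))"
    using count_good_prob[of 1 q] by auto
  \<comment> \<open>The order of choice avoids a circle: the count \<open>k\<close> for windows of
    factor 1 determines \<open>tc\<close> and thus \<kappa>, and only then the count
    \<open>k'\<close> for windows of factor \<kappa> is fixed.\<close>
  define tc where "tc = time_const A (q + 1) (2 * q) k"
  define \<kappa> where "\<kappa> = tc + 3"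
  have tc0: "0 \<le> tc" using q A_bounds(1) by (simp add: tc_def time_const_def)
  have \<kappa>0: "0 < \<kappa>" using tc0 by (simp add: \<kappa>_def)
  obtain k' C2 where k': "\<And>n. 3 \<le> n \<Longrightarrow> holds_except (C2 * real n powr (- q)) (\<lambda>\<omega>. count_good n \<kappa> k' (\<lambda>u. N 0 u \<omega>))"
    using count_good_prob[OF \<kappa>0, of q] by auto
  obtain C3 where C3: "\<And>n. 1 \<le> n \<Longrightarrow> (\<Sum>i\<le>n. rate i) = (real n)\<^sup>2 \<Longrightarrow>
     holds_except (C3 * real n powr (- q)) (\<lambda>\<omega>. gap_good n (\<lambda>u. \<Sum>i\<le>n. N i u \<omega>))"
    using gap_good_prob[of q] by auto
  define cB where "cB = \<kappa> + 2 * (q + 1)"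
  define \<alpha> where "\<alpha> = 4 * (A * (\<kappa> + 2 * (real k' + 1) * cB))"
  have cB0: "0 \<le> cB" using \<kappa>0 q by (simp add: cB_def)
  have \<alpha>0: "0 < \<alpha>"
  proof -
    have "0 < \<kappa> + 2 * (real k' + 1) * cB" using \<kappa>0 cB0 by (intro add_pos_nonneg mult_nonneg_nonneg) auto
    then show ?thesis using A_bounds(1) by (simp add: \<alpha>_def)
  qed
  have "(\<lambda>n. tc * (ln (real n) / real n)) \<longlonglongrightarrow> 0" by real_asymp
  then have "\<forall>\<^sub>F n in sequentially. tc * (ln (real n) / real n) < 1/4" by (rule order_tendstoD(2)) simp
  with lam_large have "\<forall>\<^sub>F n in sequentially. lam n = 2 * (real n)\<^sup>2 \<and> tc * (ln (real n) / real n) < 1/4 \<and> 3 \<le> n"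
    using eventually_ge_at_top[of 3] by eventually_elim auto
  then obtain n1 where n1: "\<And>n. n1 \<le> n \<Longrightarrow> lam n = 2 * (real n)\<^sup>2 \<and> tc * (ln (real n) / real n) < 1/4 \<and> 3 \<le> n"
    unfolding eventually_sequentially by blast
  define C where "C = 16 * exp 4 + (24 + (8 * exp (3/2) + (C1 + (C2 + C3))))"
  show ?thesis
  proof (rule exI[of _ \<alpha>], rule exI[of _ \<kappa>], rule exI[of _ C], rule exI[of _ "max n1 3"],
      intro conjI allI impI \<alpha>0)
    fix n assume "max n1 3 \<le> n"
    then have n: "3 \<le> n" and ln: "lam n = 2 * (real n)\<^sup>2" and small: "tc * (ln (real n) / real n) \<le> 1/4"
      using n1[of n] by auto
    have rs: "(\<Sum>i\<le>n. rate i) = (real n)\<^sup>2" unfolding rate_sum ln by simp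
    have n': "2 \<le> n" "1 \<le> n" using n by auto
    have "holds_except (16 * exp 4 * real n powr (- q) + (24 * real n powr (- q) + (8 * exp (3/2) * real n powr (- q) +
       (C1 * real n powr (- q) + (C2 * real n powr (- q) + (C3 * real n powr (- q) + 0))))))
      (\<lambda>\<omega>. fall_good n (q + 1) (\<lambda>u. B u \<omega>) (\<lambda>u. Mn n u \<omega>) \<and> osc_good n \<kappa> cB (\<lambda>u. B u \<omega>) \<and> sup_good n (2 * q) (\<lambda>u. B u \<omega>)
        \<and> count_good n 1 k (\<lambda>u. N 0 u \<omega>) \<and> count_good n \<kappa> k' (\<lambda>u. N 0 u \<omega>) \<and> gap_good n (\<lambda>u. Mn n u \<omega>) \<and>
        (\<forall>n. fluid_path (\<lambda>t. N 0 t \<omega>) (\<lambda>t. B t \<omega>) \<mu> \<sigma> A (\<lambda>t. Mn n t \<omega>) (lam n)))"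
      unfolding cB_def
      by (intro holds_except_conj fall_good_prob[OF n'(1) rs] osc_good_prob[OF n \<kappa>0] sup_good_prob[OF n'(2)]
          k[OF n] k'[OF n] C3[OF n'(2) rs] holds_except_AE[OF AE_paths])
    then show "holds_except (C * real n powr (- q)) (approximates n \<alpha> \<kappa>)"
    proof (rule holds_except_mono)
      fix \<omega> assume *: "fall_good n (q + 1) (\<lambda>u. B u \<omega>) (\<lambda>u. Mn n u \<omega>) \<and> osc_good n \<kappa> cB (\<lambda>u. B u \<omega>) \<and> sup_good n (2 * q) (\<lambda>u. B u \<omega>)
        \<and> count_good n 1 k (\<lambda>u. N 0 u \<omega>) \<and> count_good n \<kappa> k' (\<lambda>u. N 0 u \<omega>) \<and> gap_good n (\<lambda>u. Mn n u \<omega>) \<and>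
        (\<forall>n. fluid_path (\<lambda>t. N 0 t \<omega>) (\<lambda>t. B t \<omega>) \<mu> \<sigma> A (\<lambda>t. Mn n t \<omega>) (lam n))"
      then interpret F: fluid_path "\<lambda>t. N 0 t \<omega>" "\<lambda>t. B t \<omega>" "\<lambda>k. X k \<omega>" \<mu> \<sigma> A "\<lambda>t. Mn n t \<omega>" "lam n" by blast
      note le = F.level_error[OF n ln, of "q + 1" "2 * q" k cB \<kappa> k']
      show "approximates n \<alpha> \<kappa> \<omega>"
        unfolding approximates_def
      proof (intro ballI conjI)
        fix s :: real assume s: "s \<in> {0..5/4}"
        show "\<bar>R s \<omega> - Rn n s \<omega>\<bar> \<le> \<alpha> * (ln (real n) / sqrt (real n))"
          unfolding \<alpha>_def by (rule le(1)) (use * s q cB0 small in \<open>auto simp: \<kappa>_def tc_def\<close>)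
        show "\<exists>u\<ge>0. \<bar>u - s\<bar> \<le> \<kappa> * (ln (real n) / real n) \<and> snd (Jn n s \<omega>) = J u \<omega>"
          by (rule le(2)) (use * s q cB0 small in \<open>auto simp: \<kappa>_def tc_def\<close>)
      qed
    qed (simp add: C_def algebra_simps)
  qed simp
qed

lemma null_exception:
  obtains Z where "Z \<in> null_sets M"
    "\<And>\<omega> n. \<omega> \<in> space M - Z \<Longrightarrow> fluid_path (\<lambda>t. N 0 t \<omega>) (\<lambda>t. B t \<omega>) \<mu> \<sigma> A (\<lambda>t. Mn n t \<omega>) (lam n)"
  using AE_paths by (elim AE_E3) blast

text \<open>On the null set \<open>Z\<close> the paths may be irregular and the event arbitrary, so
  it is determined only up to a subset of a null set; this is where the completion enters.\<close>

lemma exceedance_measurable: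
  assumes T: "0 \<le> T"
  shows "{\<omega> \<in> space M. ereal \<alpha> < (SUP s\<in>{0..T}. ereal \<bar>R s \<omega> - Rn n s \<omega>\<bar>)} \<in> sets (completion M)"
proof -
  obtain Z where Z: "Z \<in> null_sets M"
    "\<And>\<omega> n. \<omega> \<in> space M - Z \<Longrightarrow> fluid_path (\<lambda>t. N 0 t \<omega>) (\<lambda>t. B t \<omega>) \<mu> \<sigma> A (\<lambda>t. Mn n t \<omega>) (lam n)"
    using null_exception by blast
  define S where "S = restrict_space M (space M - Z)"
  have spS: "space S = space M - Z" by (auto simp: S_def space_restrict_space)
  interpret P: path_measurability S B "N 0" "Mn n" X \<mu> \<sigma> A "lam n"
  proof (rule path_measurability.intro)
    show "B t \<in> borel_measurable S" if "0 \<le> t" for t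
      unfolding S_def by (intro measurable_restrict_space1 B.measurable_B that)
    show "N 0 t \<in> measurable S (count_space UNIV)" if "0 \<le> t" for t
      unfolding S_def by (intro measurable_restrict_space1 N_measurable that)
    show "Mn n t \<in> measurable S (count_space UNIV)" if "0 \<le> t" for t
    proof -
      have [measurable]: "N i t \<in> measurable M (count_space UNIV)" for i by (rule N_measurable[OF that])
      have "Mn n t \<in> measurable M (count_space UNIV)" by measurable
      then show ?thesis unfolding S_def by (intro measurable_restrict_space1)
    qed
    show "X k \<in> measurable S (count_space UNIV)" for k
      unfolding S_def by (intro measurable_restrict_space1 X_measurable)
    show "fluid_path (\<lambda>t. N 0 t \<omega>) (\<lambda>t. B t \<omega>) \<mu> \<sigma> A (\<lambda>t. Mn n t \<omega>) (lam n)" if "\<omega> \<in> space S" for \<omega>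
      using Z(2) that spS by simp
  qed
  define E where "E = {\<omega> \<in> space M. ereal \<alpha> < (SUP s\<in>{0..T}. ereal \<bar>R s \<omega> - Rn n s \<omega>\<bar>)}"
  have "{\<omega> \<in> space S. ereal \<alpha> < (SUP s\<in>{0..T}. ereal \<bar>R s \<omega> - Rn n s \<omega>\<bar>)} \<in> sets S"
    by (rule P.sup_error_measurable[OF T])
  also have "{\<omega> \<in> space S. ereal \<alpha> < (SUP s\<in>{0..T}. ereal \<bar>R s \<omega> - Rn n s \<omega>\<bar>)} = E - Z"
    unfolding spS E_def by blast
  finally have "E - Z \<in> sets M"
    using Z(1) by (auto simp: S_def sets_restrict_space)
  moreover have "E = (E - Z) \<union> (E \<inter> Z)" by blast
  ultimately show ?thesis unfolding E_def[symmetric]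
    using Z(1) by (intro sets_completionI[of E "E - Z" "E \<inter> Z" Z]) auto
qed

theorem level_convergence:
  assumes T: "0 \<le> T" "T < 1" and q: "0 < q"
  shows "\<exists>\<alpha>>0. let E = (\<lambda>n. {\<omega> \<in> space M.
            ereal (\<alpha> * (real n powr (- 1 / 2) * ln (real n)))
              < (SUP s\<in>{0..T}. ereal \<bar>R s \<omega> - Rn n s \<omega>\<bar>)})
      in (\<forall>n. E n \<in> sets (completion M)) \<and>
         (\<lambda>n. measure (completion M) (E n)) \<in> o(\<lambda>n. real n powr (- q))"
proof -
  \<comment> \<open>One power is given away so that the bound O(n^-(q + 1)) becomes o(n^-q).\<close>
  have q1: "0 < q + 1" using q by simp
  from good_paths[OF this] obtain \<alpha> \<kappa> C n0 where good: "0 < \<alpha>" "3 \<le> n0"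
    "\<And>n. n0 \<le> n \<Longrightarrow> holds_except (C * real n powr (- (q + 1))) (approximates n \<alpha> \<kappa>)"
    by blast
  define E where "E n = {\<omega> \<in> space M.
            ereal (\<alpha> * (real n powr (- 1 / 2) * ln (real n)))
              < (SUP s\<in>{0..T}. ereal \<bar>R s \<omega> - Rn n s \<omega>\<bar>)}" for n
  have meas: "E n \<in> sets (completion M)" for n unfolding E_def by (rule exceedance_measurable[OF T(1)])
  have bound: "measure (completion M) (E n) \<le> C * real n powr (- (q + 1))" if n: "n0 \<le> n" for n
  proof -
    from good(3)[OF n] obtain G where G: "G \<in> events" "prob G \<le> C * real n powr (- (q + 1))"
      and G': "\<forall>\<omega>\<in>space M - G. approximates n \<alpha> \<kappa> \<omega>"
      unfolding holds_except_def by (elim bexE conjE)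
    have G3: "\<bar>R s \<omega> - Rn n s \<omega>\<bar> \<le> \<alpha> * (ln (real n) / sqrt (real n))"
      if "\<omega> \<in> space M - G" "s \<in> {0..5/4}" for \<omega> s
    proof -
      note * = bspec[OF G' that(1), unfolded approximates_def]
      from bspec[OF * that(2)] show ?thesis by (rule conjunct1)
    qed
    have eps: "real n powr (- 1 / 2) * ln (real n) = ln (real n) / sqrt (real n)"
    proof -
      have "real n powr (- 1 / 2) = real n powr (- (1 / 2))" by simp
      also have "\<dots> = 1 / sqrt (real n)" unfolding powr_minus_divide by (simp add: powr_half_sqrt)
      finally show ?thesis by simp
    qed
    have "E n \<subseteq> G"
    proof (rule ccontr)
      assume "\<not> E n \<subseteq> G"
      then obtain \<omega> where \<omega>: "\<omega> \<in> E n" "\<omega> \<notin> G" by blast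
      then obtain s where s: "s \<in> {0..T}" "\<alpha> * (ln (real n) / sqrt (real n)) < \<bar>R s \<omega> - Rn n s \<omega>\<bar>"
        unfolding E_def eps by (auto simp: less_SUP_iff)
      have "\<omega> \<in> space M - G" using \<omega> by (auto simp: E_def)
      from G3[OF this, of s] s T show False by auto
    qed
    then have "measure (completion M) (E n) \<le> measure (completion M) G"
      using G(1) by (intro finite_measure.finite_measure_mono[OF prob_space.finite_measure[OF prob_space_completion]]) auto
    also have "\<dots> = prob G" using G(1) by simp
    finally have "measure (completion M) (E n) \<le> prob G" .
    then show ?thesis using G(2) by linarith
  qed
  have "(\<lambda>n. measure (completion M) (E n)) \<in> O(\<lambda>n. real n powr (- (q + 1)))"
  proof (rule bigoI[of _ C], use eventually_ge_at_top[of n0] in eventually_elim)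
    case (elim n)
    then show ?case using bound by simp
  qed
  also have "(\<lambda>n. real n powr (- (q + 1))) \<in> o(\<lambda>n. real n powr (- q))"
    by real_asymp
  finally have "(\<lambda>n. measure (completion M) (E n)) \<in> o(\<lambda>n. real n powr (- q))" .
  then show ?thesis using good(1) meas unfolding E_def Let_def by blast
qed

theorem phase_convergence:
  assumes T: "0 \<le> T" "T < 1"
  shows "AE \<omega> in M. ((\<lambda>\<rho>. limsup (\<lambda>n. SUP s\<in>{s. T - \<rho> < s \<and> s < T + \<rho> \<and> 0 \<le> s}.
            ereal (discrete_metric.dd (snd (Jn n s \<omega>)) (J s \<omega>)))) \<longlongrightarrow> 0) (at_right 0)"
proof -
  \<comment> \<open>The exponent 2 makes the exceptional probabilities summable.\<close>
  from good_paths[OF zero_less_numeral] obtain \<alpha> \<kappa> C n0 where good: "0 < \<alpha>" "3 \<le> n0"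
    "\<And>n. n0 \<le> n \<Longrightarrow> holds_except (C * real n powr (- 2)) (approximates n \<alpha> \<kappa>)"
    by blast
  have sm: "summable (\<lambda>n. C * real n powr (- 2))" by (intro summable_mult) (simp add: summable_real_powr_iff)
  have "AE \<omega> in M. \<forall>\<^sub>F n in sequentially. approximates n \<alpha> \<kappa> \<omega>"
    by (rule AE_eventually_from_holds_except[OF sm good(3)])
  then have ev: "AE \<omega> in M. \<forall>\<^sub>F n in sequentially. \<forall>s\<in>{0..5/4}. \<exists>u\<ge>0. \<bar>u - s\<bar> \<le> \<kappa> * (ln (real n) / real n) \<and> snd (Jn n s \<omega>) = J u \<omega>"
  proof eventually_elim
    case (elim \<omega>)
    then show ?case unfolding approximates_def by eventually_elim blast
  qed
  \<comment> \<open>Almost surely the fixed time T has a neighbourhood without arrivals of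
    \<open>N 0\<close>: an arrival in a window of length at most 2 / Suc i has probability at most
    \<open>rate 0\<close> times that length.\<close>
  have nojump: "AE \<omega> in M. \<exists>i. N 0 (T + 1 / real (Suc i)) \<omega> - N 0 (max 0 (T - 1 / real (Suc i))) \<omega> < 1"
  proof (rule AE_from_holds_except)
    fix e :: real assume e: "0 < e"
    have "(\<lambda>i. rate 0 * (2 / real (Suc i))) \<longlonglongrightarrow> 0" by real_asymp
    then have "\<forall>\<^sub>F i in sequentially. rate 0 * (2 / real (Suc i)) < e" using e by (rule order_tendstoD(2))
    then obtain i where i: "rate 0 * (2 / real (Suc i)) < e" using eventually_happens[of _ sequentially] by auto
    have i0: "0 < 1 / real (Suc i)" by simp
    have st: "0 \<le> max 0 (T - 1 / real (Suc i))" "max 0 (T - 1 / real (Suc i)) \<le> T + 1 / real (Suc i)"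
      using T i0 by linarith+
    have "rate 0 * (T + 1 / real (Suc i) - max 0 (T - 1 / real (Suc i))) \<le> rate 0 * (2 / real (Suc i))"
      using rate_0 T by (intro mult_left_mono) (auto simp: max_def)
    then have le: "(rate 0 * (T + 1 / real (Suc i) - max 0 (T - 1 / real (Suc i)))) ^ 1 \<le> e" using i by simp
    show "holds_except e (\<lambda>\<omega>. \<exists>i. N 0 (T + 1 / real (Suc i)) \<omega> - N 0 (max 0 (T - 1 / real (Suc i))) \<omega> < 1)"
      by (rule holds_except_mono[OF poisson_tail[OF st, of 0 1] le]) blast
  qed
  show ?thesis using ev nojump poisson_process.mono_N[OF poisson, of 0]
  proof eventually_elim
    case (elim \<omega>)
    obtain i where i: "N 0 (T + 1 / real (Suc i)) \<omega> - N 0 (max 0 (T - 1 / real (Suc i))) \<omega> < 1" using elim(2) by blast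
    define \<delta> where "\<delta> = 1 / real (Suc i)"
    have \<delta>: "0 < \<delta>" by (simp add: \<delta>_def)
    define v where "v = max 0 (T - \<delta>)"
    have mono: "N 0 s \<omega> \<le> N 0 t \<omega>" if "0 \<le> s" "s \<le> t" for s t
      using elim(3) that by (auto simp: mono_on_def)
    have const: "N 0 s \<omega> = N 0 v \<omega>" if "0 \<le> s" "T - \<delta> \<le> s" "s \<le> T + \<delta>" for s
    proof (rule antisym)
      have "N 0 s \<omega> \<le> N 0 (T + \<delta>) \<omega>" using that by (intro mono)
      also have "\<dots> \<le> N 0 v \<omega>" using i unfolding v_def \<delta>_def by simp
      finally show "N 0 s \<omega> \<le> N 0 v \<omega>" .
      show "N 0 v \<omega> \<le> N 0 s \<omega>" by (rule mono) (use that in \<open>auto simp: v_def\<close>)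
    qed
    have "(\<lambda>n. \<kappa> * (ln (real n) / real n)) \<longlonglongrightarrow> 0" by real_asymp
    then have small: "\<forall>\<^sub>F n in sequentially. \<kappa> * (ln (real n) / real n) < \<delta> / 2" using \<delta> by (intro order_tendstoD(2)) auto
    define mismatch where "mismatch \<rho> n = (SUP s\<in>{s. T - \<rho> < s \<and> s < T + \<rho> \<and> 0 \<le> s}.
            ereal (discrete_metric.dd (snd (Jn n s \<omega>)) (J s \<omega>)))" for \<rho> n
    have zero: "limsup (\<lambda>n. mismatch \<rho> n) = 0"
      \<comment> \<open>With \<rho> and the time shift both below \<delta> / 2, the time
        \<open>s\<close> and the shifted time \<open>u\<close> lie in the window around T on which
        the phase is constant.\<close>
      if \<rho>: "0 < \<rho>" "\<rho> < \<delta> / 2" "\<rho> < 1/4" for \<rho>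
    proof -
      have "\<forall>\<^sub>F n in sequentially. mismatch \<rho> n = 0"
        using elim(1) small
      proof eventually_elim
        case (elim n)
        have "discrete_metric.dd (snd (Jn n s \<omega>)) (J s \<omega>) = 0" if s: "T - \<rho> < s" "s < T + \<rho>" "0 \<le> s" for s
        proof -
          have "s \<in> {0..5/4}" using s \<rho> T by auto
          then obtain u where u: "0 \<le> u" "\<bar>u - s\<bar> \<le> \<kappa> * (ln (real n) / real n)" "snd (Jn n s \<omega>) = J u \<omega>"
            using elim(1) by blast
          have "T - \<delta> \<le> u" "u \<le> T + \<delta>" using u(2) elim(2) s \<rho> by linarith+
          then have "N 0 u \<omega> = N 0 v \<omega>" using u(1) by (intro const)
          moreover have "N 0 s \<omega> = N 0 v \<omega>" using s \<rho> \<delta> by (intro const) auto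
          ultimately have "J u \<omega> = J s \<omega>" by (simp add: mmbm_phase_def)
          then show ?thesis using u(3) by (simp add: discrete_metric.dd_def)
        qed
        then have "mismatch \<rho> n = (SUP s\<in>{s. T - \<rho> < s \<and> s < T + \<rho> \<and> 0 \<le> s}. 0)"
          unfolding mismatch_def by (intro SUP_cong refl) (auto simp: zero_ereal_def)
        \<comment> \<open>The index set contains T; over an empty set the supremum would be minus
          infinity.\<close>
        also have "\<dots> = 0" using T \<rho> by (intro cSUP_const) (auto intro: exI[of _ T])
        finally show ?case .
      qed
      then have "limsup (\<lambda>n. mismatch \<rho> n) = limsup (\<lambda>n. 0)"
        by (rule Limsup_eq)
      then show ?thesis by (simp add: Limsup_const)
    qed
    have "\<forall>\<^sub>F \<rho> in at_right 0. \<rho> \<in> {0<..<min (\<delta> / 2) (1/4)}" using \<delta> by (intro eventually_at_right_real) auto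
    then have "\<forall>\<^sub>F \<rho> in at_right 0. limsup (\<lambda>n. mismatch \<rho> n) = 0"
      by eventually_elim (use zero in auto)
    then show ?case unfolding mismatch_def by (rule tendsto_eventually)
  qed
qed

end

text \<open>With a zero diagonal all entries are nonnegative and every row sums to 0, which forces Q
  = 0. This yields \<open>0 < lam 0\<close> for the first Poisson rate.\<close>

lemma intensity_matrix_diagonal:
  fixes Q :: "real ^ 's::finite ^ 's"
  assumes "intensity_matrix Q" "Q \<noteq> 0"
  shows "0 < (MAX i. \<bar>Q $ i $ i\<bar>)"
proof (rule ccontr)
  assume "\<not> 0 < (MAX i. \<bar>Q $ i $ i\<bar>)"
  moreover have "\<bar>Q $ i $ i\<bar> \<le> (MAX i. \<bar>Q $ i $ i\<bar>)" for i by (rule Max_ge) auto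
  ultimately have diag: "Q $ i $ i = 0" for i by (metis abs_le_zero_iff not_less order_trans)
  have "0 \<le> Q $ i $ j" for i j
    using assms(1) diag by (cases "i = j") (auto simp: intensity_matrix_def)
  moreover have "(\<Sum>j\<in>UNIV. Q $ i $ j) = 0" for i using assms(1) by (simp add: intensity_matrix_def)
  ultimately have "Q $ i $ j = 0" for i j by (simp add: sum_nonneg_eq_0_iff)
  then show False using assms(2) by (simp add: vec_eq_iff)
qed

theorem theorem1p2:
  fixes M :: "'w measure"
    and p :: "'s::finite pmf"
    and Q :: "real ^ 's ^ 's"
    and \<mu> \<sigma> :: "'s \<Rightarrow> real"
    and lam :: "nat \<Rightarrow> real"
    and B :: "real \<Rightarrow> 'w \<Rightarrow> real"
    and N :: "nat \<Rightarrow> real \<Rightarrow> 'w \<Rightarrow> nat"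
    and X :: "nat \<Rightarrow> 'w \<Rightarrow> 's"
    and R :: "real \<Rightarrow> 'w \<Rightarrow> real"
    and J :: "real \<Rightarrow> 'w \<Rightarrow> 's"
    and Rn :: "nat \<Rightarrow> real \<Rightarrow> 'w \<Rightarrow> real"
    and Jn :: "nat \<Rightarrow> real \<Rightarrow> 'w \<Rightarrow> sign \<times> 's"
    and T :: real
  assumes "intensity_matrix Q"
    and "\<And>i. 0 < \<sigma> i"
    and "Q \<noteq> 0 \<Longrightarrow> lam 0 = 2 * (MAX i. \<bar>Q $ i $ i\<bar>)"
    and "Q = 0 \<Longrightarrow> 0 < lam 0"
    and "\<And>n. 1 \<le> n \<Longrightarrow> lam n = max (lam 0) (2 * (real n)\<^sup>2)"
    and "prob_space M"
    and "standard_brownian_motion M B"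
    and "poisson_process M (N 0) (lam 0 / 2)"
    and "\<And>n. 1 \<le> n \<Longrightarrow> poisson_process M (N n) ((lam n - lam (n - 1)) / 2)"
    and "markov_chain M X p (mat 1 + inverse (lam 0 / 2) *\<^sub>R Q)"
    and "independent_drivers M B N X"
    and "\<And>t \<omega>. J t \<omega> = mmbm_phase (\<lambda>s. N 0 s \<omega>) (\<lambda>k. X k \<omega>) t"
    and "\<And>t \<omega>. R t \<omega> = mmbm_level \<mu> \<sigma> (\<lambda>s. B s \<omega>) (\<lambda>s. N 0 s \<omega>) (\<lambda>k. X k \<omega>) t"
    and "\<And>n t \<omega>. Jn n t \<omega> =
      fluid_phase \<mu> \<sigma> (lam n) (\<lambda>s. \<Sum>i\<le>n. N i s \<omega>) (\<lambda>s. R s \<omega>) (\<lambda>s. J s \<omega>) t"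
    and "\<And>n t \<omega>. Rn n t \<omega> =
      fluid_level \<mu> \<sigma> (lam n) (\<lambda>s. \<Sum>i\<le>n. N i s \<omega>) (\<lambda>s. R s \<omega>) (\<lambda>s. J s \<omega>) t"
    and "0 \<le> T" and "T < 1"
  shows "(\<forall>q>0. \<exists>\<alpha>>0.
      let E = (\<lambda>n. {\<omega> \<in> space M.
            ereal (\<alpha> * (real n powr (- 1 / 2) * ln (real n)))
              < (SUP s\<in>{0..T}. ereal \<bar>R s \<omega> - Rn n s \<omega>\<bar>)})
      in (\<forall>n. E n \<in> sets (completion M)) \<and>
         (\<lambda>n. measure (completion M) (E n)) \<in> o(\<lambda>n. real n powr (- q)))
    \<and> (AE \<omega> in M.
      ((\<lambda>\<rho>. limsup (\<lambda>n. SUP s\<in>{s. T - \<rho> < s \<and> s < T + \<rho> \<and> 0 \<le> s}.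
            ereal (discrete_metric.dd (snd (Jn n s \<omega>)) (J s \<omega>))))
        \<longlongrightarrow> 0) (at_right 0))"
proof -
  define rate where "rate i = (if i = 0 then lam 0 / 2 else (lam i - lam (i - 1)) / 2)" for i :: nat
  have lam0: "0 < lam 0"
    using assms(3,4) intensity_matrix_diagonal[OF assms(1)] by (cases "Q = 0") auto
  interpret fluid_approximation M B N X rate \<mu> \<sigma> lam
  proof (intro fluid_approximation.intro drivers.intro drivers_axioms.intro fluid_approximation_axioms.intro)
    show "prob_space M" by (rule assms(6))
    show "standard_brownian_motion M B" by (rule assms(7))
    show "poisson_process M (N i) (rate i)" for i
      using assms(8) assms(9)[of i] by (cases "i = 0") (auto simp: rate_def)
    show "independent_drivers M B N X" by (rule assms(11))
    show "0 < \<sigma> i" for i by (rule assms(2))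
    show "X k \<in> measurable M (count_space UNIV)" for k
      using assms(10) by (simp add: markov_chain_def markov_chain_axioms_def)
    show "0 < rate 0" using lam0 by (simp add: rate_def)
    show "0 < lam n" for n using lam0 assms(5)[of n] by (cases "n = 0") auto
    show "(\<Sum>i\<le>n. rate i) = lam n / 2" for n
      by (induction n) (auto simp: rate_def field_simps)
    show "\<forall>\<^sub>F n in sequentially. lam n = 2 * (real n)\<^sup>2"
      \<comment> \<open>From n >= 1 and n >= \<open>lam 0\<close> follows \<open>lam 0\<close> <= n
        <= n^2 <= 2 n^2, so the maximum is 2 n^2.\<close>
      using eventually_ge_at_top[of "nat \<lceil>lam 0\<rceil> + 1"]
    proof eventually_elim
      case (elim n)
      then have n: "lam 0 \<le> real n" "1 \<le> real n" by linarith+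
      have "real n * 1 \<le> real n * real n" using n(2) by (intro mult_left_mono) auto
      then have "lam 0 \<le> 2 * (real n)\<^sup>2" using n unfolding power2_eq_square by linarith
      then show ?case using assms(5)[of n] elim by simp
    qed
  qed
  show ?thesis
    unfolding assms(12-15) using level_convergence[OF assms(16,17)] phase_convergence[OF assms(16,17)] by blast
qed

end
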